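(* Let $(W,I)$ be a Coxeter group with set of reflections $T$, let $\preceq$ be any reflection order on $T$, and let $v<w$ in $W$ with respect to the Bruhat order. Then the set of edges $M_{\preceq}([v,w])$ of the Hasse diagram of the Bruhat interval $[v,w]$ is an acyclic complete matching of $[v,w]$.
   Context: $(W,I)$ is a Coxeter group with set of simple reflections $I$, length function $\ell$, Bruhat order $\le$ with cover relation $\lessdot$, and set of reflections $T=\{xsx^{-1} : x\in W, s\in I\}$. For $v\le w$, $[v,w]=\{z\in W : v\le z\le w\}$. Reflection order (Dyer): for $x\in W$ put $N(x)=\{t\in T:\ell(tx)<\ell(x)\}$. A dihedral reflection subgroup $W'$ of $W$ is a subgroup generated by two distinct reflections; its canonical generators are the two elements $r,s$ of $\{t\in T\cap W' : N(t)\cap W'=\{t\}\}$. A total order $\preceq$ on $T$ is a reflection order if for every dihedral reflection subgroup $W'$ with canonical generators $r,s$, either $r\prec rsr\prec rsrsr\prec\cdots\prec srsrs\prec srs\prec s$ or the reverse order $s\prec srs\prec srsrs\prec\cdots\prec rsrsr\prec rsr\prec r$ holds on $T\cap W'$. The Hasse diagram $G(P)$ of a poset $P$ has vertex set $P$ and edges the covering relations of $P$. A matching of $P$ is a set $M$ of edges of $G(P)$ such that every vertex is incident to at most one edge in $M$; it is complete if every vertex is incident to an edge in $M$. Regard $G(P)$ as a directed graph with edges directed from larger to smaller elements, and let $G_M(P)$ be the directed graph obtained by reversing the direction of the edges in $M$. The matching $M$ is acyclic if $G_M(P)$ has no directed cycles. Definition of $M_{\preceq}([v,w])$: label each edge $w_1\lessdot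 w_2$ of $G([v,w])$ by the reflection $\lambda(w_1\lessdot w_2)=w_1w_2^{-1}\in T$. For $x\in[v,w]$ let $E(x)$ be the set of edges of $G([v,w])$ incident to $x$ (edges going up as well as edges going down from $x$); the labels on $E(x)$ are pairwise distinct. Let $E(x,\max)\in E(x)$ be the edge whose label is maximal with respect to $\preceq$. Then $M_{\preceq}([v,w])=\{E(x,\max) : x\in[v,w]\}$. *)

theory Defs
  imports "HOL-Algebra.Multiplicative_Group" "HOL-Algebra.Generated_Groups"
    "HOL-Library.Extended_Nat"
begin

section \<open>Coxeter systems\<close>

definition coxeter_matrix :: "'a set \<Rightarrow> ('a \<Rightarrow> 'a \<Rightarrow> enat) \<Rightarrow> bool" where
  "coxeter_matrix I m \<longleftrightarrow>
     (\<forall>s\<in>I. \<forall>t\<in>I. 1 \<le> m s t \<and> m s t = m t s \<and> (m s t = 1 \<longleftrightarrow> s = t))"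

text \<open>
  The congruence on words over \<open>I\<close> generated by \<open>(s t)\<^sup>k = 1\<close> for \<open>m s t = k < \<infinity>\<close>. Since
  \<open>m s s = 1\<close>, the relation \<open>s s = 1\<close> is included, so every generator is its own inverse and this
  monoid presentation presents the same object as the group presentation with these relators.
\<close>

inductive coxeter_cong :: "'a set \<Rightarrow> ('a \<Rightarrow> 'a \<Rightarrow> enat) \<Rightarrow> 'a list \<Rightarrow> 'a list \<Rightarrow> bool"
  for I :: "'a set" and m :: "'a \<Rightarrow> 'a \<Rightarrow> enat" where
  relator: "us \<in> lists I \<Longrightarrow> vs \<in> lists I \<Longrightarrow> s \<in> I \<Longrightarrow> t \<in> I \<Longrightarrow> m s t = enat k \<Longrightarrow>
     coxeter_cong I m (us @ concat (replicate k [s, t]) @ vs) (us @ vs)"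
| refl: "us \<in> lists I \<Longrightarrow> coxeter_cong I m us us"
| sym: "coxeter_cong I m us vs \<Longrightarrow> coxeter_cong I m vs us"
| trans: "coxeter_cong I m us vs \<Longrightarrow> coxeter_cong I m vs ws \<Longrightarrow> coxeter_cong I m us ws"

definition (in monoid) word_prod :: "'a list \<Rightarrow> 'a" where
  "word_prod ss = foldr (\<otimes>) ss \<one>"

locale coxeter_system = group W for W (structure) +
  fixes I :: "'a set"
  assumes gens_closed: "I \<subseteq> carrier W"
    and generates: "carrier W = word_prod ` lists I"
    and presentation: "\<exists>m. coxeter_matrix I m \<and>
      (\<forall>us\<in>lists I. \<forall>vs\<in>lists I. word_prod us = word_prod vs \<longleftrightarrow> coxeter_cong I m us vs)"
begin

definition len :: "'a \<Rightarrow> nat" where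
  "len w = (LEAST n. \<exists>ss\<in>lists I. length ss = n \<and> word_prod ss = w)"

definition reflections :: "'a set" where
  "reflections = {x \<otimes> s \<otimes> inv x | x s. x \<in> carrier W \<and> s \<in> I}"

definition bruhat_le :: "'a \<Rightarrow> 'a \<Rightarrow> bool" where
  "bruhat_le x y \<longleftrightarrow> x \<in> carrier W \<and>
     (x, y) \<in> {(u, t \<otimes> u) | u t. u \<in> carrier W \<and> t \<in> reflections \<and> len u < len (t \<otimes> u)}\<^sup>*"

definition bruhat_less :: "'a \<Rightarrow> 'a \<Rightarrow> bool" where
  "bruhat_less x y \<longleftrightarrow> bruhat_le x y \<and> x \<noteq> y"

definition bruhat_interval :: "'a \<Rightarrow> 'a \<Rightarrow> 'a set" where
  "bruhat_interval v w = {z \<in> carrier W. bruhat_le v z \<and> bruhat_le z w}"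


section \<open>Reflection orders\<close>

definition left_inversions :: "'a \<Rightarrow> 'a set" where
  "left_inversions x = {t \<in> reflections. len (t \<otimes> x) < len x}"

definition dihedral_reflection_subgroup :: "'a set \<Rightarrow> bool" where
  "dihedral_reflection_subgroup D \<longleftrightarrow>
     (\<exists>t\<in>reflections. \<exists>u\<in>reflections. t \<noteq> u \<and> D = generate W {t, u})"

definition canonical_generators :: "'a set \<Rightarrow> 'a set" where
  "canonical_generators D = {t \<in> reflections \<inter> D. left_inversions t \<inter> D = {t}}"

text \<open>\<open>alt_refl r s 0, alt_refl r s 1, alt_refl r s 2, \<dots>\<close> are \<open>r, rsr, rsrsr, \<dots>\<close>.\<close>

definition alt_refl :: "'a \<Rightarrow> 'a \<Rightarrow> nat \<Rightarrow> 'a" where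
  "alt_refl r s i = (r \<otimes> s) [^] i \<otimes> r"

text \<open>
  The chain \<open>r \<prec> rsr \<prec> rsrsr \<prec> \<cdots> \<prec> srsrs \<prec> srs \<prec> s\<close>. If \<open>rs\<close> has finite order \<open>n\<close>, the dihedral
  group has the \<open>n\<close> reflections \<open>alt_refl r s i\<close> with \<open>i < n\<close>, and
  \<open>alt_refl r s (n - 1 - i) = alt_refl s r i\<close>, so that the last one is \<open>s\<close>. If \<open>rs\<close> has infinite
  order (\<open>ord (r \<otimes> s) = 0\<close>), the chain consists of an increasing sequence starting at \<open>r\<close>, all of
  whose members lie below a decreasing sequence starting at \<open>s\<close>.
\<close>

definition dihedral_chain :: "'a rel \<Rightarrow> 'a \<Rightarrow> 'a \<Rightarrow> bool" where
  "dihedral_chain R r s \<longleftrightarrow>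
     (let lt = (\<lambda>a b. (a, b) \<in> R \<and> a \<noteq> b); n = ord (r \<otimes> s) in
      if n = 0 then
        (\<forall>i j. i < j \<longrightarrow> lt (alt_refl r s i) (alt_refl r s j)) \<and>
        (\<forall>i j. lt (alt_refl r s i) (alt_refl s r j)) \<and>
        (\<forall>i j. i < j \<longrightarrow> lt (alt_refl s r j) (alt_refl s r i))
      else (\<forall>i j. i < j \<and> j < n \<longrightarrow> lt (alt_refl r s i) (alt_refl r s j)))"

definition reflection_order :: "'a rel \<Rightarrow> bool" where
  "reflection_order R \<longleftrightarrow> linear_order_on reflections R \<and>
     (\<forall>D r s. dihedral_reflection_subgroup D \<and> r \<noteq> s \<and> canonical_generators D = {r, s} \<longrightarrow>
        dihedral_chain R r s \<or> dihedral_chain R s r)"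

end


section \<open>Hasse diagrams and matchings\<close>

text \<open>An edge of the Hasse diagram is represented by the pair (smaller element, larger element).\<close>

definition hasse_edges :: "'a set \<Rightarrow> ('a \<Rightarrow> 'a \<Rightarrow> bool) \<Rightarrow> ('a \<times> 'a) set" where
  "hasse_edges P leq = {(x, y). x \<in> P \<and> y \<in> P \<and> leq x y \<and> x \<noteq> y \<and>
     \<not> (\<exists>z\<in>P. leq x z \<and> z \<noteq> x \<and> leq z y \<and> z \<noteq> y)}"

definition incident :: "'a \<Rightarrow> 'a \<times> 'a \<Rightarrow> bool" where
  "incident x e \<longleftrightarrow> x = fst e \<or> x = snd e"

definition matching :: "'a set \<Rightarrow> ('a \<Rightarrow> 'a \<Rightarrow> bool) \<Rightarrow> ('a \<times> 'a) set \<Rightarrow> bool" where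
  "matching P leq M \<longleftrightarrow> M \<subseteq> hasse_edges P leq \<and>
     (\<forall>x\<in>P. \<forall>e\<in>M. \<forall>f\<in>M. incident x e \<and> incident x f \<longrightarrow> e = f)"

definition complete_matching :: "'a set \<Rightarrow> ('a \<Rightarrow> 'a \<Rightarrow> bool) \<Rightarrow> ('a \<times> 'a) set \<Rightarrow> bool" where
  "complete_matching P leq M \<longleftrightarrow> matching P leq M \<and> (\<forall>x\<in>P. \<exists>e\<in>M. incident x e)"

text \<open>
  In the directed graph, edges outside \<open>M\<close> point from the larger to the smaller element and edges
  in \<open>M\<close> point from the smaller to the larger one.
\<close>

definition matching_digraph ::
    "'a set \<Rightarrow> ('a \<Rightarrow> 'a \<Rightarrow> bool) \<Rightarrow> ('a \<times> 'a) set \<Rightarrow> ('a \<times> 'a) set" where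
  "matching_digraph P leq M = (hasse_edges P leq - M)\<inverse> \<union> M"

definition acyclic_matching :: "'a set \<Rightarrow> ('a \<Rightarrow> 'a \<Rightarrow> bool) \<Rightarrow> ('a \<times> 'a) set \<Rightarrow> bool" where
  "acyclic_matching P leq M \<longleftrightarrow> matching P leq M \<and> acyclic (matching_digraph P leq M)"


section \<open>The matching of a Bruhat interval\<close>

context coxeter_system
begin

definition edge_label :: "'a \<times> 'a \<Rightarrow> 'a" where
  "edge_label e = fst e \<otimes> inv (snd e)"

definition interval_edges_at :: "'a \<Rightarrow> 'a \<Rightarrow> 'a \<Rightarrow> ('a \<times> 'a) set" where
  "interval_edges_at v w x = {e \<in> hasse_edges (bruhat_interval v w) bruhat_le. incident x e}"

definition max_edge :: "'a rel \<Rightarrow> 'a \<Rightarrow> 'a \<Rightarrow> 'a \<Rightarrow> 'a \<times> 'a" where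
  "max_edge R v w x = (THE e. e \<in> interval_edges_at v w x \<and>
     (\<forall>f\<in>interval_edges_at v w x. (edge_label f, edge_label e) \<in> R))"

definition bruhat_matching :: "'a rel \<Rightarrow> 'a \<Rightarrow> 'a \<Rightarrow> ('a \<times> 'a) set" where
  "bruhat_matching R v w = max_edge R v w ` bruhat_interval v w"

end

end

(*
  The matching is governed by increasing saturated chains. Right multiplication by a simple
  reflection s does not change the labels of Bruhat covers, except for the covers x < xs. Given an
  increasing chain that starts at xs > x and ends at an element that s lowers, exactly one label of
  the form z s z^-1 can be inserted so that the result is an increasing chain starting at x; a
  reflection order enters only through the way conjugation by t moves the other reflections of a
  dihedral subgroup across t. Together with the dual statement at the other end and the lifting
  property, induction on the length of y shows that every Bruhat interval [x, y] has exactly one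
  increasing chain (Dyer). Applied to intervals of length two, this shows that the first label of
  that chain is minimal and the last one is maximal. Hence, if the edge of label t is maximal at x,
  it is also maximal at t x: at a peak the increasing chain from v to x extends by t to the
  increasing chain from v to t x, whose last label is maximal; valleys are dual, and for
  x < t x < u t x the chain of length two can be exchanged. Along a directed cycle the
  increasing label sequence from v to the lower end of the matched edge would grow
  lexicographically.
*)
theory Submission
  imports Defs
begin

section \<open>Words\<close>

context coxeter_system
begin

text \<open>The hypothesis on the order only constrains dihedral subgroups whose canonical
  generators form a pair. It becomes usable once every dihedral reflection subgroup is known to be
  generated by exactly two canonical generators, and the group theory at the beginning serves this.
  No root system is at hand: signs of roots are replaced by the cocycle N, a parity count on words,
  well defined because a relator contributes every reflection an even number of times. Two
  properties of the order are then isolated. The side rule produces the unique increasing chains;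
  the impossibility of b a = c d for labels a, b, c, d increasing inside one dihedral subgroup
  produces the exchange in intervals of length two. Both survive reversal of the order, so results
  transfer to the reversed order. Since T may be infinite, extremal labels are taken over finite
  sets only, which the finiteness of lower Bruhat intervals supplies, and acyclicity is read off
  from a transitive irreflexive relation.\<close>

lemma gen_closed [simp]: "s \<in> I \<Longrightarrow> s \<in> carrier W"
  using gens_closed by blast

lemma word_prod_Nil [simp]: "word_prod [] = \<one>"
  and word_prod_Cons [simp]: "word_prod (s # ss) = s \<otimes> word_prod ss"
  by (simp_all add: word_prod_def)

lemma word_prod_closed [simp]: "ss \<in> lists I \<Longrightarrow> word_prod ss \<in> carrier W"
  by (induction ss) auto

lemma word_prod_append:
  "us \<in> lists I \<Longrightarrow> vs \<in> lists I \<Longrightarrow> word_prod (us @ vs) = word_prod us \<otimes> word_prod vs"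
  by (induction us) (auto simp: m_assoc)

lemma gen_square [simp]:
  assumes "s \<in> I"
  shows "s \<otimes> s = \<one>"
proof -
  obtain m where m: "coxeter_matrix I m"
    "\<forall>us\<in>lists I. \<forall>vs\<in>lists I. word_prod us = word_prod vs \<longleftrightarrow> coxeter_cong I m us vs"
    using presentation by blast
  have "m s s = enat 1"
    using m(1) assms by (auto simp: coxeter_matrix_def one_enat_def)
  then have "coxeter_cong I m ([] @ concat (replicate 1 [s, s]) @ []) ([] @ [])"
    using assms by (intro coxeter_cong.relator) auto
  then have "coxeter_cong I m [s, s] []" by simp
  then have "word_prod [s, s] = word_prod []"
    using m(2) assms by (metis lists.Cons lists.Nil)
  then show ?thesis
    using assms by simp
qed

lemma gen_inv [simp]: "s \<in> I \<Longrightarrow> inv s = s"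
  by (simp add: inv_equality)

lemma gen_cancel [simp]: "s \<in> I \<Longrightarrow> x \<in> carrier W \<Longrightarrow> s \<otimes> (s \<otimes> x) = x"
  by (simp flip: m_assoc)

lemma word_prod_surj:
  assumes "x \<in> carrier W"
  obtains ss where "ss \<in> lists I" "word_prod ss = x"
  using assms generates by auto

lemma word_prod_rev: "ss \<in> lists I \<Longrightarrow> word_prod (rev ss) = inv (word_prod ss)"
proof (induction ss)
  case (Cons s ss)
  then have "s \<in> I" "ss \<in> lists I" "rev ss \<in> lists I" by (auto simp: in_lists_conv_set)
  with Cons show ?case by (simp add: word_prod_append inv_mult_group)
qed simp

section \<open>Inversions\<close>

text \<open>For a word \<open>s\<^sub>1 \<dots> s\<^sub>n\<close> this counts the \<open>i\<close> with \<open>t = s\<^sub>1 \<dots> s\<^sub>i \<dots> s\<^sub>1\<close>.\<close>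

primrec inversion_count :: "'a list \<Rightarrow> 'a \<Rightarrow> nat" where
  "inversion_count [] t = 0"
| "inversion_count (s # ss) t = of_bool (t = s) + inversion_count ss (s \<otimes> t \<otimes> s)"

lemma inversion_count_append:
  assumes "us \<in> lists I" "t \<in> carrier W"
  shows "inversion_count (us @ vs) t =
    inversion_count us t + inversion_count vs (inv (word_prod us) \<otimes> t \<otimes> word_prod us)"
  using assms
proof (induction us arbitrary: t)
  case (Cons s us)
  then have "s \<in> I" "us \<in> lists I" by auto
  with Cons show ?case by (simp add: inv_mult_group m_assoc)
qed simp

text \<open>The summands run over the 2 k prefix reflections of the alternating word. Peeling off
  its first two letters conjugates x by them, which shifts j by two; these letters themselves
  account for j = 0 and j = 1.\<close>

lemma inversion_count_alternating:
  assumes "s \<in> I" "t \<in> I" "x \<in> carrier W"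
  shows "inversion_count (concat (replicate k [s, t])) x =
    (\<Sum>j<2 * k. of_bool (x = (s \<otimes> t) [^] j \<otimes> s))"
  using assms(3)
proof (induction k arbitrary: x)
  case (Suc k)
  have shift: "t \<otimes> (s \<otimes> x \<otimes> s) \<otimes> t = (s \<otimes> t) [^] j \<otimes> s \<longleftrightarrow> x = (s \<otimes> t) [^] (Suc (Suc j)) \<otimes> s"
    for j :: nat
  proof -
    let ?y = "(s \<otimes> t) [^] j"
    have y: "?y \<in> carrier W" using assms by simp
    have "(s \<otimes> t) [^] (Suc (Suc j)) = (s \<otimes> t) \<otimes> ?y \<otimes> (s \<otimes> t)"
      using assms by (metis gen_closed m_closed nat_pow_Suc nat_pow_Suc2)
    then have e: "(s \<otimes> t) [^] (Suc (Suc j)) \<otimes> s = s \<otimes> t \<otimes> ?y \<otimes> s \<otimes> t \<otimes> s"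
      using assms y by (simp add: m_assoc)
    show ?thesis
    proof
      assume "t \<otimes> (s \<otimes> x \<otimes> s) \<otimes> t = ?y \<otimes> s"
      then have "s \<otimes> (t \<otimes> (t \<otimes> (s \<otimes> x \<otimes> s) \<otimes> t) \<otimes> t) \<otimes> s = s \<otimes> (t \<otimes> (?y \<otimes> s) \<otimes> t) \<otimes> s"
        by simp
      then show "x = (s \<otimes> t) [^] (Suc (Suc j)) \<otimes> s"
        unfolding e using assms Suc.prems y by (simp add: m_assoc)
    next
      assume "x = (s \<otimes> t) [^] (Suc (Suc j)) \<otimes> s"
      then show "t \<otimes> (s \<otimes> x \<otimes> s) \<otimes> t = ?y \<otimes> s"
        unfolding e using assms y by (simp add: m_assoc)
    qed
  qed
  have one: "s \<otimes> x \<otimes> s = t \<longleftrightarrow> x = (s \<otimes> t) [^] Suc 0 \<otimes> s"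
  proof
    assume "s \<otimes> x \<otimes> s = t"
    then have "s \<otimes> (s \<otimes> x \<otimes> s) \<otimes> s = s \<otimes> t \<otimes> s" by simp
    then show "x = (s \<otimes> t) [^] Suc 0 \<otimes> s"
      using assms Suc.prems by (simp add: m_assoc)
  qed (use assms in \<open>simp add: m_assoc\<close>)
  have "inversion_count (concat (replicate (Suc k) [s, t])) x =
    of_bool (x = s) + (of_bool (s \<otimes> x \<otimes> s = t)
      + (\<Sum>j<2 * k. of_bool (t \<otimes> (s \<otimes> x \<otimes> s) \<otimes> t = (s \<otimes> t) [^] j \<otimes> s)))"
    using Suc assms by simp
  also have "\<dots> = (\<Sum>j<2 * Suc k. of_bool (x = (s \<otimes> t) [^] j \<otimes> s))"
    unfolding shift one using assms(1)
    by (simp add: sum.lessThan_Suc_shift del: sum.lessThan_Suc nat_pow_Suc)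
  finally show ?case .
qed simp

text \<open>When the power is trivial, the list of 2 k prefix reflections has period k, so its two
  halves contribute equally.\<close>

lemma even_inversion_count_relator:
  assumes "s \<in> I" "t \<in> I" "x \<in> carrier W" "(s \<otimes> t) [^] k = \<one>"
  shows "even (inversion_count (concat (replicate k [s, t])) x)"
proof -
  let ?f = "\<lambda>j. of_bool (x = (s \<otimes> t) [^] j \<otimes> s) :: nat"
  have "(s \<otimes> t) [^] (j + k) = (s \<otimes> t) [^] j" for j
    using assms by (simp flip: nat_pow_mult)
  then have "(\<Sum>j<k. ?f (j + k)) = (\<Sum>j<k. ?f j)" by simp
  then have "(\<Sum>j<k + k. ?f j) = 2 * (\<Sum>j<k. ?f j)"
    using sum.atLeastLessThan_concat[of 0 k "k + k" ?f] sum.shift_bounds_nat_ivl[of ?f 0 k k]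
    by (simp add: atLeast0LessThan)
  then show ?thesis
    using assms by (simp add: inversion_count_alternating mult_2)
qed

lemma word_prod_concat_replicate:
  "s \<in> I \<Longrightarrow> t \<in> I \<Longrightarrow> word_prod (concat (replicate k [s, t])) = (s \<otimes> t) [^] k"
proof (induction k)
  case (Suc k)
  then have "word_prod (concat (replicate (Suc k) [s, t])) = (s \<otimes> t) \<otimes> (s \<otimes> t) [^] k"
    by (simp add: m_assoc)
  also have "\<dots> = (s \<otimes> t) [^] Suc k"
    using Suc.prems by (simp only: nat_pow_Suc2 gen_closed m_closed)
  finally show ?case .
qed simp

lemma concat_replicate_lists [simp]:
  "us \<in> lists A \<Longrightarrow> concat (replicate k us) \<in> lists A"
  by (induction k) auto

text \<open>A relator has product one, so the conjugation seen by the letters after it is unaffected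
  by its insertion, and its own contribution is even. Hence both parities are invariants of the
  group element.\<close>

lemma word_parity:
  assumes "us \<in> lists I" "vs \<in> lists I" "word_prod us = word_prod vs"
  shows "(even (length us) \<longleftrightarrow> even (length vs)) \<and>
    (\<forall>t\<in>carrier W. even (inversion_count us t) \<longleftrightarrow> even (inversion_count vs t))"
proof -
  obtain m where m:
    "\<forall>us\<in>lists I. \<forall>vs\<in>lists I. word_prod us = word_prod vs \<longleftrightarrow> coxeter_cong I m us vs"
    using presentation by blast
  then have "coxeter_cong I m us vs" using assms by blast
  then show ?thesis
  proof induction
    case (relator us vs s t k)
    let ?r = "concat (replicate k [s, t])"
    have r: "?r \<in> lists I" using relator by simp
    have "coxeter_cong I m ([] @ ?r @ []) ([] @ [])"
      using relator by (intro coxeter_cong.relator) auto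
    then have "coxeter_cong I m ?r []" by simp
    then have "word_prod ?r = word_prod []" using m r by blast
    then have "word_prod ?r = \<one>" by simp
    then have "(s \<otimes> t) [^] k = \<one>"
      using relator by (simp add: word_prod_concat_replicate)
    then have "even (inversion_count ?r x)" if "x \<in> carrier W" for x
      using relator that by (intro even_inversion_count_relator)
    moreover have "even (length ?r)"
      by (induction k) auto
    ultimately show ?case
      using relator r \<open>word_prod ?r = \<one>\<close> by (simp add: inversion_count_append)
  qed simp_all
qed

section \<open>Length and reflections\<close>

lemma len_le: "ss \<in> lists I \<Longrightarrow> len (word_prod ss) \<le> length ss"
  unfolding len_def by (rule Least_le) blast

lemma reduced_word:
  assumes "x \<in> carrier W"
  obtains ss where "ss \<in> lists I" "word_prod ss = x" "length ss = len x"
proof -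
  obtain us where "us \<in> lists I" "word_prod us = x" using word_prod_surj assms by blast
  then have "\<exists>n. \<exists>ss\<in>lists I. length ss = n \<and> word_prod ss = x" by blast
  from LeastI_ex[OF this] show ?thesis using that unfolding len_def by blast
qed

lemma even_len_word_prod:
  assumes "ss \<in> lists I"
  shows "even (len (word_prod ss)) \<longleftrightarrow> even (length ss)"
proof -
  obtain us where us: "us \<in> lists I" "word_prod us = word_prod ss" "length us = len (word_prod ss)"
    using reduced_word assms word_prod_closed by blast
  then show ?thesis using word_parity[OF us(1) assms us(2)] by simp
qed

lemma even_len_mult:
  assumes "x \<in> carrier W" "y \<in> carrier W"
  shows "even (len (x \<otimes> y)) \<longleftrightarrow> (even (len x) \<longleftrightarrow> even (len y))"
proof -
  obtain us vs where "us \<in> lists I" "word_prod us = x" "vs \<in> lists I" "word_prod vs = y"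
    using assms word_prod_surj by metis
  then show ?thesis
    using even_len_word_prod[of us] even_len_word_prod[of vs] even_len_word_prod[of "us @ vs"]
    by (auto simp: word_prod_append)
qed

lemma len_one [simp]: "len \<one> = 0"
  using len_le[of "[]"] by simp

lemma len_inv [simp]:
  assumes "x \<in> carrier W"
  shows "len (inv x) = len x"
proof -
  have "len (inv y) \<le> len y" if y: "y \<in> carrier W" for y
  proof -
    obtain ss where "ss \<in> lists I" "word_prod ss = y" "length ss = len y"
      using reduced_word y by blast
    then show ?thesis using len_le[of "rev ss"] by (simp add: word_prod_rev in_lists_conv_set)
  qed
  from this[OF assms] this[of "inv x"] assms show ?thesis by simp
qed

lemma len_mult_le:
  assumes "x \<in> carrier W" "y \<in> carrier W"
  shows "len (x \<otimes> y) \<le> len x + len y"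
proof -
  obtain us vs where "us \<in> lists I" "word_prod us = x" "length us = len x"
    "vs \<in> lists I" "word_prod vs = y" "length vs = len y"
    using assms reduced_word by metis
  then show ?thesis using len_le[of "us @ vs"] by (simp add: word_prod_append)
qed

lemma odd_len_gen: "s \<in> I \<Longrightarrow> odd (len s)"
  using even_len_word_prod[of "[s]"] by simp

lemma len_gen [simp]: "s \<in> I \<Longrightarrow> len s = 1"
  using len_le[of "[s]"] odd_len_gen[of s] by (auto simp: le_Suc_eq)

lemma reflectionE:
  assumes "t \<in> reflections"
  obtains x s where "x \<in> carrier W" "s \<in> I" "t = x \<otimes> s \<otimes> inv x"
  using assms unfolding reflections_def by blast

lemma reflectionI: "x \<in> carrier W \<Longrightarrow> s \<in> I \<Longrightarrow> x \<otimes> s \<otimes> inv x \<in> reflections"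
  unfolding reflections_def by blast

lemma reflection_closed [simp]: "t \<in> reflections \<Longrightarrow> t \<in> carrier W"
  by (auto simp: reflections_def)

lemma gen_reflection [simp]:
  assumes "s \<in> I"
  shows "s \<in> reflections"
proof -
  have "s = \<one> \<otimes> s \<otimes> inv \<one>" using assms by simp
  then show ?thesis using reflectionI[of \<one> s] assms by simp
qed

lemma reflection_square [simp]: "t \<in> reflections \<Longrightarrow> t \<otimes> t = \<one>"
proof (unfold reflections_def, clarify)
  fix x s assume xs: "x \<in> carrier W" "s \<in> I"
  then have "inv x \<otimes> (x \<otimes> (s \<otimes> inv x)) = s \<otimes> inv x" by (simp flip: m_assoc)
  with xs show "x \<otimes> s \<otimes> inv x \<otimes> (x \<otimes> s \<otimes> inv x) = \<one>"
    by (simp add: m_assoc)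
qed

lemma reflection_cancel [simp]: "t \<in> reflections \<Longrightarrow> x \<in> carrier W \<Longrightarrow> t \<otimes> (t \<otimes> x) = x"
  by (simp flip: m_assoc)

lemma reflection_inv [simp]: "t \<in> reflections \<Longrightarrow> inv t = t"
  by (simp add: inv_equality)

lemma inv_cancel_left [simp]:
  "x \<in> carrier W \<Longrightarrow> y \<in> carrier W \<Longrightarrow> inv x \<otimes> (x \<otimes> y) = y"
  "x \<in> carrier W \<Longrightarrow> y \<in> carrier W \<Longrightarrow> x \<otimes> (inv x \<otimes> y) = y"
  by (simp_all flip: m_assoc)

lemma conj_reflection:
  assumes "x \<in> carrier W" "t \<in> reflections"
  shows "x \<otimes> t \<otimes> inv x \<in> reflections" "inv x \<otimes> t \<otimes> x \<in> reflections"
proof -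
  have *: "y \<otimes> t \<otimes> inv y \<in> reflections" if "y \<in> carrier W" for y
  proof -
    obtain z s where zs: "z \<in> carrier W" "s \<in> I" "t = z \<otimes> s \<otimes> inv z"
      using assms reflectionE by blast
    then have "y \<otimes> t \<otimes> inv y = (y \<otimes> z) \<otimes> s \<otimes> inv (y \<otimes> z)"
      using that by (simp add: m_assoc inv_mult_group)
    then show ?thesis using reflectionI[of "y \<otimes> z" s] zs that by simp
  qed
  show "x \<otimes> t \<otimes> inv x \<in> reflections" "inv x \<otimes> t \<otimes> x \<in> reflections"
    using *[of x] *[of "inv x"] assms by simp_all
qed

lemma reflection_conj: "t \<in> reflections \<Longrightarrow> u \<in> reflections \<Longrightarrow> t \<otimes> u \<otimes> t \<in> reflections"
  using conj_reflection[of t u] by simp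

lemma odd_len_reflection:
  assumes "t \<in> reflections"
  shows "odd (len t)"
proof -
  obtain x s where "x \<in> carrier W" "s \<in> I" "t = x \<otimes> s \<otimes> inv x"
    using assms reflectionE by blast
  then show ?thesis by (simp add: even_len_mult)
qed

lemma reflection_neq_one: "t \<in> reflections \<Longrightarrow> t \<noteq> \<one>"
  using odd_len_reflection by force

section \<open>The reflection cocycle\<close>

text \<open>Membership in Dyer's reflection cocycle N(x). By \<open>word_parity\<close> every word
  for x gives the same answer for t in the carrier, so the choice of word is harmless.\<close>

definition odd_inversion :: "'a \<Rightarrow> 'a \<Rightarrow> bool" where
  "odd_inversion x t \<longleftrightarrow> (\<exists>ss\<in>lists I. word_prod ss = x \<and> odd (inversion_count ss t))"

lemma odd_inversion_word_prod:
  "ss \<in> lists I \<Longrightarrow> t \<in> carrier W \<Longrightarrow> odd_inversion (word_prod ss) t \<longleftrightarrow> odd (inversion_count ss t)"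
  unfolding odd_inversion_def using word_parity by blast

text \<open>The cocycle rule, addition of sets being symmetric difference. It does the work of sign
  computations with roots.\<close>

lemma odd_inversion_mult:
  assumes "x \<in> carrier W" "y \<in> carrier W" "t \<in> carrier W"
  shows "odd_inversion (x \<otimes> y) t \<longleftrightarrow> (odd_inversion x t \<noteq> odd_inversion y (inv x \<otimes> t \<otimes> x))"
proof -
  obtain us vs where "us \<in> lists I" "word_prod us = x" "vs \<in> lists I" "word_prod vs = y"
    using assms word_prod_surj by metis
  then show ?thesis
    using odd_inversion_word_prod[of us t] odd_inversion_word_prod[of vs "inv x \<otimes> t \<otimes> x"]
      odd_inversion_word_prod[of "us @ vs" t] assms
    by (auto simp: word_prod_append inversion_count_append)
qed

lemma odd_inversion_one [simp]: "t \<in> carrier W \<Longrightarrow> \<not> odd_inversion \<one> t"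
  using odd_inversion_word_prod[of "[]" t] by simp

lemma odd_inversion_gen: "s \<in> I \<Longrightarrow> t \<in> carrier W \<Longrightarrow> odd_inversion s t \<longleftrightarrow> t = s"
  using odd_inversion_word_prod[of "[s]" t] by simp

text \<open>Write t as x s followed by the inverse of x. The outer factors contribute equally,
  because they must cancel in the product of x and its inverse; what is left is the single
  contribution of s.\<close>

lemma odd_inversion_self:
  assumes "t \<in> reflections"
  shows "odd_inversion t t"
proof -
  obtain x s where xs: "x \<in> carrier W" "s \<in> I" and t: "t = x \<otimes> s \<otimes> inv x"
    using assms reflectionE by blast
  have c: "inv x \<otimes> t \<otimes> x = s" using xs by (simp add: t m_assoc)
  have "odd_inversion (x \<otimes> (s \<otimes> inv x)) t \<longleftrightarrow> (odd_inversion x t \<noteq> odd_inversion (s \<otimes> inv x) s)"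
    using xs assms by (simp add: odd_inversion_mult c)
  moreover have "odd_inversion (s \<otimes> inv x) s \<longleftrightarrow> \<not> odd_inversion (inv x) s"
    using xs by (simp add: odd_inversion_mult odd_inversion_gen)
  moreover have "odd_inversion x t = odd_inversion (inv x) s"
    using odd_inversion_mult[of x "inv x" t] xs assms c by simp
  ultimately show ?thesis using xs by (simp add: t m_assoc)
qed

text \<open>Multiplication by a prefix reflection deletes the letter at which the prefix turns
  around: this is the strong exchange condition. It only asks that t occur among the prefix
  reflections; oddness is the way to guarantee an occurrence.\<close>

lemma delete_letter:
  assumes "ss \<in> lists I" "t \<in> carrier W" "inversion_count ss t > 0"
  shows "\<exists>us\<in>lists I. length us < length ss \<and> word_prod us = t \<otimes> word_prod ss"
  using assms
proof (induction ss arbitrary: t)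
  case (Cons s ss)
  then have s: "s \<in> I" "ss \<in> lists I" by auto
  show ?case
  proof (cases "t = s")
    case True
    then show ?thesis using s by (intro bexI[of _ ss]) auto
  next
    case False
    then have "inversion_count ss (s \<otimes> t \<otimes> s) > 0" "s \<otimes> t \<otimes> s \<in> carrier W"
      using Cons.prems s by auto
    then obtain us where us: "us \<in> lists I" "length us < length ss"
      "word_prod us = s \<otimes> t \<otimes> s \<otimes> word_prod ss"
      using Cons.IH by blast
    then show ?thesis
      using s Cons.prems by (intro bexI[of _ "s # us"]) (simp_all add: m_assoc)
  qed
qed simp

lemma len_reflection_mult_less:
  assumes "x \<in> carrier W" "t \<in> carrier W" "odd_inversion x t"
  shows "len (t \<otimes> x) < len x"
proof -
  obtain ss where ss: "ss \<in> lists I" "word_prod ss = x" "length ss = len x"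
    using reduced_word assms by blast
  then have "odd (inversion_count ss t)" using odd_inversion_word_prod assms by metis
  then have "inversion_count ss t > 0" by (rule odd_pos)
  then obtain us where "us \<in> lists I" "length us < len x" "word_prod us = t \<otimes> x"
    using delete_letter ss assms by metis
  then show ?thesis using len_le by fastforce
qed

text \<open>If t has even count for x, the cocycle rule and \<open>odd_inversion_self\<close> give
  it odd count for t x, so passing from t x to t (t x) = x shortens. Thus parity and length define
  the same set.\<close>

lemma left_inversion_iff:
  assumes "x \<in> carrier W"
  shows "t \<in> left_inversions x \<longleftrightarrow> t \<in> reflections \<and> odd_inversion x t"
proof (cases "t \<in> reflections")
  case True
  have "\<not> len (t \<otimes> x) < len x" if "\<not> odd_inversion x t"
  proof -
    have "odd_inversion (t \<otimes> x) t"
      using odd_inversion_mult[of t x t] odd_inversion_self[OF True] True assms that by simp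
    then have "len (t \<otimes> (t \<otimes> x)) < len (t \<otimes> x)"
      using True assms by (intro len_reflection_mult_less) auto
    then show ?thesis using True assms by simp
  qed
  then show ?thesis
    using True assms len_reflection_mult_less by (auto simp: left_inversions_def)
qed (simp add: left_inversions_def)

lemma left_inversions_mult:
  assumes "x \<in> carrier W" "y \<in> carrier W" "t \<in> reflections"
  shows "t \<in> left_inversions (x \<otimes> y) \<longleftrightarrow>
    (t \<in> left_inversions x) \<noteq> (inv x \<otimes> t \<otimes> x \<in> left_inversions y)"
  using assms by (simp add: left_inversion_iff odd_inversion_mult conj_reflection)

lemma left_inversions_one [simp]: "left_inversions \<one> = {}"
  by (simp add: left_inversions_def)

lemma left_inversions_gen [simp]: "s \<in> I \<Longrightarrow> left_inversions s = {s}"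
  using odd_inversion_gen by (auto simp: left_inversion_iff)

lemma self_left_inversion: "t \<in> reflections \<Longrightarrow> t \<in> left_inversions t"
  by (simp add: left_inversion_iff odd_inversion_self)

lemma len_reflection_mult_neq:
  assumes "x \<in> carrier W" "t \<in> reflections"
  shows "len (t \<otimes> x) \<noteq> len x"
  using even_len_mult[of t x] odd_len_reflection[of t] assms by force

lemma not_left_inversion:
  assumes "x \<in> carrier W" "t \<in> reflections"
  shows "t \<notin> left_inversions x \<longleftrightarrow> len x < len (t \<otimes> x)"
  using len_reflection_mult_neq[OF assms] assms(2) by (auto simp: left_inversions_def)

text \<open>After conjugation by x the claim concerns a reflection q that commutes with s and
  differs from it. The factor s then neither contributes nor moves q, so the contributions of x and
  its inverse cancel as they do in the trivial product.\<close>

lemma commuting_not_left_inversion: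
  assumes "t \<in> reflections" "p \<in> reflections" "p \<noteq> t" "p \<otimes> t = t \<otimes> p"
  shows "p \<notin> left_inversions t"
proof -
  obtain x s where xs: "x \<in> carrier W" "s \<in> I" and t: "t = x \<otimes> s \<otimes> inv x"
    using assms(1) reflectionE by blast
  define q where "q = inv x \<otimes> p \<otimes> x"
  have q: "q \<in> reflections" using xs assms conj_reflection by (simp add: q_def)
  have p: "p = x \<otimes> q \<otimes> inv x" using xs assms by (simp add: q_def m_assoc)
  have "q \<noteq> s" using assms(3) p t by auto
  have "inv x \<otimes> (p \<otimes> t) \<otimes> x = inv x \<otimes> (t \<otimes> p) \<otimes> x" using assms(4) by simp
  then have "q \<otimes> s = s \<otimes> q" using xs q by (simp add: p t m_assoc)
  then have sqs: "s \<otimes> q \<otimes> s = q" using xs q by (simp add: m_assoc)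
  have "p \<in> left_inversions (x \<otimes> (s \<otimes> inv x)) \<longleftrightarrow>
      (p \<in> left_inversions x) \<noteq> (q \<in> left_inversions (s \<otimes> inv x))"
    using xs assms by (subst left_inversions_mult) (auto simp: q_def)
  moreover have "q \<in> left_inversions (s \<otimes> inv x) \<longleftrightarrow> q \<in> left_inversions (inv x)"
    using xs q sqs \<open>q \<noteq> s\<close> by (subst left_inversions_mult) auto
  moreover have "p \<in> left_inversions (x \<otimes> inv x) \<longleftrightarrow>
      (p \<in> left_inversions x) \<noteq> (q \<in> left_inversions (inv x))"
    using xs assms by (subst left_inversions_mult) (auto simp: q_def)
  ultimately show ?thesis using xs by (simp add: t m_assoc)
qed

lemma left_descent:
  assumes "x \<in> carrier W" "x \<noteq> \<one>"
  obtains s where "s \<in> I" "len (s \<otimes> x) < len x"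
proof -
  obtain ss where ss: "ss \<in> lists I" "word_prod ss = x" "length ss = len x"
    using reduced_word assms by blast
  then obtain s us where "ss = s # us" using assms(2) by (cases ss) auto
  then have us: "s \<in> I" "us \<in> lists I" "x = s \<otimes> word_prod us" "Suc (length us) = len x"
    using ss by auto
  moreover have "s \<otimes> x = word_prod us" using us by simp
  ultimately show ?thesis using that[of s] len_le[of us] by simp
qed

lemma right_descent:
  assumes "x \<in> carrier W" "x \<noteq> \<one>"
  obtains s where "s \<in> I" "len (x \<otimes> s) < len x"
proof -
  have "inv x \<noteq> \<one>" using assms by (metis inv_inv inv_one)
  then obtain s where s: "s \<in> I" "len (s \<otimes> inv x) < len (inv x)"
    using left_descent assms inv_closed by metis
  have "s \<otimes> inv x = inv (x \<otimes> s)" using s assms by (simp add: inv_mult_group)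
  then show ?thesis using that[of s] s assms by (metis gen_closed len_inv m_closed)
qed

text \<open>Take a left descent s of t. As s t and t s are mutually inverse, they are equally long,
  and s remains a left descent of t s unless it commutes with t, which
  \<open>commuting_not_left_inversion\<close> excludes.\<close>

lemma shorter_conjugate:
  assumes "t \<in> reflections" "t \<notin> I"
  obtains s where "s \<in> I" "len (s \<otimes> t \<otimes> s) < len t"
proof -
  obtain s where s: "s \<in> I" "len (s \<otimes> t) < len t"
    using left_descent reflection_neq_one assms reflection_closed by metis
  have "s \<in> left_inversions t" using s by (simp add: left_inversions_def)
  then have "s \<otimes> t \<noteq> t \<otimes> s" using commuting_not_left_inversion[of t s] assms s by auto
  then have "t \<otimes> s \<otimes> t \<noteq> s"
    using s assms by (metis gen_closed m_assoc m_closed reflection_closed reflection_square r_one)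
  then have "s \<in> left_inversions (t \<otimes> s)"
    using left_inversions_mult[of t s s] s assms \<open>s \<in> left_inversions t\<close> by simp
  then have "len (s \<otimes> (t \<otimes> s)) < len (t \<otimes> s)" by (simp add: left_inversions_def)
  also have "len (t \<otimes> s) = len (s \<otimes> t)"
    using len_inv[of "s \<otimes> t"] s assms by (simp add: inv_mult_group)
  finally show ?thesis using that s assms by (simp add: m_assoc)
qed

section \<open>Dihedral groups\<close>

text \<open>Integer indices join both alternating chains into one two-sided sequence with r at 0 and
  s at -1. Conjugation then acts as j \<mapsto> 2 i - j, and for finite order n of
  \<open>r \<otimes> s\<close> indices count modulo n.\<close>

definition dihedral_reflection :: "'a \<Rightarrow> 'a \<Rightarrow> int \<Rightarrow> 'a" where
  "dihedral_reflection r s k = (r \<otimes> s) [^] k \<otimes> r"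

lemma involution_int_pow:
  assumes "r \<in> reflections" "s \<in> reflections"
  shows "r \<otimes> (r \<otimes> s) [^] (k::int) = (r \<otimes> s) [^] (- k) \<otimes> r"
proof -
  let ?c = "r \<otimes> s"
  have c: "?c \<in> carrier W" using assms by simp
  have nat: "r \<otimes> ?c [^] (int n) = ?c [^] (- int n) \<otimes> r" for n
  proof (induction n)
    case (Suc n)
    have "r \<otimes> ?c [^] int (Suc n) = r \<otimes> ?c [^] int n \<otimes> ?c"
      using c assms int_pow_mult[OF c, of "int n" 1] by (simp add: m_assoc add.commute)
    also have "\<dots> = ?c [^] (- int n) \<otimes> (r \<otimes> ?c)"
      using c assms Suc by (simp add: m_assoc)
    also have "r \<otimes> ?c = ?c [^] (- 1 :: int) \<otimes> r"
      using c assms by (simp add: int_pow_neg inv_mult_group m_assoc)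
    also have "?c [^] (- int n) \<otimes> (?c [^] (- 1 :: int) \<otimes> r) = ?c [^] (- int (Suc n)) \<otimes> r"
    proof -
      have "- int (Suc n) = - int n + - 1" by simp
      then show ?thesis using c assms by (simp only: int_pow_mult) (simp add: m_assoc)
    qed
    finally show ?case .
  qed (use assms in simp)
  show ?thesis
  proof (cases "k \<ge> 0")
    case True
    then show ?thesis using nat[of "nat k"] by simp
  next
    case False
    define n where "n = nat (- k)"
    have k: "k = - int n" using False by (simp add: n_def)
    have "r \<otimes> (r \<otimes> ?c [^] (int n)) \<otimes> r = r \<otimes> (?c [^] (- int n) \<otimes> r) \<otimes> r" using nat by simp
    then show ?thesis using c assms by (simp add: k m_assoc)
  qed
qed

lemma dihedral_reflection_closed [simp]:
  "r \<in> reflections \<Longrightarrow> s \<in> reflections \<Longrightarrow> dihedral_reflection r s k \<in> carrier W"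
  by (simp add: dihedral_reflection_def)

lemma rotation_mult_dihedral_reflection:
  assumes "r \<in> reflections" "s \<in> reflections"
  shows "(r \<otimes> s) [^] j \<otimes> dihedral_reflection r s k = dihedral_reflection r s (j + k)"
  using assms by (simp add: dihedral_reflection_def int_pow_mult m_assoc)

lemma dihedral_reflection_mult:
  assumes "r \<in> reflections" "s \<in> reflections"
  shows "dihedral_reflection r s j \<otimes> dihedral_reflection r s k = (r \<otimes> s) [^] (j - k)"
proof -
  let ?c = "r \<otimes> s"
  have "dihedral_reflection r s j \<otimes> dihedral_reflection r s k = ?c [^] j \<otimes> (r \<otimes> ?c [^] k) \<otimes> r"
    using assms by (simp add: dihedral_reflection_def m_assoc)
  also have "\<dots> = ?c [^] j \<otimes> ?c [^] (- k)"
    using assms by (simp add: involution_int_pow m_assoc)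
  finally show ?thesis using assms by (simp flip: int_pow_mult)
qed

lemma dihedral_reflection_conj:
  assumes "r \<in> reflections" "s \<in> reflections"
  shows "dihedral_reflection r s j \<otimes> dihedral_reflection r s k \<otimes> dihedral_reflection r s j =
    dihedral_reflection r s (2 * j - k)"
  using assms by (simp add: dihedral_reflection_mult rotation_mult_dihedral_reflection)

lemma dihedral_reflection_0 [simp]: "r \<in> reflections \<Longrightarrow> s \<in> reflections \<Longrightarrow> dihedral_reflection r s 0 = r"
  by (simp add: dihedral_reflection_def)

lemma dihedral_reflection_minus_1 [simp]:
  "r \<in> reflections \<Longrightarrow> s \<in> reflections \<Longrightarrow> dihedral_reflection r s (- 1) = s"
  by (simp add: dihedral_reflection_def int_pow_neg inv_mult_group m_assoc)

text \<open>Conjugation by a power of the rotation shifts the index by an even amount, so even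
  indices give conjugates of r and odd ones conjugates of s, whose index is -1.\<close>

lemma dihedral_reflection_in_reflections [simp]:
  assumes "r \<in> reflections" "s \<in> reflections"
  shows "dihedral_reflection r s k \<in> reflections"
proof -
  have conj: "(r \<otimes> s) [^] j \<otimes> t \<otimes> inv ((r \<otimes> s) [^] j) \<in> reflections" if "t \<in> reflections" for j :: int and t
    using that assms by (intro conj_reflection) simp_all
  have half: "(r \<otimes> s) [^] j \<otimes> dihedral_reflection r s i \<otimes> inv ((r \<otimes> s) [^] j)
      = dihedral_reflection r s (2 * j + i)" for i j
  proof -
    have "(r \<otimes> s) [^] j \<otimes> dihedral_reflection r s i \<otimes> (r \<otimes> s) [^] (- j)
        = (r \<otimes> s) [^] (j + i) \<otimes> (r \<otimes> (r \<otimes> s) [^] (- j))"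
      using assms by (simp add: dihedral_reflection_def int_pow_mult m_assoc)
    also have "\<dots> = (r \<otimes> s) [^] (j + i + j) \<otimes> r"
      unfolding involution_int_pow[OF assms] minus_minus int_pow_mult[OF m_closed[OF assms[THEN reflection_closed]]]
      using assms by (simp add: m_assoc)
    also have "j + i + j = 2 * j + i" by simp
    finally show ?thesis using assms by (simp add: int_pow_neg dihedral_reflection_def)
  qed
  have "k = 2 * (k div 2) \<or> k = 2 * (k div 2 + 1) + (- 1)" by presburger
  then show ?thesis
  proof
    assume "k = 2 * (k div 2)"
    then show ?thesis using conj[of r "k div 2"] half[of "k div 2" 0] assms by simp
  next
    assume "k = 2 * (k div 2 + 1) + (- 1)"
    then show ?thesis using conj[of s "k div 2 + 1"] half[of "k div 2 + 1" "- 1"] assms by simp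
  qed
qed

lemma dihedral_reflection_eq_iff:
  assumes "r \<in> reflections" "s \<in> reflections"
  shows "dihedral_reflection r s j = dihedral_reflection r s k \<longleftrightarrow> int (ord (r \<otimes> s)) dvd k - j"
  using assms by (simp add: dihedral_reflection_def int_pow_eq)

lemma alt_refl_eq:
  assumes "r \<in> reflections" "s \<in> reflections"
  shows "alt_refl r s n = dihedral_reflection r s (int n)"
  by (simp add: alt_refl_def dihedral_reflection_def int_pow_int)

lemma dihedral_reflection_swap:
  assumes "r \<in> reflections" "s \<in> reflections"
  shows "dihedral_reflection s r k = dihedral_reflection r s (- 1 - k)"
proof -
  have "s \<otimes> r = inv (r \<otimes> s)" using assms by (simp add: inv_mult_group)
  then have "dihedral_reflection s r k = (r \<otimes> s) [^] (- k) \<otimes> dihedral_reflection r s (- 1)"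
    using assms by (simp add: dihedral_reflection_def[of s] int_pow_inv int_pow_neg)
  then show ?thesis using assms by (simp only: rotation_mult_dihedral_reflection) (simp add: algebra_simps)
qed

lemma generate_pair_cases:
  assumes "r \<in> reflections" "s \<in> reflections" "x \<in> generate W {r, s}"
  shows "\<exists>k::int. x = (r \<otimes> s) [^] k \<or> x = dihedral_reflection r s k"
  using assms(3)
proof induction
  case one
  have "\<one> = (r \<otimes> s) [^] (0::int)" by simp
  then show ?case by blast
next
  case (incl h)
  then have "h = dihedral_reflection r s 0 \<or> h = dihedral_reflection r s (- 1)" using assms by auto
  then show ?case by blast
next
  case (inv h)
  then have "inv h = dihedral_reflection r s 0 \<or> inv h = dihedral_reflection r s (- 1)"
    using assms by auto
  then show ?case by blast
next
  case (eng h1 h2)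
  obtain i j where "h1 = (r \<otimes> s) [^] (i::int) \<or> h1 = dihedral_reflection r s i"
    and "h2 = (r \<otimes> s) [^] (j::int) \<or> h2 = dihedral_reflection r s j"
    using eng by blast
  moreover have "dihedral_reflection r s i \<otimes> (r \<otimes> s) [^] j = dihedral_reflection r s (i - j)"
  proof -
    have "dihedral_reflection r s i \<otimes> (r \<otimes> s) [^] j = (r \<otimes> s) [^] i \<otimes> (r \<otimes> (r \<otimes> s) [^] j)"
      using assms by (simp add: dihedral_reflection_def m_assoc)
    also have "\<dots> = (r \<otimes> s) [^] (i + (- j)) \<otimes> r"
      unfolding involution_int_pow[OF assms(1,2)] using assms by (simp add: m_assoc int_pow_mult del: add_uminus_conv_diff)
    finally show ?thesis by (simp add: dihedral_reflection_def)
  qed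
  moreover have "(r \<otimes> s) [^] i \<otimes> (r \<otimes> s) [^] j = (r \<otimes> s) [^] (i + j)"
    using assms by (simp add: int_pow_mult)
  ultimately show ?case
    using rotation_mult_dihedral_reflection[OF assms(1,2), of i j] dihedral_reflection_mult[OF assms(1,2), of i j]
    by metis
qed

text \<open>Parity of length separates the two kinds of elements of a dihedral group: rotations have
  even length, reflections odd length.\<close>

lemma reflection_in_dihedral:
  assumes "r \<in> reflections" "s \<in> reflections" "t \<in> generate W {r, s}" "t \<in> reflections"
  obtains k where "t = dihedral_reflection r s k"
proof -
  have rs: "r \<otimes> s \<in> carrier W" "even (len (r \<otimes> s))"
    using assms by (simp_all add: even_len_mult odd_len_reflection)
  have nat: "even (len ((r \<otimes> s) [^] n))" for n :: nat
    by (induction n) (simp_all add: even_len_mult rs)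
  have even: "even (len ((r \<otimes> s) [^] k))" for k :: int
    using nat[of "nat k"] nat[of "nat (- k)"] rs(1) unfolding int_pow_def2
    by (auto split: if_splits)
  obtain k :: int where "t = (r \<otimes> s) [^] k \<or> t = dihedral_reflection r s k"
    using generate_pair_cases[OF assms(1-3)] by blast
  then show ?thesis
    using odd_len_reflection[OF assms(4)] even[of k] that[of k] by metis
qed

section \<open>Canonical generators\<close>

text \<open>In the cocycle expansion of s x s the outer letters contribute only where s itself is
  tested. This never happens, since u and its conjugate by x lie in D and s does not.\<close>

lemma left_inversions_conj_gen:
  assumes "subgroup D W" "s \<in> I" "s \<notin> D" "x \<in> D" "u \<in> D" "u \<in> reflections"
  shows "s \<otimes> u \<otimes> s \<in> left_inversions (s \<otimes> x \<otimes> s) \<longleftrightarrow> u \<in> left_inversions x"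
proof -
  interpret D: subgroup D W by fact
  have [simp]: "x \<in> carrier W" "u \<in> carrier W" using assms by auto
  have "inv x \<otimes> u \<otimes> x \<in> D" using assms by simp
  then have x: "inv x \<otimes> u \<otimes> x \<noteq> s" using assms(3) by auto
  have "s \<otimes> u \<otimes> s \<noteq> s"
  proof
    assume "s \<otimes> u \<otimes> s = s"
    then have "s \<otimes> (s \<otimes> u \<otimes> s) \<otimes> s = s" using assms by (simp add: m_assoc)
    then have "u = s" using assms by (simp add: m_assoc)
    then show False using assms by simp
  qed
  moreover have "s \<otimes> u \<otimes> s \<in> left_inversions (s \<otimes> (x \<otimes> s)) \<longleftrightarrow>
      (s \<otimes> u \<otimes> s = s) \<noteq> (u \<in> left_inversions (x \<otimes> s))"
    using assms reflection_conj[of s u] by (subst left_inversions_mult) (simp_all add: m_assoc)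
  moreover have "u \<in> left_inversions (x \<otimes> s) \<longleftrightarrow> u \<in> left_inversions x"
    using assms x by (subst left_inversions_mult) auto
  ultimately show ?thesis using assms by (simp add: m_assoc)
qed

lemma subgroup_conj_gen:
  assumes "subgroup D W" "s \<in> I"
  shows "subgroup ((\<lambda>x. s \<otimes> x \<otimes> s) ` D) W"
proof -
  interpret D: subgroup D W by fact
  show ?thesis
  proof
    fix x y assume "x \<in> (\<lambda>x. s \<otimes> x \<otimes> s) ` D" "y \<in> (\<lambda>x. s \<otimes> x \<otimes> s) ` D"
    then obtain a b where ab: "a \<in> D" "b \<in> D" "x = s \<otimes> a \<otimes> s" "y = s \<otimes> b \<otimes> s" by auto
    then have "x \<otimes> y = s \<otimes> (a \<otimes> b) \<otimes> s" using assms by (simp add: m_assoc)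
    then show "x \<otimes> y \<in> (\<lambda>x. s \<otimes> x \<otimes> s) ` D" using ab by auto
    have "inv x = s \<otimes> inv a \<otimes> s" using ab assms by (simp add: inv_mult_group m_assoc)
    then show "inv x \<in> (\<lambda>x. s \<otimes> x \<otimes> s) ` D" using ab by auto
  next
    have "\<one> = s \<otimes> \<one> \<otimes> s" using assms by simp
    then show "\<one> \<in> (\<lambda>x. s \<otimes> x \<otimes> s) ` D" using D.one_closed by blast
  qed (use assms in auto)
qed

lemma canonical_generators_conj_gen:
  assumes "subgroup D W" "s \<in> I" "s \<notin> D" "t \<in> canonical_generators ((\<lambda>x. s \<otimes> x \<otimes> s) ` D)"
  shows "s \<otimes> t \<otimes> s \<in> canonical_generators D"
proof -
  interpret D: subgroup D W by fact
  have t: "t \<in> reflections" "left_inversions t \<inter> (\<lambda>x. s \<otimes> x \<otimes> s) ` D = {t}"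
    using assms(4) by (auto simp: canonical_generators_def)
  obtain d where d: "d \<in> D" "t = s \<otimes> d \<otimes> s" using assms(4) by (auto simp: canonical_generators_def)
  have sts: "s \<otimes> t \<otimes> s = d" using d assms by (simp add: m_assoc)
  then have dT: "d \<in> reflections" using reflection_conj[of s t] t assms by simp
  have "u = d" if u: "u \<in> left_inversions d" "u \<in> D" for u
  proof -
    have uT: "u \<in> reflections" using u by (simp add: left_inversions_def)
    have "s \<otimes> u \<otimes> s \<in> left_inversions t"
      using left_inversions_conj_gen[of D s d u] u d uT assms by simp
    then have "s \<otimes> u \<otimes> s = t" using t u by auto
    then show ?thesis using sts u assms by (auto simp: m_assoc)
  qed
  then have "left_inversions d \<inter> D = {d}" using d dT self_left_inversion by auto
  then show ?thesis using d dT sts by (simp add: canonical_generators_def)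
qed

lemma generate_conj_gen:
  assumes "y \<in> generate W A" "s \<in> I" "A \<subseteq> carrier W" "B \<subseteq> carrier W"
    and "\<And>a. a \<in> A \<Longrightarrow> s \<otimes> a \<otimes> s \<in> generate W B"
  shows "s \<otimes> y \<otimes> s \<in> generate W B"
  using assms(1)
proof induction
  case one
  then show ?case using assms by (simp add: generate.one)
next
  case (incl h)
  then show ?case using assms by simp
next
  case (inv h)
  then have "s \<otimes> inv h \<otimes> s = inv (s \<otimes> h \<otimes> s)"
    using assms by (simp add: inv_mult_group m_assoc subset_iff)
  then show ?case using inv assms generate_m_inv_closed by simp
next
  case (eng h1 h2)
  then have "s \<otimes> (h1 \<otimes> h2) \<otimes> s = (s \<otimes> h1 \<otimes> s) \<otimes> (s \<otimes> h2 \<otimes> s)"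
    using assms generate_in_carrier[of A] by (simp add: m_assoc)
  then show ?case using eng.IH generate.eng by metis
qed

text \<open>Following Dyer: conjugation by a simple reflection outside \<open>D\<close> transports the canonical
  generators of \<open>D\<close>, and a simple reflection inside \<open>D\<close> is itself canonical; so one can descend on
  the length of \<open>t\<close>.\<close>

lemma reflection_in_generate_canonical:
  assumes "subgroup D W" "t \<in> reflections" "t \<in> D"
  shows "t \<in> generate W (canonical_generators D)"
  using assms
proof (induction "len t" arbitrary: t D rule: less_induct)
  case less
  have canon: "canonical_generators E \<subseteq> carrier W" for E
    by (auto simp: canonical_generators_def)
  show ?case
  proof (cases "t \<in> I")
    case True
    then show ?thesis using less.prems
      by (intro generate.incl) (simp add: canonical_generators_def)
  next
    case False
    then obtain s where s: "s \<in> I" "len (s \<otimes> t \<otimes> s) < len t"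
      using shorter_conjugate less.prems by blast
    have t: "t = s \<otimes> (s \<otimes> t \<otimes> s) \<otimes> s" using s less.prems by (simp add: m_assoc)
    show ?thesis
    proof (cases "s \<in> D")
      case True
      interpret D: subgroup D W by fact
      have *: "s \<in> generate W (canonical_generators D)"
        using True s by (intro generate.incl) (simp add: canonical_generators_def)
      have "s \<otimes> t \<otimes> s \<in> generate W (canonical_generators D)"
        using less.hyps[OF s(2) less.prems(1)] True less.prems s reflection_conj by simp
      then have "s \<otimes> (s \<otimes> t \<otimes> s) \<otimes> s \<in> generate W (canonical_generators D)"
        by (rule generate.eng[OF generate.eng[OF *] *])
      then show ?thesis by (simp only: t[symmetric])
    next
      case nD: False
      have "s \<otimes> t \<otimes> s \<in> generate W (canonical_generators ((\<lambda>x. s \<otimes> x \<otimes> s) ` D))"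
        using less.hyps[OF s(2) subgroup_conj_gen[OF less.prems(1) s(1)]] less.prems s reflection_conj
        by simp
      then have "s \<otimes> (s \<otimes> t \<otimes> s) \<otimes> s \<in> generate W (canonical_generators D)"
        using generate_conj_gen[OF _ s(1) canon canon]
          canonical_generators_conj_gen[OF less.prems(1) s(1) nD] generate.incl by metis
      then show ?thesis by (simp only: t[symmetric])
    qed
  qed
qed

context
  fixes t u D
  assumes t: "t \<in> reflections" and u: "u \<in> reflections" and tu: "t \<noteq> u"
    and D: "D = generate W {t, u}"
begin

lemma subgroup_D: "subgroup D W"
  unfolding D using t u by (intro generate_is_subgroup) auto

interpretation D: subgroup D W by (rule subgroup_D)

lemma D_reflection:
  assumes "x \<in> D" "x \<in> reflections"
  obtains k where "x = dihedral_reflection t u k"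
  using reflection_in_dihedral[OF t u] assms D by blast

lemma canonicalD:
  assumes "x \<in> canonical_generators D"
  shows "x \<in> D" "x \<in> reflections" "p \<in> D \<Longrightarrow> p \<in> left_inversions x \<longleftrightarrow> p = x"
  using assms by (auto simp: canonical_generators_def)

text \<open>If z were x y x, then x not being an inversion of z forces, by the cocycle rule at x,
  that y x y = x. Then x y x = y, so z would equal y.\<close>

lemma canonical_conj_neq:
  assumes "x \<in> canonical_generators D" "y \<in> canonical_generators D" "z \<in> canonical_generators D"
    "x \<noteq> y" "y \<noteq> z" "x \<noteq> z"
  shows "x \<otimes> y \<otimes> x \<noteq> z"
proof
  assume z: "x \<otimes> y \<otimes> x = z"
  note c = canonicalD[OF assms(1)] canonicalD[OF assms(2)] canonicalD[OF assms(3)]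
  have "x \<in> left_inversions (x \<otimes> (y \<otimes> x)) \<longleftrightarrow> x \<notin> left_inversions (y \<otimes> x)"
    using c by (subst left_inversions_mult) (auto simp: self_left_inversion)
  also have "x \<in> left_inversions (y \<otimes> x) \<longleftrightarrow> y \<otimes> x \<otimes> y = x"
    using c assms by (subst left_inversions_mult) auto
  finally have "y \<otimes> x \<otimes> y = x" using c z assms(6) by (simp add: m_assoc)
  then have "x \<otimes> (y \<otimes> x \<otimes> y) \<otimes> y = x \<otimes> x \<otimes> y" by simp
  then have "x \<otimes> y \<otimes> x = y" using c by (simp add: m_assoc)
  then show False using z assms by simp
qed

lemma product_of_three:
  assumes "x \<in> D" "y \<in> D" "z \<in> D" "x \<in> reflections" "y \<in> reflections" "z \<in> reflections"
  shows "x \<otimes> y \<otimes> z \<in> reflections" "x \<otimes> y \<otimes> z = z \<otimes> y \<otimes> x"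
proof -
  obtain i j k where "x = dihedral_reflection t u i" "y = dihedral_reflection t u j"
    "z = dihedral_reflection t u k"
    using D_reflection assms by metis
  then have "x \<otimes> y \<otimes> z = dihedral_reflection t u (i - j + k)" "z \<otimes> y \<otimes> x = dihedral_reflection t u (k - j + i)"
    by (simp_all add: dihedral_reflection_mult rotation_mult_dihedral_reflection t u)
  then show "x \<otimes> y \<otimes> z \<in> reflections" "x \<otimes> y \<otimes> z = z \<otimes> y \<otimes> x"
    using t u by (simp_all add: algebra_simps)
qed

text \<open>Products of two reflections of a dihedral group commute, so \<open>y x z = z x y\<close>; evaluating both
  sides of this equation with the cocycle at \<open>y\<close> leaves only \<open>x z = z x\<close>.\<close>

lemma canonical_commute:
  assumes "x \<in> canonical_generators D" "y \<in> canonical_generators D" "z \<in> canonical_generators D"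
    "x \<noteq> y" "y \<noteq> z" "x \<noteq> z"
  shows "x \<otimes> z = z \<otimes> x"
proof -
  note c = canonicalD[OF assms(1)] canonicalD[OF assms(2)] canonicalD[OF assms(3)]
  have g: "y \<otimes> (x \<otimes> z) = z \<otimes> (x \<otimes> y)"
    using product_of_three(2)[of y x z] c by (simp add: m_assoc)
  have "y \<in> left_inversions (y \<otimes> (x \<otimes> z)) \<longleftrightarrow> y \<notin> left_inversions (x \<otimes> z)"
    using c by (subst left_inversions_mult) (auto simp: self_left_inversion)
  also have "y \<in> left_inversions (x \<otimes> z) \<longleftrightarrow> (y = x) \<noteq> (x \<otimes> y \<otimes> x \<in> left_inversions z)"
    using c assms by (subst left_inversions_mult) auto
  also have "x \<otimes> y \<otimes> x \<in> left_inversions z \<longleftrightarrow> x \<otimes> y \<otimes> x = z"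
    using c by auto
  finally have "y \<in> left_inversions (z \<otimes> (x \<otimes> y))"
    using canonical_conj_neq[OF assms] assms by (simp flip: g)
  also have "y \<in> left_inversions (z \<otimes> (x \<otimes> y)) \<longleftrightarrow> (y = z) \<noteq> (z \<otimes> y \<otimes> z \<in> left_inversions (x \<otimes> y))"
    using c by (subst left_inversions_mult) auto
  also have "z \<otimes> y \<otimes> z \<in> left_inversions (x \<otimes> y) \<longleftrightarrow>
      (z \<otimes> y \<otimes> z = x) \<noteq> (x \<otimes> (z \<otimes> y \<otimes> z) \<otimes> x \<in> left_inversions y)"
    using c by (subst left_inversions_mult) (auto simp: reflection_conj)
  also have "x \<otimes> (z \<otimes> y \<otimes> z) \<otimes> x \<in> left_inversions y \<longleftrightarrow> x \<otimes> (z \<otimes> y \<otimes> z) \<otimes> x = y"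
    using c by auto
  finally have "x \<otimes> (z \<otimes> y \<otimes> z) \<otimes> x = y"
    using canonical_conj_neq[OF assms(3,2,1)] assms by auto
  then have "x \<otimes> (z \<otimes> y \<otimes> z) \<otimes> x \<otimes> x \<otimes> z = y \<otimes> x \<otimes> z" by simp
  then have "x \<otimes> z \<otimes> y = y \<otimes> (x \<otimes> z)" using c by (simp add: m_assoc)
  also have "\<dots> = z \<otimes> x \<otimes> y" using g c by (simp add: m_assoc)
  finally show ?thesis using c by simp
qed

text \<open>Three distinct canonical generators would commute pairwise, and their product p would be
  a reflection in D. Since p inverts itself, the cocycle rule must find a contribution at one of the
  three factors, and each such contribution makes two distinct reflections inverse to each
  other.\<close>

lemma canonical_at_most_two:
  assumes "x \<in> canonical_generators D" "y \<in> canonical_generators D" "z \<in> canonical_generators D"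
    "x \<noteq> y" "y \<noteq> z"
  shows "x = z"
proof (rule ccontr)
  assume xz: "x \<noteq> z"
  note c = canonicalD[OF assms(1)] canonicalD[OF assms(2)] canonicalD[OF assms(3)]
  have comm: "x \<otimes> z = z \<otimes> x" "x \<otimes> y = y \<otimes> x" "y \<otimes> z = z \<otimes> y"
    using canonical_commute[of x y z] canonical_commute[of x z y] canonical_commute[of y x z]
      assms xz by auto
  have one: "a \<otimes> b \<noteq> \<one>" if "a \<in> reflections" "b \<in> reflections" "a \<noteq> b" for a b
    using that inv_equality[of a b] by auto
  define p where "p = x \<otimes> y \<otimes> z"
  have p: "p \<in> reflections" "p \<in> D" using product_of_three c by (auto simp: p_def)
  have px: "p = x \<otimes> (y \<otimes> z)" using c by (simp add: p_def m_assoc)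
  have "p \<in> left_inversions (x \<otimes> (y \<otimes> z)) \<longleftrightarrow> (p = x) \<noteq> (x \<otimes> p \<otimes> x \<in> left_inversions (y \<otimes> z))"
    using c p by (subst left_inversions_mult) auto
  also have "x \<otimes> p \<otimes> x = y \<otimes> (x \<otimes> z)"
    using c comm(1) by (simp add: px m_assoc)
  also have "y \<otimes> (x \<otimes> z) \<in> left_inversions (y \<otimes> z) \<longleftrightarrow>
      (y \<otimes> (x \<otimes> z) = y) \<noteq> (y \<otimes> (y \<otimes> (x \<otimes> z)) \<otimes> y \<in> left_inversions z)"
    using c product_of_three(1)[of y x z] by (subst left_inversions_mult) (auto simp: m_assoc)
  also have "y \<otimes> (y \<otimes> (x \<otimes> z)) \<otimes> y \<in> left_inversions z \<longleftrightarrow> y \<otimes> (y \<otimes> (x \<otimes> z)) \<otimes> y = z"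
    using c by auto
  also have "y \<otimes> (y \<otimes> (x \<otimes> z)) \<otimes> y = z \<otimes> (x \<otimes> y)"
  proof -
    have "y \<otimes> (y \<otimes> (x \<otimes> z)) \<otimes> y = x \<otimes> z \<otimes> y" using c by simp
    then show ?thesis unfolding comm(1) using c by (simp add: m_assoc)
  qed
  finally have "p = x \<or> y \<otimes> (x \<otimes> z) = y \<or> z \<otimes> (x \<otimes> y) = z"
    using self_left_inversion[OF p(1)] unfolding px by blast
  then show False
    using one[of y z] one[of x z] one[of x y] c assms xz by (auto simp: px)
qed

text \<open>The canonical generators generate D. A single one would generate only the identity and
  itself, too little for the two reflections t and u; more than two are excluded by
  \<open>canonical_at_most_two\<close>.\<close>

lemma canonical_pair:
  obtains r s where "r \<in> reflections" "s \<in> reflections" "r \<noteq> s" "canonical_generators D = {r, s}"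
    "D = generate W {r, s}"
proof -
  let ?C = "canonical_generators D"
  have CD: "?C \<subseteq> D" by (auto simp: canonical_generators_def)
  have "{t, u} \<subseteq> generate W ?C"
    using reflection_in_generate_canonical[OF subgroup_D] t u D generate.incl[of _ "{t, u}" W] by auto
  moreover have "subgroup (generate W ?C) W"
    using CD D.subset by (intro generate_is_subgroup) blast
  ultimately have DC: "D \<subseteq> generate W ?C" unfolding D by (rule generate_subgroup_incl)
  have CDg: "generate W ?C = D"
    using DC generate_subgroup_incl[OF CD subgroup_D] by simp
  have "\<exists>r\<in>?C. \<exists>s\<in>?C. r \<noteq> s"
  proof (rule ccontr)
    assume neg: "\<not> ?thesis"
    have single: "y = \<one> \<or> y \<in> ?C" if "y \<in> generate W ?C" for y
      using that
    proof induction
      case (inv h)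
      then show ?case using canonicalD(2) by simp
    next
      case (eng h1 h2)
      then show ?case using neg canonicalD(2) by fastforce
    qed auto
    have "t \<in> D" "u \<in> D" using D generate.incl[of _ "{t, u}" W] by auto
    then show False using single[of t] single[of u] CDg reflection_neq_one t u tu neg by auto
  qed
  then obtain r s where rs: "r \<in> ?C" "s \<in> ?C" "r \<noteq> s" by blast
  then have "?C = {r, s}" using canonical_at_most_two by blast
  then show ?thesis using that rs canonicalD(2) CDg by metis
qed

end

end

section \<open>Reflection orders on dihedral subgroups\<close>

definition strict_part :: "'a rel \<Rightarrow> 'a \<Rightarrow> 'a \<Rightarrow> bool" where
  "strict_part R a b \<longleftrightarrow> (a, b) \<in> R \<and> a \<noteq> b"

lemma strict_part_converse: "strict_part (R\<inverse>) a b \<longleftrightarrow> strict_part R b a"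
  by (auto simp: strict_part_def)

lemma strict_part_linear:
  assumes "linear_order_on A R"
  shows "\<not> strict_part R a a"
    and "strict_part R a b \<Longrightarrow> strict_part R b c \<Longrightarrow> strict_part R a c"
    and "a \<in> A \<Longrightarrow> b \<in> A \<Longrightarrow> a \<noteq> b \<Longrightarrow> strict_part R a b \<or> strict_part R b a"
    and "strict_part R a b \<Longrightarrow> \<not> strict_part R b a"
  using assms
  by (auto simp: strict_part_def order_on_defs total_on_def dest: transD antisymD)

context coxeter_system
begin

text \<open>In terms of positive roots: \<open>u \<notin> left_inversions t\<close> means that \<open>t\<close> maps the root of \<open>u\<close> to a
  positive root, which then lies on the same side of the root of \<open>t\<close>; otherwise the negative of
  the image is positive and lies on the opposite side.\<close>

definition side_compatible :: "('a \<Rightarrow> 'a \<Rightarrow> bool) \<Rightarrow> 'a \<Rightarrow> 'a \<Rightarrow> bool" where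
  "side_compatible lt t u \<longleftrightarrow>
    (u \<notin> left_inversions t \<longrightarrow> (lt (t \<otimes> u \<otimes> t) t \<longleftrightarrow> lt u t)) \<and>
    (u \<in> left_inversions t \<longrightarrow> (lt t (t \<otimes> u \<otimes> t) \<longleftrightarrow> lt u t))"

lemma side_compatible_converse:
  assumes R: "linear_order_on reflections R" and t: "t \<in> reflections" and u: "u \<in> reflections" "u \<noteq> t"
  shows "side_compatible (strict_part (R\<inverse>)) t u \<longleftrightarrow> side_compatible (strict_part R) t u"
proof -
  have tut: "t \<otimes> u \<otimes> t \<in> reflections" using t u reflection_conj by simp
  have "t \<otimes> u \<otimes> t \<noteq> t"
  proof
    assume "t \<otimes> u \<otimes> t = t"
    then have "t \<otimes> (t \<otimes> u \<otimes> t) \<otimes> t = t" using t by simp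
    then show False using t u by (simp add: m_assoc)
  qed
  then show ?thesis
    using strict_part_linear(3,4)[OF R] t u tut unfolding side_compatible_def strict_part_converse by metis
qed

context
  fixes r s D
  assumes r: "r \<in> reflections" and s: "s \<in> reflections" and rs: "r \<noteq> s"
    and D: "D = generate W {r, s}" and canonical: "canonical_generators D = {r, s}"
begin

lemma dihedral_reflection_in_D: "dihedral_reflection r s k \<in> D"
proof -
  interpret D: subgroup D W unfolding D using r s by (intro generate_is_subgroup) auto
  have rsD: "r \<in> D" "s \<in> D" using D generate.incl[of _ "{r, s}" W] by auto
  have nat: "(r \<otimes> s) [^] (n::nat) \<in> D" for n
    by (induction n) (simp_all add: rsD)
  have "(r \<otimes> s) [^] k \<in> D"
  proof (cases k rule: int_cases2)
    case (nonneg n)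
    then show ?thesis using nat by (simp add: int_pow_int)
  next
    case (nonpos n)
    then show ?thesis using nat r s by (simp add: int_pow_neg_int)
  qed
  then show ?thesis using rsD by (simp add: dihedral_reflection_def)
qed

text \<open>Canonicity makes r and s behave inside D like simple reflections, so the inversions can
  be counted on the alternating word of length 2 i + 1, whose prefix reflections have indices 0 to 2
  i. Parity matters because indices may coincide modulo a finite order.\<close>

lemma dihedral_left_inversions:
  "dihedral_reflection r s j \<in> left_inversions (dihedral_reflection r s (int i)) \<longleftrightarrow>
    odd (\<Sum>m\<le>2 * i. of_bool (dihedral_reflection r s (int m) = dihedral_reflection r s j) :: nat)"
proof (induction i arbitrary: j)
  have gens: "dihedral_reflection r s j \<in> left_inversions r \<longleftrightarrow> dihedral_reflection r s j = r"
    "dihedral_reflection r s j \<in> left_inversions s \<longleftrightarrow> dihedral_reflection r s j = s" for j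
    using canonical dihedral_reflection_in_D[of j] by (auto simp: canonical_generators_def)
  {
    case 0
    show ?case using gens(1)[of j] r s by auto
  next
    case (Suc i)
    let ?\<rho> = "dihedral_reflection r s"
    have shift: "?\<rho> a = ?\<rho> (b - 2) \<longleftrightarrow> ?\<rho> (a + 2) = ?\<rho> b" for a b
      using r s by (simp add: dihedral_reflection_eq_iff algebra_simps)
    have "?\<rho> (int (Suc i)) = (r \<otimes> s) [^] (1::int) \<otimes> ?\<rho> (int i)"
      using r s by (simp only: rotation_mult_dihedral_reflection) simp
    then have e: "?\<rho> (int (Suc i)) = r \<otimes> (s \<otimes> ?\<rho> (int i))" using r s by (simp add: m_assoc)
    have "?\<rho> j \<in> left_inversions (?\<rho> (int (Suc i))) \<longleftrightarrow>
        (?\<rho> j = r) \<noteq> (r \<otimes> ?\<rho> j \<otimes> r \<in> left_inversions (s \<otimes> ?\<rho> (int i)))"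
      unfolding e using r s gens by (subst left_inversions_mult) simp_all
    also have "r \<otimes> ?\<rho> j \<otimes> r = ?\<rho> (- j)"
      using dihedral_reflection_conj[OF r s, of 0 j] r s by simp
    also have "?\<rho> (- j) \<in> left_inversions (s \<otimes> ?\<rho> (int i)) \<longleftrightarrow>
        (?\<rho> (- j) = s) \<noteq> (s \<otimes> ?\<rho> (- j) \<otimes> s \<in> left_inversions (?\<rho> (int i)))"
      using r s gens by (subst left_inversions_mult) simp_all
    also have "s \<otimes> ?\<rho> (- j) \<otimes> s = ?\<rho> (j - 2)"
      using dihedral_reflection_conj[OF r s, of "- 1" "- j"] r s by simp
    also have "?\<rho> (j - 2) \<in> left_inversions (?\<rho> (int i)) \<longleftrightarrow>
        odd (\<Sum>m\<le>2 * i. of_bool (?\<rho> (int (Suc (Suc m))) = ?\<rho> j) :: nat)"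
      unfolding Suc.IH shift by (simp add: algebra_simps)
    also have "?\<rho> (- j) = s \<longleftrightarrow> ?\<rho> 1 = ?\<rho> j"
      using dihedral_reflection_eq_iff[OF r s, of "- j" "- 1"] dihedral_reflection_eq_iff[OF r s, of 1 j] r s
      by (simp add: algebra_simps)
    also have "?\<rho> j = r \<longleftrightarrow> ?\<rho> 0 = ?\<rho> j" using r s by auto
    finally show ?case
      by (simp add: sum.atMost_Suc_shift del: sum.atMost_Suc)
  }
qed

lemma infinite_dihedral_left_inversions:
  assumes "ord (r \<otimes> s) = 0"
  shows "dihedral_reflection r s j \<in> left_inversions (dihedral_reflection r s (int i)) \<longleftrightarrow>
    0 \<le> j \<and> j \<le> 2 * int i"
proof -
  have eq: "dihedral_reflection r s a = dihedral_reflection r s b \<longleftrightarrow> a = b" for a b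
    using assms r s by (auto simp: dihedral_reflection_eq_iff)
  show ?thesis
  proof (cases "j \<ge> 0")
    case True
    then obtain k where "j = int k" using nonneg_int_cases by blast
    then show ?thesis unfolding dihedral_left_inversions eq by (auto simp: of_bool_def)
  next
    case False
    then have "int m \<noteq> j" for m by auto
    then show ?thesis unfolding dihedral_left_inversions eq using False by simp
  qed
qed

text \<open>Among the indices up to 2 i, which is below twice the order, the class of j can be met
  only at j and at j plus the order. The count is odd when the first is reached and the second is
  not.\<close>

lemma finite_dihedral_left_inversions:
  assumes "j < ord (r \<otimes> s)" "i < ord (r \<otimes> s)"
  shows "dihedral_reflection r s (int j) \<in> left_inversions (dihedral_reflection r s (int i)) \<longleftrightarrow>
    j \<le> 2 * i \<and> 2 * i < j + ord (r \<otimes> s)"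
proof -
  let ?n = "ord (r \<otimes> s)"
  have "dihedral_reflection r s (int m) = dihedral_reflection r s (int j) \<longleftrightarrow> m = j \<or> m = j + ?n"
    if "m \<le> 2 * i" for m
  proof
    assume "dihedral_reflection r s (int m) = dihedral_reflection r s (int j)"
    then obtain q where q: "int j - int m = int ?n * q"
      using dihedral_reflection_eq_iff[OF r s] by (auto simp: dvd_def)
    have "q < 1"
    proof (rule ccontr)
      assume "\<not> q < 1"
      then have "int ?n * 1 \<le> int ?n * q" by (intro mult_left_mono) auto
      then show False using q assms by linarith
    qed
    moreover have "- 2 < q"
    proof (rule ccontr)
      assume "\<not> - 2 < q"
      then have "int ?n * q \<le> int ?n * (- 2)" by (intro mult_left_mono) auto
      then show False using q assms that by linarith
    qed
    ultimately have "q = 0 \<or> q = - 1" by auto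
    then show "m = j \<or> m = j + ?n" using q by auto
  qed (use r s in \<open>auto simp: dihedral_reflection_eq_iff\<close>)
  moreover have "?n \<noteq> 0" using assms by simp
  ultimately have "(\<Sum>m\<le>2 * i. of_bool (dihedral_reflection r s (int m) = dihedral_reflection r s (int j)) :: nat)
      = (\<Sum>m\<le>2 * i. of_bool (m = j) + of_bool (m = j + ?n))"
    by (intro sum.cong) auto
  also have "\<dots> = of_bool (j \<le> 2 * i) + of_bool (j + ?n \<le> 2 * i)"
    by (simp add: sum.distrib of_bool_def)
  finally show ?thesis unfolding dihedral_left_inversions by auto
qed

lemma finite_chain_iff:
  assumes R: "linear_order_on reflections R" and "dihedral_chain R r s"
    and "ord (r \<otimes> s) \<noteq> 0" "i < ord (r \<otimes> s)" "j < ord (r \<otimes> s)"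
  shows "strict_part R (dihedral_reflection r s (int i)) (dihedral_reflection r s (int j)) \<longleftrightarrow> i < j"
proof -
  have "strict_part R (dihedral_reflection r s (int a)) (dihedral_reflection r s (int b))"
    if "a < b" "b < ord (r \<otimes> s)" for a b
    using assms(2,3) that r s
    by (simp add: dihedral_chain_def Let_def strict_part_def alt_refl_eq)
  then show ?thesis
    using assms strict_part_linear(1,4)[OF R] by (metis linorder_neqE_nat)
qed

text \<open>The order 0, 1, 2, ... followed by ..., -3, -2, -1: the chain leaves r upwards and
  arrives at s, the index -1, from below.\<close>

definition chain_index_less :: "int \<Rightarrow> int \<Rightarrow> bool" where
  "chain_index_less i j \<longleftrightarrow> (0 \<le> i \<and> i < j) \<or> (0 \<le> i \<and> j < 0) \<or> (i < j \<and> j < 0)"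

lemma infinite_chain_iff:
  assumes R: "linear_order_on reflections R" and chain: "dihedral_chain R r s"
    and ord: "ord (r \<otimes> s) = 0"
  shows "strict_part R (dihedral_reflection r s i) (dihedral_reflection r s j) \<longleftrightarrow> chain_index_less i j"
proof -
  let ?\<rho> = "dihedral_reflection r s"
  have c: "\<And>i j. i < j \<Longrightarrow> strict_part R (alt_refl r s i) (alt_refl r s j)"
    "\<And>i j. strict_part R (alt_refl r s i) (alt_refl s r j)"
    "\<And>i j. i < j \<Longrightarrow> strict_part R (alt_refl s r j) (alt_refl s r i)"
    using chain ord by (simp_all add: dihedral_chain_def Let_def strict_part_def)
  have alt: "?\<rho> i = (if i \<ge> 0 then alt_refl r s (nat i) else alt_refl s r (nat (- 1 - i)))" for i
    using r s by (simp add: alt_refl_eq dihedral_reflection_swap[OF r s])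
  have less: "strict_part R (?\<rho> i) (?\<rho> j)" if "chain_index_less i j" for i j
    using that c unfolding alt chain_index_less_def by (auto simp: nat_less_eq_zless)
  have "chain_index_less i j \<or> i = j \<or> chain_index_less j i"
    by (auto simp: chain_index_less_def)
  then show ?thesis
    using less strict_part_linear(1,4)[OF R] by metis
qed

lemma side_compatible_finite:
  assumes R: "linear_order_on reflections R" and chain: "dihedral_chain R r s"
    and ord: "ord (r \<otimes> s) \<noteq> 0" and ij: "i < ord (r \<otimes> s)" "j < ord (r \<otimes> s)" "i \<noteq> j"
  shows "side_compatible (strict_part R) (dihedral_reflection r s (int i)) (dihedral_reflection r s (int j))"
proof -
  let ?n = "ord (r \<otimes> s)" and ?\<rho> = "dihedral_reflection r s"
  note less = finite_chain_iff[OF R chain ord]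
  \<comment> \<open>The representative of 2 i - j modulo the order in the range of the chain. The
    middle case, where nothing is added or subtracted, is exactly the inversion condition of
    \<open>finite_dihedral_left_inversions\<close>.\<close>
  define k where "k = (if 2 * i < j then 2 * i + ?n - j
    else if 2 * i < j + ?n then 2 * i - j else 2 * i - j - ?n)"
  have k: "k < ?n" using ij by (auto simp: k_def)
  have "int k = 2 * int i - int j \<or> int k = 2 * int i - int j + int ?n
      \<or> int k = 2 * int i - int j - int ?n"
    using ij by (auto simp: k_def)
  then have "int ?n dvd int k - (2 * int i - int j)"
    by (elim disjE) auto
  then have conj: "?\<rho> (int i) \<otimes> ?\<rho> (int j) \<otimes> ?\<rho> (int i) = ?\<rho> (int k)"
    using r s by (simp add: dihedral_reflection_conj dihedral_reflection_eq_iff)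
  have "j \<le> 2 * i \<and> 2 * i < j + ?n \<Longrightarrow> i < k \<longleftrightarrow> j < i"
    "\<not> (j \<le> 2 * i \<and> 2 * i < j + ?n) \<Longrightarrow> k < i \<longleftrightarrow> j < i"
    using ij by (auto simp: k_def)
  then show ?thesis
    unfolding side_compatible_def finite_dihedral_left_inversions[OF ij(2,1)] conj
      less[OF ij(1,2)] less[OF ij(2,1)] less[OF k ij(1)] less[OF ij(1) k] by blast
qed

lemma side_compatible_infinite:
  assumes R: "linear_order_on reflections R" and chain: "dihedral_chain R r s"
    and ord: "ord (r \<otimes> s) = 0" and j: "j \<noteq> int i"
  shows "side_compatible (strict_part R) (dihedral_reflection r s (int i)) (dihedral_reflection r s j)"
  using j r s unfolding side_compatible_def infinite_dihedral_left_inversions[OF ord]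
  by (auto simp: dihedral_reflection_conj infinite_chain_iff[OF R chain ord] chain_index_less_def)

lemma dihedral_chain_converse:
  assumes "ord (r \<otimes> s) = 0" "dihedral_chain R r s"
  shows "dihedral_chain (R\<inverse>) s r"
proof -
  have "s \<otimes> r = inv (r \<otimes> s)" using r s by (simp add: inv_mult_group)
  then have "ord (s \<otimes> r) = 0" using assms r s by simp
  then show ?thesis using assms unfolding dihedral_chain_def Let_def by simp metis
qed

text \<open>A product of two reflections is the rotation by the difference of their indices. In a
  finite chain b a and c d rotate in opposite directions by two disjoint gaps, whose sum stays below
  the order; in an infinite chain the differences are plain integers and cannot agree, even if one
  gap spans the turn from nonnegative to negative indices.\<close>

lemma no_nested_products:
  assumes R: "linear_order_on reflections R" and chain: "dihedral_chain R r s"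
    and abcd: "{a, b, c, d} \<subseteq> reflections \<inter> D"
    and less: "strict_part R a b" "strict_part R b c" "strict_part R c d"
  shows "b \<otimes> a \<noteq> c \<otimes> d"
proof
  assume eq: "b \<otimes> a = c \<otimes> d"
  let ?n = "ord (r \<otimes> s)" and ?\<rho> = "dihedral_reflection r s"
  have ex: "\<exists>k. x = ?\<rho> k" if "x \<in> {a, b, c, d}" for x
    using reflection_in_dihedral[OF r s] abcd D that by blast
  show False
  proof (cases "?n = 0")
    case True
    obtain ia ib ic id where i: "a = ?\<rho> ia" "b = ?\<rho> ib" "c = ?\<rho> ic" "d = ?\<rho> id"
      using ex by (metis insertCI)
    then have "ib - ia = ic - id"
      using eq r s True by (simp add: dihedral_reflection_mult int_pow_eq)
    then show False
      using less unfolding i infinite_chain_iff[OF R chain True] chain_index_less_def by auto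
  next
    case False
    have "\<exists>k<?n. x = ?\<rho> (int k)" if x: "x \<in> {a, b, c, d}" for x
    proof -
      obtain k where k: "x = ?\<rho> k" using ex x by blast
      have "x = ?\<rho> (int (nat (k mod int ?n)))"
        unfolding k using r s False
        by (simp add: dihedral_reflection_eq_iff mod_0_imp_dvd mod_diff_left_eq)
      moreover have "nat (k mod int ?n) < ?n" using False by (simp add: nat_less_iff)
      ultimately show ?thesis by blast
    qed
    then obtain ia ib ic id where i: "a = ?\<rho> (int ia)" "b = ?\<rho> (int ib)" "c = ?\<rho> (int ic)" "d = ?\<rho> (int id)"
      and n: "ia < ?n" "ib < ?n" "ic < ?n" "id < ?n"
      by (metis insertCI)
    then have "ia < ib" "ib < ic" "ic < id"
      using less finite_chain_iff[OF R chain False] by auto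
    moreover have "int ?n dvd (int ic - int id) - (int ib - int ia)"
      using eq i r s by (simp add: dihedral_reflection_mult int_pow_eq)
    then have "int ?n dvd (int id - int ic) + (int ib - int ia)"
      by (subst dvd_minus_iff[symmetric]) (simp add: algebra_simps)
    ultimately show False
      using n zdvd_imp_le[of "int ?n" "(int id - int ic) + (int ib - int ia)"] by simp
  qed
qed

end

lemma side_compatible_chain:
  assumes rs: "r \<in> reflections" "s \<in> reflections" "r \<noteq> s"
    and D: "D = generate W {r, s}" and can: "canonical_generators D = {r, s}"
    and R: "linear_order_on reflections R" and chain: "dihedral_chain R r s"
    and tu: "t \<in> reflections" "u \<in> reflections" "t \<in> D" "u \<in> D" "u \<noteq> t"
  shows "side_compatible (strict_part R) t u"
proof -
  let ?n = "ord (r \<otimes> s)"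
  obtain i j where ij: "t = dihedral_reflection r s i" "u = dihedral_reflection r s j"
    using reflection_in_dihedral[OF rs(1,2)] tu D by metis
  show ?thesis
  proof (cases "?n = 0")
    case True
    show ?thesis
    proof (cases "i \<ge> 0")
      \<comment> \<open>A negative index of t becomes nonnegative when r and s are exchanged. This
        turns the chain around, so the reversed order is used and the result is carried back by
        \<open>side_compatible_converse\<close>.\<close>
      case False
      have D': "D = generate W {s, r}" and can': "canonical_generators D = {s, r}"
        using D can by (simp_all add: insert_commute)
      have ord': "ord (s \<otimes> r) = 0"
        using True ord_inv[of "r \<otimes> s"] rs by (simp add: inv_mult_group)
      have R': "linear_order_on reflections (R\<inverse>)" using R by simp
      define n where "n = nat (- 1 - i)"
      have n: "i = - 1 - int n" using False by (simp add: n_def)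
      have "- 1 - j \<noteq> int n"
      proof
        assume "- 1 - j = int n"
        then have "j = i" using n by simp
        then show False using ij tu(5) by simp
      qed
      then have "side_compatible (strict_part (R\<inverse>)) (dihedral_reflection s r (int n))
          (dihedral_reflection s r (- 1 - j))"
        using side_compatible_infinite[OF rs(2,1) rs(3)[symmetric] D' can' R'
            dihedral_chain_converse[OF rs D can True chain] ord', of "- 1 - j" n] n ij tu(5) by auto
      then show ?thesis
        using n ij side_compatible_converse[OF R] tu by (simp add: dihedral_reflection_swap[OF rs(1,2)])
    next
      case T: True
      then show ?thesis
        using side_compatible_infinite[OF rs D can R chain True, of j "nat i"] ij tu by auto
    qed
  next
    case False
    have red: "dihedral_reflection r s k = dihedral_reflection r s (int (nat (k mod int ?n)))
        \<and> nat (k mod int ?n) < ?n" for k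
      using rs False
      by (simp add: dihedral_reflection_eq_iff mod_0_imp_dvd mod_diff_left_eq nat_less_iff)
    then show ?thesis
      using side_compatible_finite[OF rs D can R chain False, of "nat (i mod int ?n)" "nat (j mod int ?n)"]
        ij tu by metis
  qed
qed

end

text \<open>These axioms are the whole interface to the order from here on. The last two are the
  dihedral ones, and the list is stable under reversal, which makes \<open>dual\<close>
  possible.\<close>

locale coxeter_reflection_order = coxeter_system +
  fixes lt :: "'a \<Rightarrow> 'a \<Rightarrow> bool" (infix \<open>\<prec>\<close> 50)
  assumes lt_irrefl: "\<not> t \<prec> t"
    and lt_trans: "t \<prec> u \<Longrightarrow> u \<prec> x \<Longrightarrow> t \<prec> x"
    and lt_total: "t \<in> reflections \<Longrightarrow> u \<in> reflections \<Longrightarrow> t \<noteq> u \<Longrightarrow> t \<prec> u \<or> u \<prec> t"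
    and lt_side: "t \<in> reflections \<Longrightarrow> u \<in> reflections \<Longrightarrow> u \<noteq> t \<Longrightarrow> side_compatible lt t u"
    and lt_no_nested: "t \<in> reflections \<Longrightarrow> u \<in> reflections \<Longrightarrow> t \<noteq> u \<Longrightarrow>
      {a, b, c, d} \<subseteq> reflections \<inter> generate W {t, u} \<Longrightarrow> a \<prec> b \<Longrightarrow> b \<prec> c \<Longrightarrow> c \<prec> d \<Longrightarrow> b \<otimes> a \<noteq> c \<otimes> d"

text \<open>The canonical pair of the subgroup generated by t and u makes the hypothesis applicable;
  naming its members suitably reduces the two directions of the chain to one.\<close>

lemma (in coxeter_system) reflection_order_locale:
  assumes "reflection_order R"
  shows "coxeter_reflection_order W I (strict_part R)"
proof -
  have R: "linear_order_on reflections R"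
    and chains: "\<And>D r s. dihedral_reflection_subgroup D \<Longrightarrow> r \<noteq> s \<Longrightarrow> canonical_generators D = {r, s} \<Longrightarrow>
      dihedral_chain R r s \<or> dihedral_chain R s r"
    using assms by (simp_all add: reflection_order_def)
  note lin = strict_part_linear[OF R]
  have chain: "\<exists>r s. r \<in> reflections \<and> s \<in> reflections \<and> r \<noteq> s \<and> generate W {t, u} = generate W {r, s} \<and>
      canonical_generators (generate W {t, u}) = {r, s} \<and> dihedral_chain R r s"
    if tu: "t \<in> reflections" "u \<in> reflections" "t \<noteq> u" for t u
  proof -
    obtain r s where rs: "r \<in> reflections" "s \<in> reflections" "r \<noteq> s"
      "canonical_generators (generate W {t, u}) = {r, s}" "generate W {t, u} = generate W {r, s}"
      using canonical_pair[OF tu HOL.refl] by blast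
    moreover have "dihedral_reflection_subgroup (generate W {t, u})"
      using tu unfolding dihedral_reflection_subgroup_def by blast
    ultimately have "dihedral_chain R r s \<or> dihedral_chain R s r" using chains by blast
    then show ?thesis
    proof
      assume "dihedral_chain R s r"
      then show ?thesis
        using rs by (intro exI[of _ s] exI[of _ r]) (simp add: insert_commute)
    qed (use rs in blast)
  qed
  show ?thesis
  proof
    show "side_compatible (strict_part R) t u" if tu: "t \<in> reflections" "u \<in> reflections" "u \<noteq> t" for t u
    proof -
      have "t \<in> generate W {t, u}" "u \<in> generate W {t, u}" by (auto intro: generate.incl)
      moreover obtain r s where "r \<in> reflections" "s \<in> reflections" "r \<noteq> s"
        "generate W {t, u} = generate W {r, s}" "canonical_generators (generate W {t, u}) = {r, s}"
        "dihedral_chain R r s"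
        using chain[OF tu(1,2) tu(3)[symmetric]] by blast
      ultimately show ?thesis using side_compatible_chain[OF _ _ _ _ _ R] tu by blast
    qed
    show "b \<otimes> a \<noteq> c \<otimes> d"
      if tu: "t \<in> reflections" "u \<in> reflections" "t \<noteq> u" "{a, b, c, d} \<subseteq> reflections \<inter> generate W {t, u}"
        "strict_part R a b" "strict_part R b c" "strict_part R c d" for t u a b c d
    proof -
      obtain r s where "r \<in> reflections" "s \<in> reflections" "r \<noteq> s"
        "generate W {t, u} = generate W {r, s}" "canonical_generators (generate W {t, u}) = {r, s}"
        "dihedral_chain R r s"
        using chain[OF tu(1-3)] by blast
      then show ?thesis using no_nested_products[OF _ _ _ _ _ R _ tu(4-7)] by blast
    qed
  qed (fact lin)+
qed

section \<open>Lifting increasing paths\<close>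

primrec labelled_path :: "('v \<Rightarrow> 'l \<Rightarrow> bool) \<Rightarrow> ('l \<Rightarrow> 'v \<Rightarrow> 'v) \<Rightarrow> 'v \<Rightarrow> 'l list \<Rightarrow> 'v \<Rightarrow> bool" where
  "labelled_path E act x [] y \<longleftrightarrow> x = y"
| "labelled_path E act x (t # ts) y \<longleftrightarrow> E x t \<and> labelled_path E act (act t x) ts y"

lemma labelled_path_append:
  "labelled_path E act x (us @ vs) z \<longleftrightarrow> (\<exists>y. labelled_path E act x us y \<and> labelled_path E act y vs z)"
  by (induction us arbitrary: x) auto

text \<open>The abstract setting of the lifting argument: \<open>\<sigma>\<close> is right multiplication by a simple
  reflection, \<open>asc\<close> holds for the elements that \<open>\<sigma>\<close> raises, and \<open>lab x\<close> is the label of the edge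
  from \<open>x\<close> to \<open>\<sigma> x\<close>. An increasing path from \<open>\<sigma> x\<close> to a descent turns into one from \<open>x\<close> by
  inserting a single label \<open>lab z\<close>, and there is exactly one position where this keeps it
  increasing.\<close>

locale path_flip =
  fixes E :: "'v \<Rightarrow> 'l \<Rightarrow> bool" and act :: "'l \<Rightarrow> 'v \<Rightarrow> 'v" and \<sigma> :: "'v \<Rightarrow> 'v"
    and asc :: "'v \<Rightarrow> bool" and lab :: "'v \<Rightarrow> 'l" and lt :: "'l \<Rightarrow> 'l \<Rightarrow> bool" (infix \<open>\<sqsubset>\<close> 50)
  assumes irrefl: "\<not> t \<sqsubset> t"
    and trans: "t \<sqsubset> u \<Longrightarrow> u \<sqsubset> v \<Longrightarrow> t \<sqsubset> v"
    and total: "asc x \<Longrightarrow> E y t \<Longrightarrow> t \<noteq> lab x \<Longrightarrow> t \<sqsubset> lab x \<or> lab x \<sqsubset> t"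
    and translate: "asc x \<Longrightarrow> E x t \<Longrightarrow> asc (act t x) \<Longrightarrow>
      E (\<sigma> x) t \<and> act t (\<sigma> x) = \<sigma> (act t x) \<and> t \<noteq> lab x \<and> t \<noteq> lab (act t x) \<and> (lab x \<sqsubset> t \<longleftrightarrow> lab (act t x) \<sqsubset> t)"
    and translate_back: "asc x \<Longrightarrow> E (\<sigma> x) t \<Longrightarrow> \<not> asc (act t (\<sigma> x)) \<Longrightarrow>
      E x t \<and> asc (act t x) \<and> act t (\<sigma> x) = \<sigma> (act t x)"
    and link: "asc x \<Longrightarrow> E (\<sigma> x) t \<Longrightarrow> asc (act t (\<sigma> x)) \<Longrightarrow> t \<sqsubset> lab x \<Longrightarrow> lab (act t (\<sigma> x)) \<sqsubset> t"
    and cross: "asc x \<Longrightarrow> E x t \<Longrightarrow> \<not> asc (act t x) \<Longrightarrow> t = lab x"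
    and cross_edge: "asc x \<Longrightarrow> E x (lab x) \<and> act (lab x) x = \<sigma> x"
    and label_neq: "asc x \<Longrightarrow> E (\<sigma> x) t \<Longrightarrow> t \<noteq> lab x"
begin

abbreviation path where "path \<equiv> labelled_path E act"
abbreviation increasing where "increasing \<equiv> sorted_wrt (\<sqsubset>)"

text \<open>The list is a path from \<open>\<sigma> x\<close>, but the tracked vertex is its partner
  x, whose own label is what may be inserted at each stage.\<close>

primrec insert_label :: "'v \<Rightarrow> 'l list \<Rightarrow> 'l list" where
  "insert_label x [] = [lab x]"
| "insert_label x (t # ts) =
    (if lab x \<sqsubset> t then lab x # t # ts else t # insert_label (act t x) ts)"

fun delete_label :: "'v \<Rightarrow> 'l list \<Rightarrow> 'l list" where
  "delete_label x [] = []"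
| "delete_label x (t # ts) = (if t = lab x then ts else t # delete_label (act t x) ts)"

text \<open>A path from an ascent to a descent must use a crossing edge, labelled by
  \<open>lab\<close> of its start. Once all labels lie above \<open>lab x\<close>,
  \<open>translate\<close> preserves this along the path, so the crossing label never
  occurs.\<close>

lemma no_crossing:
  "asc x \<Longrightarrow> path x ts y \<Longrightarrow> \<not> asc y \<Longrightarrow> increasing ts \<Longrightarrow> \<forall>t\<in>set ts. lab x \<sqsubset> t \<Longrightarrow> False"
proof (induction ts arbitrary: x)
  case (Cons t ts)
  then have t: "lab x \<sqsubset> t" "E x t" by auto
  have a: "asc (act t x)" using cross[OF Cons.prems(1) t(2)] t(1) irrefl by auto
  have "lab (act t x) \<sqsubset> t" using translate[OF Cons.prems(1) t(2) a] t(1) by simp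
  moreover have "\<forall>u\<in>set ts. t \<sqsubset> u" using Cons.prems(4) by simp
  ultimately have "\<forall>u\<in>set ts. lab (act t x) \<sqsubset> u" using trans by blast
  then show False using Cons.IH[OF a] Cons.prems by simp
qed simp

text \<open>The last conjunct carries lower bounds through the induction: it shows that the extended
  tail still lies above the label put in front of it.\<close>

lemma insert_label_path:
  assumes "asc x" "path (\<sigma> x) ts y" "\<not> asc y" "increasing ts"
  shows "path x (insert_label x ts) y \<and> increasing (insert_label x ts) \<and>
    delete_label x (insert_label x ts) = ts \<and>
    (\<forall>u. u \<sqsubset> lab x \<and> (\<forall>t\<in>set ts. u \<sqsubset> t) \<longrightarrow> (\<forall>t\<in>set (insert_label x ts). u \<sqsubset> t))"
  using assms
proof (induction ts arbitrary: x)
  case Nil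
  then show ?case using cross_edge by auto
next
  case (Cons t ts)
  note x = Cons.prems(1)
  have t: "E (\<sigma> x) t" "path (act t (\<sigma> x)) ts y" "increasing ts" "\<forall>u\<in>set ts. t \<sqsubset> u"
    using Cons.prems by auto
  show ?case
  proof (cases "lab x \<sqsubset> t")
    case True
    moreover have "\<forall>u\<in>set ts. lab x \<sqsubset> u" using True t(4) trans by blast
    ultimately show ?thesis using Cons.prems cross_edge[OF x] by simp
  next
    case False
    then have less: "t \<sqsubset> lab x" using total[OF x t(1)] label_neq[OF x t(1)] by blast
    \<comment> \<open>Had the edge led to an ascent, \<open>link\<close> would place its
      \<open>lab\<close> below t and hence below all remaining labels, and
      \<open>no_crossing\<close> would keep the path from ever reaching the descent y.\<close>
    have "\<not> asc (act t (\<sigma> x))"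
    proof
      assume a: "asc (act t (\<sigma> x))"
      have "lab (act t (\<sigma> x)) \<sqsubset> t" using link[OF x t(1) a less] .
      then have "\<forall>u\<in>set ts. lab (act t (\<sigma> x)) \<sqsubset> u" using t(4) trans by blast
      then show False using no_crossing[OF a t(2) Cons.prems(3) t(3)] by blast
    qed
    then have b: "E x t" "asc (act t x)" "act t (\<sigma> x) = \<sigma> (act t x)"
      using translate_back[OF x t(1)] by auto
    note tr = translate[OF x b(1,2)]
    have p: "path (\<sigma> (act t x)) ts y" using t(2) b(3) by simp
    have IH: "path (act t x) (insert_label (act t x) ts) y"
      "increasing (insert_label (act t x) ts)"
      "delete_label (act t x) (insert_label (act t x) ts) = ts"
      "\<And>u. u \<sqsubset> lab (act t x) \<Longrightarrow> \<forall>v\<in>set ts. u \<sqsubset> v \<Longrightarrow> \<forall>v\<in>set (insert_label (act t x) ts). u \<sqsubset> v"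
      using Cons.IH[OF b(2) p Cons.prems(3) t(3)] by blast+
    have less': "t \<sqsubset> lab (act t x)" using total[OF b(2) t(1)] tr False by metis
    then have "increasing (t # insert_label (act t x) ts)" using IH(2) IH(4)[OF less' t(4)] by simp
    moreover have "\<forall>v\<in>set (t # insert_label (act t x) ts). u \<sqsubset> v"
      if "u \<sqsubset> lab x" "\<forall>v\<in>set (t # ts). u \<sqsubset> v" for u
    proof -
      have "u \<sqsubset> t" "\<forall>v\<in>set ts. u \<sqsubset> v" using that by simp_all
      moreover have "u \<sqsubset> lab (act t x)" using trans[OF \<open>u \<sqsubset> t\<close> less'] .
      ultimately show ?thesis using IH(4)[of u] by simp
    qed
    moreover have "path x (t # insert_label (act t x) ts) y" using IH(1) b(1) by simp
    ultimately show ?thesis using False IH(3) tr by simp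
  qed
qed

text \<open>By \<open>no_crossing\<close>, every label before the crossing edge lies below the
  current \<open>lab\<close>. So the crossing label sits exactly where \<open>insert_label\<close>
  would put it, and deletion inverts insertion.\<close>

lemma delete_label_path:
  assumes "asc x" "path x ts y" "\<not> asc y" "increasing ts"
  shows "path (\<sigma> x) (delete_label x ts) y \<and> increasing (delete_label x ts) \<and>
    set (delete_label x ts) \<subseteq> set ts \<and> insert_label x (delete_label x ts) = ts"
  using assms
proof (induction ts arbitrary: x)
  case (Cons t ts)
  note x = Cons.prems(1)
  have t: "E x t" "path (act t x) ts y" "increasing ts" "\<forall>u\<in>set ts. t \<sqsubset> u"
    using Cons.prems by auto
  show ?case
  proof (cases "t = lab x")
    case True
    then show ?thesis using t cross_edge[OF x] by (cases ts) auto
  next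
    case False
    then have a: "asc (act t x)" using cross[OF x t(1)] by blast
    note tr = translate[OF x t(1) a]
    note IH = Cons.IH[OF a t(2) Cons.prems(3) t(3)]
    have "\<not> lab x \<sqsubset> t"
    proof
      assume "lab x \<sqsubset> t"
      then have "\<forall>u\<in>set ts. lab (act t x) \<sqsubset> u" using tr t(4) trans by blast
      then show False using no_crossing[OF a t(2) Cons.prems(3) t(3)] by blast
    qed
    then show ?thesis using False IH tr t by auto
  qed
qed simp

lemma unique_increasing_path_flip:
  assumes "asc x" "\<not> asc y"
  shows "(\<exists>!ts. path x ts y \<and> increasing ts) \<longleftrightarrow> (\<exists>!ts. path (\<sigma> x) ts y \<and> increasing ts)"
proof
  assume "\<exists>!ts. path x ts y \<and> increasing ts"
  then show "\<exists>!ts. path (\<sigma> x) ts y \<and> increasing ts"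
    using delete_label_path[OF assms(1) _ assms(2)] insert_label_path[OF assms(1) _ assms(2)] by metis
next
  assume "\<exists>!ts. path (\<sigma> x) ts y \<and> increasing ts"
  then show "\<exists>!ts. path x ts y \<and> increasing ts"
    using delete_label_path[OF assms(1) _ assms(2)] insert_label_path[OF assms(1) _ assms(2)] by metis
qed

end

section \<open>Right multiplication by a simple reflection and labelled covers\<close>

context coxeter_system
begin

lemma len_mult_gen_cases:
  assumes "x \<in> carrier W" "s \<in> I"
  shows "len (x \<otimes> s) = Suc (len x) \<or> len x = Suc (len (x \<otimes> s))"
proof -
  have "len (x \<otimes> s) \<le> Suc (len x)" using len_mult_le[of x s] assms by simp
  moreover have "len x \<le> Suc (len (x \<otimes> s))"
    using len_mult_le[of "x \<otimes> s" s] assms by (simp add: m_assoc)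
  moreover have "len (x \<otimes> s) \<noteq> len x" using even_len_mult[of x s] assms odd_len_gen by force
  ultimately show ?thesis by linarith
qed

text \<open>Multiplying x by s on the right changes N(x) in a single reflection, the label of the
  edge between x and x s; the last hypothesis says that t is a different one.\<close>

lemma len_less_mult_gen:
  assumes "x \<in> carrier W" "t \<in> reflections" "s \<in> I" "len x < len (t \<otimes> x)" "t \<otimes> x \<noteq> x \<otimes> s"
  shows "len (x \<otimes> s) < len (t \<otimes> x \<otimes> s)"
proof -
  have "inv x \<otimes> t \<otimes> x \<noteq> s"
  proof
    assume "inv x \<otimes> t \<otimes> x = s"
    then have "x \<otimes> (inv x \<otimes> t \<otimes> x) = x \<otimes> s" by simp
    then show False using assms by (simp add: m_assoc)
  qed
  moreover have "t \<notin> left_inversions x" using assms not_left_inversion by simp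
  ultimately have "t \<notin> left_inversions (x \<otimes> s)" using assms by (simp add: left_inversions_mult)
  then show ?thesis using assms not_left_inversion[of "x \<otimes> s" t] by (simp add: m_assoc)
qed

lemma gen_label:
  assumes "x \<in> carrier W" "s \<in> I"
  shows "x \<otimes> s \<otimes> inv x \<in> reflections" "x \<otimes> s \<otimes> inv x \<otimes> x = x \<otimes> s"
    "x \<otimes> s \<otimes> inv x \<in> left_inversions x \<longleftrightarrow> len (x \<otimes> s) < len x"
proof -
  show r: "x \<otimes> s \<otimes> inv x \<in> reflections" using assms conj_reflection by simp
  show "x \<otimes> s \<otimes> inv x \<otimes> x = x \<otimes> s" using assms by (simp add: m_assoc)
  then show "x \<otimes> s \<otimes> inv x \<in> left_inversions x \<longleftrightarrow> len (x \<otimes> s) < len x"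
    using r by (simp add: left_inversions_def)
qed

lemma gen_label_mult:
  assumes "x \<in> carrier W" "s \<in> I" "t \<in> reflections"
  shows "t \<otimes> x \<otimes> s \<otimes> inv (t \<otimes> x) = t \<otimes> (x \<otimes> s \<otimes> inv x) \<otimes> t"
  using assms by (simp add: m_assoc inv_mult_group)

text \<open>This feeds the side rule: whether t inverts the label of the edge between x and x s is
  decided by comparing s as a descent of x with s as a descent of t x.\<close>

lemma gen_label_left_inversion:
  assumes "x \<in> carrier W" "s \<in> I" "t \<in> reflections"
  shows "x \<otimes> s \<otimes> inv x \<in> left_inversions t \<longleftrightarrow> ((len (x \<otimes> s) < len x) \<noteq> (len (t \<otimes> x \<otimes> s) < len (t \<otimes> x)))"
proof -
  let ?u = "x \<otimes> s \<otimes> inv x"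
  note u = gen_label[OF assms(1,2)]
  have tut: "t \<otimes> ?u \<otimes> t \<in> reflections" using u assms reflection_conj by simp
  have [simp]: "t \<otimes> (t \<otimes> ?u \<otimes> t) \<otimes> t = ?u" using u assms by (simp add: m_assoc)
  have "len (t \<otimes> x \<otimes> s) < len (t \<otimes> x) \<longleftrightarrow> t \<otimes> ?u \<otimes> t \<in> left_inversions (t \<otimes> x)"
    using gen_label(3)[of "t \<otimes> x" s] assms by (simp add: gen_label_mult)
  also have "\<dots> \<longleftrightarrow> (t \<otimes> ?u \<otimes> t \<in> left_inversions t) \<noteq> (?u \<in> left_inversions x)"
    using tut assms by (subst left_inversions_mult) simp_all
  also have "t \<otimes> ?u \<otimes> t \<in> left_inversions t \<longleftrightarrow> ?u \<in> left_inversions t"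
    using left_inversions_mult[of t t ?u] u assms by simp
  finally show ?thesis using u(3) by blast
qed

definition up_edge :: "'a \<Rightarrow> 'a \<Rightarrow> bool" where
  "up_edge x t \<longleftrightarrow> x \<in> carrier W \<and> t \<in> reflections \<and> len (t \<otimes> x) = Suc (len x)"

definition down_edge :: "'a \<Rightarrow> 'a \<Rightarrow> bool" where
  "down_edge x t \<longleftrightarrow> x \<in> carrier W \<and> t \<in> reflections \<and> len x = Suc (len (t \<otimes> x))"

abbreviation chain :: "'a \<Rightarrow> 'a list \<Rightarrow> 'a \<Rightarrow> bool" where
  "chain \<equiv> labelled_path up_edge (\<otimes>)"

lemma up_edgeD:
  "up_edge x t \<Longrightarrow> x \<in> carrier W \<and> t \<in> reflections \<and> t \<otimes> x \<in> carrier W \<and> len (t \<otimes> x) = Suc (len x)"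
  by (simp add: up_edge_def)

lemma down_edge_iff: "t \<in> reflections \<Longrightarrow> x \<in> carrier W \<Longrightarrow> down_edge x t \<longleftrightarrow> up_edge (t \<otimes> x) t"
  by (auto simp: up_edge_def down_edge_def)

lemma chain_len: "chain x ts y \<Longrightarrow> len y = len x + length ts"
  by (induction ts arbitrary: x) (auto dest: up_edgeD)

lemma chain_reverse:
  "x \<in> carrier W \<Longrightarrow> labelled_path down_edge (\<otimes>) y (rev ts) x \<longleftrightarrow> y \<in> carrier W \<and> chain x ts y"
proof (induction ts arbitrary: x)
  case (Cons t ts)
  have "labelled_path down_edge (\<otimes>) y (rev (t # ts)) x \<longleftrightarrow>
      (\<exists>z. labelled_path down_edge (\<otimes>) y (rev ts) z \<and> down_edge z t \<and> t \<otimes> z = x)"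
    by (auto simp: labelled_path_append)
  also have "\<dots> \<longleftrightarrow> y \<in> carrier W \<and> chain x (t # ts) y"
  proof
    assume "\<exists>z. labelled_path down_edge (\<otimes>) y (rev ts) z \<and> down_edge z t \<and> t \<otimes> z = x"
    then obtain z where z: "labelled_path down_edge (\<otimes>) y (rev ts) z" "down_edge z t" "t \<otimes> z = x"
      by blast
    then have "z \<in> carrier W" "t \<in> reflections" by (auto simp: down_edge_def)
    then show "y \<in> carrier W \<and> chain x (t # ts) y"
      using Cons.IH[of z] z down_edge_iff[of t z] by auto
  next
    assume a: "y \<in> carrier W \<and> chain x (t # ts) y"
    then have "up_edge x t" by simp
    then have *: "t \<otimes> x \<in> carrier W" "t \<in> reflections" "t \<otimes> (t \<otimes> x) = x" by (auto dest: up_edgeD)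
    then show "\<exists>z. labelled_path down_edge (\<otimes>) y (rev ts) z \<and> down_edge z t \<and> t \<otimes> z = x"
      using Cons.IH[of "t \<otimes> x"] a down_edge_iff[of t "t \<otimes> x"] by (intro exI[of _ "t \<otimes> x"]) simp
  qed
  finally show ?case .
qed auto

section \<open>Bruhat order\<close>

lemma bruhat_le_refl: "x \<in> carrier W \<Longrightarrow> bruhat_le x x"
  by (simp add: bruhat_le_def)

lemma bruhat_le_induct [consumes 1, case_names refl step]:
  assumes "bruhat_le x y"
    and "P x"
    and "\<And>y t. y \<in> carrier W \<Longrightarrow> bruhat_le x y \<Longrightarrow> P y \<Longrightarrow> t \<in> reflections \<Longrightarrow> len y < len (t \<otimes> y) \<Longrightarrow> P (t \<otimes> y)"
  shows "P y"
proof -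
  have x: "x \<in> carrier W" using assms(1) by (simp add: bruhat_le_def)
  have "(x, y) \<in> {(u, t \<otimes> u) | u t. u \<in> carrier W \<and> t \<in> reflections \<and> len u < len (t \<otimes> u)}\<^sup>*"
    using assms(1) by (simp add: bruhat_le_def)
  then show ?thesis
  proof (induction rule: rtrancl_induct)
    case base
    then show ?case using assms(2) .
  next
    case (step y z)
    then have "bruhat_le x y" using x by (simp add: bruhat_le_def)
    then show ?case using step assms(3) by auto
  qed
qed

lemma bruhat_le_step:
  assumes "bruhat_le x y" "y \<in> carrier W" "t \<in> reflections" "len y < len (t \<otimes> y)"
  shows "bruhat_le x (t \<otimes> y)"
proof -
  have "(y, t \<otimes> y) \<in> {(u, t \<otimes> u) | u t. u \<in> carrier W \<and> t \<in> reflections \<and> len u < len (t \<otimes> u)}"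
    using assms by blast
  then show ?thesis using assms(1) unfolding bruhat_le_def by (blast intro: rtrancl_into_rtrancl)
qed

lemma bruhat_le_trans: "bruhat_le x y \<Longrightarrow> bruhat_le y z \<Longrightarrow> bruhat_le x z"
  unfolding bruhat_le_def by auto

lemma bruhat_le_closed:
  assumes "bruhat_le x y"
  shows "x \<in> carrier W \<and> y \<in> carrier W"
proof -
  have "x \<in> carrier W" using assms by (simp add: bruhat_le_def)
  with assms show ?thesis by (induction rule: bruhat_le_induct) auto
qed

lemma bruhat_le_len: "bruhat_le x y \<Longrightarrow> x = y \<or> len x < len y"
  by (induction rule: bruhat_le_induct) auto

lemma bruhat_le_mult_gen:
  assumes "x \<in> carrier W" "s \<in> I" "len x < len (x \<otimes> s)"
  shows "bruhat_le x (x \<otimes> s)"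
  using bruhat_le_step[OF bruhat_le_refl, of x "x \<otimes> s \<otimes> inv x"] gen_label[of x s] assms by simp

lemma chain_bruhat_le: "x \<in> carrier W \<Longrightarrow> chain x ts y \<Longrightarrow> bruhat_le x y"
proof (induction ts arbitrary: x)
  case (Cons t ts)
  then have t: "up_edge x t" "chain (t \<otimes> x) ts y" by auto
  then have "bruhat_le x (t \<otimes> x)"
    using bruhat_le_step[OF bruhat_le_refl] up_edgeD[OF t(1)] by simp
  then show ?case using Cons t up_edgeD bruhat_le_trans by metis
qed (simp add: bruhat_le_refl)

text \<open>The minimal representative of the coset consisting of x and x s.\<close>

definition lower_mult :: "'a \<Rightarrow> 'a \<Rightarrow> 'a" where
  "lower_mult s x = (if len (x \<otimes> s) < len x then x \<otimes> s else x)"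

text \<open>The lifting property, stated as monotonicity of the coset projection. A Bruhat step
  either stays inside one coset or persists after multiplication by s, and the lower element of a
  coset is below both of its members.\<close>

lemma lower_mult_mono:
  assumes "bruhat_le x y" "s \<in> I"
  shows "bruhat_le (lower_mult s x) (lower_mult s y)"
  using assms(1)
proof (induction rule: bruhat_le_induct)
  case refl
  then show ?case using assms bruhat_le_closed by (auto simp: lower_mult_def intro: bruhat_le_refl)
next
  case (step y t)
  have ty: "t \<otimes> y \<in> carrier W" using step by simp
  have "bruhat_le (lower_mult s y) (lower_mult s (t \<otimes> y))"
  proof (cases "t \<otimes> y = y \<otimes> s")
    case True
    have "len y < len (y \<otimes> s)" using step.hyps True by simp
    then have "lower_mult s y = y" "lower_mult s (t \<otimes> y) = y"
      using True step.hyps(1) assms(2) by (simp_all add: lower_mult_def m_assoc)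
    then show ?thesis using step.hyps(1) by (simp add: bruhat_le_refl)
  next
    case False
    have less: "len (y \<otimes> s) < len (t \<otimes> y \<otimes> s)"
      using len_less_mult_gen step assms False by simp
    have le: "bruhat_le y (t \<otimes> y)" "bruhat_le (y \<otimes> s) (t \<otimes> y \<otimes> s)"
      using bruhat_le_step[OF bruhat_le_refl, of y t] bruhat_le_step[OF bruhat_le_refl, of "y \<otimes> s" t]
        step less assms by (simp_all add: m_assoc)
    have down: "bruhat_le (z \<otimes> s) z" if "z \<in> carrier W" "len (z \<otimes> s) < len z" for z
      using bruhat_le_mult_gen[of "z \<otimes> s" s] that assms by (simp add: m_assoc)
    have up: "bruhat_le z (z \<otimes> s)" if "z \<in> carrier W" "\<not> len (z \<otimes> s) < len z" for z
      using bruhat_le_mult_gen[of z s] len_mult_gen_cases[of z s] that assms by auto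
    have lo: "bruhat_le (lower_mult s y) y" "bruhat_le (lower_mult s y) (y \<otimes> s)"
      using down[of y] up[of y] step.hyps(1) assms(2) by (simp_all add: lower_mult_def bruhat_le_refl)
    show ?thesis
      using bruhat_le_trans[OF lo(1) le(1)] bruhat_le_trans[OF lo(2) le(2)]
      by (simp add: lower_mult_def[of s "t \<otimes> y"])
  qed
  then show ?case using step bruhat_le_trans by blast
qed

end

section \<open>Reversal of the order, and the side rule for labels of simple edges\<close>

context coxeter_reflection_order
begin

lemma lt_asym: "t \<prec> u \<Longrightarrow> \<not> u \<prec> t"
  using lt_irrefl lt_trans by blast

lemma conj_neq_self:
  assumes "t \<in> reflections" "u \<in> reflections" "u \<noteq> t"
  shows "t \<otimes> u \<otimes> t \<noteq> t"
proof
  assume "t \<otimes> u \<otimes> t = t"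
  then have "t \<otimes> (t \<otimes> u \<otimes> t) \<otimes> t = t" using assms by simp
  then show False using assms by (simp add: m_assoc)
qed

lemma dual: "coxeter_reflection_order W I (\<lambda>a b. b \<prec> a)"
proof
  show "side_compatible (\<lambda>a b. b \<prec> a) t u" if "t \<in> reflections" "u \<in> reflections" "u \<noteq> t" for t u
  proof -
    have "t \<otimes> u \<otimes> t \<in> reflections" using that reflection_conj by simp
    then show ?thesis
      using lt_side[OF that] that conj_neq_self[OF that] lt_total lt_asym unfolding side_compatible_def by metis
  qed
  show "b \<otimes> a \<noteq> c \<otimes> d"
    if "t \<in> reflections" "u \<in> reflections" "t \<noteq> u" "{a, b, c, d} \<subseteq> reflections \<inter> generate W {t, u}"
      "b \<prec> a" "c \<prec> b" "d \<prec> c" for t u a b c d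
    using lt_no_nested[OF that(1-3), of d c b a] that(4-7) by fastforce
qed (use lt_irrefl lt_trans lt_total in blast)+

text \<open>The side rule at the label of the edge between x and x s. Conjugation by t turns it into
  the label at t x, and the two cases of the rule become: s has the same type (ascent or descent) at
  x and t x, or opposite types.\<close>

lemma gen_label_side:
  assumes x: "x \<in> carrier W" and s: "s \<in> I" and t: "t \<in> reflections" "t \<otimes> x \<noteq> x \<otimes> s"
  shows "x \<otimes> s \<otimes> inv x \<noteq> t"
    and "(len (x \<otimes> s) < len x) = (len (t \<otimes> x \<otimes> s) < len (t \<otimes> x)) \<Longrightarrow>
      (t \<otimes> x \<otimes> s \<otimes> inv (t \<otimes> x) \<prec> t \<longleftrightarrow> x \<otimes> s \<otimes> inv x \<prec> t)"
    and "(len (x \<otimes> s) < len x) \<noteq> (len (t \<otimes> x \<otimes> s) < len (t \<otimes> x)) \<Longrightarrow>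
      (t \<prec> t \<otimes> x \<otimes> s \<otimes> inv (t \<otimes> x) \<longleftrightarrow> x \<otimes> s \<otimes> inv x \<prec> t)"
proof -
  note u = gen_label[OF x s]
  show neq: "x \<otimes> s \<otimes> inv x \<noteq> t" using u(2) t(2) by auto
  note side = lt_side[OF t(1) u(1) neq, unfolded side_compatible_def
      gen_label_left_inversion[OF x s t(1)], folded gen_label_mult[OF x s t(1)]]
  show "(len (x \<otimes> s) < len x) = (len (t \<otimes> x \<otimes> s) < len (t \<otimes> x)) \<Longrightarrow>
      (t \<otimes> x \<otimes> s \<otimes> inv (t \<otimes> x) \<prec> t \<longleftrightarrow> x \<otimes> s \<otimes> inv x \<prec> t)"
    "(len (x \<otimes> s) < len x) \<noteq> (len (t \<otimes> x \<otimes> s) < len (t \<otimes> x)) \<Longrightarrow>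
      (t \<prec> t \<otimes> x \<otimes> s \<otimes> inv (t \<otimes> x) \<longleftrightarrow> x \<otimes> s \<otimes> inv x \<prec> t)"
    using side by blast+
qed

end

section \<open>Finiteness of lower intervals, and the labels of intervals of length two\<close>

context coxeter_system
begin

lemma gen_label_mult_gen: "x \<in> carrier W \<Longrightarrow> s \<in> I \<Longrightarrow> x \<otimes> s \<otimes> s \<otimes> inv (x \<otimes> s) = x \<otimes> s \<otimes> inv x"
  by (simp add: m_assoc inv_mult_group)

lemma mult_gen_cancel: "x \<in> carrier W \<Longrightarrow> s \<in> I \<Longrightarrow> x \<otimes> s \<otimes> s = x"
  by (simp add: m_assoc)

text \<open>By the lifting property everything below y lies in the coset of some element below y s,
  so the lower set at most doubles with each letter of y.\<close>

lemma finite_bruhat_lower: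
  assumes "y \<in> carrier W"
  shows "finite {x. bruhat_le x y}"
  using assms
proof (induction "len y" arbitrary: y rule: less_induct)
  case less
  show ?case
  proof (cases "y = \<one>")
    case True
    then have "{x. bruhat_le x y} \<subseteq> {\<one>}" using bruhat_le_len[of _ \<one>] by auto
    then show ?thesis using finite_subset by blast
  next
    case False
    then obtain s where s: "s \<in> I" "len (y \<otimes> s) < len y" using right_descent less.prems by blast
    let ?F = "{x. bruhat_le x (y \<otimes> s)}"
    have "{x. bruhat_le x y} \<subseteq> ?F \<union> (\<lambda>x. x \<otimes> s) ` ?F"
    proof
      fix x assume "x \<in> {x. bruhat_le x y}"
      then have x: "bruhat_le x y" by simp
      then have "bruhat_le (lower_mult s x) (y \<otimes> s)"
        using lower_mult_mono[OF x s(1)] s(2) by (simp add: lower_mult_def[of s y])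
      moreover have "x = lower_mult s x \<or> x = lower_mult s x \<otimes> s"
        using bruhat_le_closed[OF x] s(1) by (simp add: lower_mult_def mult_gen_cancel)
      ultimately show "x \<in> ?F \<union> (\<lambda>x. x \<otimes> s) ` ?F" by auto
    qed
    moreover have "finite ?F" using less s by simp
    ultimately show ?thesis using finite_subset by blast
  qed
qed

text \<open>Otherwise x, x s, t x s, t x would have strictly increasing lengths, although the first
  and the last differ by one only.\<close>

lemma up_edge_asc_desc:
  assumes "up_edge x t" "s \<in> I" "len x < len (x \<otimes> s)" "len (t \<otimes> x \<otimes> s) < len (t \<otimes> x)"
  shows "t \<otimes> x = x \<otimes> s" "t = x \<otimes> s \<otimes> inv x"
proof -
  note x = up_edgeD[OF assms(1)]
  show e: "t \<otimes> x = x \<otimes> s"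
  proof (rule ccontr)
    assume "t \<otimes> x \<noteq> x \<otimes> s"
    then have "len (x \<otimes> s) < len (t \<otimes> x \<otimes> s)" using len_less_mult_gen x assms(2) by simp
    then show False
      using assms(3,4) x by linarith
  qed
  then have "t \<otimes> x \<otimes> inv x = x \<otimes> s \<otimes> inv x" by simp
  then show "t = x \<otimes> s \<otimes> inv x" using x by (simp add: m_assoc)
qed

lemma up_edge_mult_gen:
  assumes "up_edge x t" "s \<in> I" "(len x < len (x \<otimes> s)) = (len (t \<otimes> x) < len (t \<otimes> x \<otimes> s))"
  shows "up_edge (x \<otimes> s) t" "t \<otimes> (x \<otimes> s) = t \<otimes> x \<otimes> s"
proof -
  note x = up_edgeD[OF assms(1)]
  show e: "t \<otimes> (x \<otimes> s) = t \<otimes> x \<otimes> s" using x assms(2) by (simp add: m_assoc)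
  show "up_edge (x \<otimes> s) t"
    using len_mult_gen_cases[of x s] len_mult_gen_cases[of "t \<otimes> x" s] x assms(2,3)
    unfolding up_edge_def e by auto
qed

lemma up_edge_desc:
  assumes "x \<in> carrier W" "s \<in> I" "len (x \<otimes> s) < len x"
  shows "up_edge (x \<otimes> s) (x \<otimes> s \<otimes> inv x)" "(x \<otimes> s \<otimes> inv x) \<otimes> (x \<otimes> s) = x"
proof -
  show e: "(x \<otimes> s \<otimes> inv x) \<otimes> (x \<otimes> s) = x" using assms by (simp add: m_assoc)
  show "up_edge (x \<otimes> s) (x \<otimes> s \<otimes> inv x)"
    unfolding up_edge_def e using assms gen_label(1) len_mult_gen_cases[of x s] by auto
qed

lemma not_asc_iff: "x \<in> carrier W \<Longrightarrow> s \<in> I \<Longrightarrow> \<not> len x < len (x \<otimes> s) \<longleftrightarrow> len (x \<otimes> s) < len x"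
  using len_mult_gen_cases[of x s] by auto

text \<open>Let \<open>z\<close> be the top of the interval and \<open>s\<close> a right descent of \<open>z\<close>. If \<open>s\<close> is an ascent of \<open>x\<close>, the
  middle elements are \<open>x s\<close> and \<open>z s\<close>; otherwise one passes to the interval from \<open>x s\<close> to \<open>z s\<close>.\<close>

lemma two_step_labels:
  assumes "up_edge x a" "up_edge (a \<otimes> x) b" "up_edge x a'" "up_edge (a' \<otimes> x) b'"
    and "b \<otimes> (a \<otimes> x) = b' \<otimes> (a' \<otimes> x)"
  shows "{a', b'} \<subseteq> generate W {a, b}"
  using assms
proof (induction "len x" arbitrary: x a b a' b' rule: less_induct)
  case less
  note x = less.prems
  let ?y = "a \<otimes> x" and ?y' = "a' \<otimes> x" and ?z = "b \<otimes> (a \<otimes> x)"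
  have c: "x \<in> carrier W" "?y \<in> carrier W" "?y' \<in> carrier W" "?z \<in> carrier W"
    and r: "a \<in> reflections" "b \<in> reflections" "a' \<in> reflections" "b' \<in> reflections"
    and l: "len ?z = Suc (Suc (len x))" "len ?y = Suc (len x)" "len ?y' = Suc (len x)"
    using up_edgeD[OF x(1)] up_edgeD[OF x(2)] up_edgeD[OF x(3)] up_edgeD[OF x(4)] by auto
  have "?z \<noteq> \<one>" using l by force
  then obtain s where s: "s \<in> I" "len (?z \<otimes> s) < len ?z" using right_descent c by blast
  let ?G = "generate W {a, b}"
  have ab: "a \<in> ?G" "b \<in> ?G" by (auto intro: generate.incl)
  note mult = generate.eng[of _ W "{a, b}"]
  have products: "b \<otimes> a = b' \<otimes> a'"
  proof -
    have "(b \<otimes> a) \<otimes> x = (b' \<otimes> a') \<otimes> x" using x(5) c(1) r by (simp add: m_assoc)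
    then show ?thesis using c(1) r by (simp only: right_cancel m_closed reflection_closed)
  qed
  have z': "len (b' \<otimes> ?y' \<otimes> s) < len (b' \<otimes> ?y')" using s x(5) by simp
  \<comment> \<open>If s raises both middle elements, both are mapped by s to the top; if s raises x
    and lowers both, both are x s. In either event they coincide, so these are the remaining
    patterns.\<close>
  consider (asc_desc) "len x < len (x \<otimes> s)" "len ?y < len (?y \<otimes> s)" "len (?y' \<otimes> s) < len ?y'"
    | (desc_asc) "len x < len (x \<otimes> s)" "len (?y \<otimes> s) < len ?y" "len ?y' < len (?y' \<otimes> s)"
    | (same) "?y = ?y'"
    | (desc) "len (x \<otimes> s) < len x" "len (?y \<otimes> s) < len ?y" "len (?y' \<otimes> s) < len ?y'"
    | (asc1) "len (x \<otimes> s) < len x" "len ?y < len (?y \<otimes> s)" "len (?y' \<otimes> s) < len ?y'"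
    | (asc2) "len (x \<otimes> s) < len x" "len (?y \<otimes> s) < len ?y" "len ?y' < len (?y' \<otimes> s)"
  proof -
    have "?y = ?y'" if "len ?y < len (?y \<otimes> s)" "len ?y' < len (?y' \<otimes> s)"
    proof -
      have "?y \<otimes> s = ?y' \<otimes> s"
        using up_edge_asc_desc(1)[OF x(2) s(1) that(1) s(2)] up_edge_asc_desc(1)[OF x(4) s(1) that(2) z'] x(5)
        by simp
      then show ?thesis using c s by simp
    qed
    moreover have "?y = ?y'" if "len x < len (x \<otimes> s)" "len (?y \<otimes> s) < len ?y" "len (?y' \<otimes> s) < len ?y'"
      using up_edge_asc_desc(1)[OF x(1) s(1) that(1,2)] up_edge_asc_desc(1)[OF x(3) s(1) that(1,3)] by simp
    ultimately show thesis
      using that not_asc_iff[OF c(1) s(1)] not_asc_iff[OF c(2) s(1)] not_asc_iff[OF c(3) s(1)] by blast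
  qed
  then show ?case
  proof cases
    \<comment> \<open>Here y' = x s and z = y s, so a' and b are labels of simple edges and
      conjugate under a.\<close>
    case asc_desc
    have a': "a' = x \<otimes> s \<otimes> inv x" using up_edge_asc_desc(2)[OF x(3) s(1) asc_desc(1,3)] .
    have "b = ?y \<otimes> s \<otimes> inv ?y" using up_edge_asc_desc(2)[OF x(2) s(1) asc_desc(2) s(2)] .
    then have "b = a \<otimes> a' \<otimes> a" using gen_label_mult[OF c(1) s(1) r(1)] a' by simp
    then have "a' = a \<otimes> b \<otimes> a" using r by (simp add: m_assoc)
    moreover have "b' = b \<otimes> a \<otimes> a'" using products r by (simp add: m_assoc)
    ultimately show ?thesis using ab mult by auto
  next
    case desc_asc
    have a: "a = x \<otimes> s \<otimes> inv x" using up_edge_asc_desc(2)[OF x(1) s(1) desc_asc(1,2)] .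
    have "b' = ?y' \<otimes> s \<otimes> inv ?y'" using up_edge_asc_desc(2)[OF x(4) s(1) desc_asc(3) z'] .
    then have b': "b' = a' \<otimes> a \<otimes> a'" using gen_label_mult[OF c(1) s(1) r(3)] a by simp
    then have "b \<otimes> a = a' \<otimes> a" using products r by (simp add: m_assoc)
    then have "a' = b" using r by simp
    then show ?thesis using ab mult b' by auto
  next
    case same
    then have "a = a'" using c(1) r by simp
    moreover from this have "b = b'" using products r by simp
    ultimately show ?thesis using ab by simp
  next
    case desc
    have e: "up_edge (x \<otimes> s) a" "a \<otimes> (x \<otimes> s) = ?y \<otimes> s"
      using up_edge_mult_gen[OF x(1) s(1)] desc by auto
    have f: "up_edge (?y \<otimes> s) b" "b \<otimes> (?y \<otimes> s) = ?z \<otimes> s"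
      using up_edge_mult_gen[OF x(2) s(1)] desc s(2) by auto
    have e': "up_edge (x \<otimes> s) a'" "a' \<otimes> (x \<otimes> s) = ?y' \<otimes> s"
      using up_edge_mult_gen[OF x(3) s(1)] desc by auto
    have f': "up_edge (?y' \<otimes> s) b'" "b' \<otimes> (?y' \<otimes> s) = ?z \<otimes> s"
      using up_edge_mult_gen[OF x(4) s(1)] desc z' x(5) by auto
    show ?thesis using less.hyps[OF desc(1), of a b a' b'] e f e' f' by simp
  next
    \<comment> \<open>As z = y s, the interval from x s to z s has top y. One of its chains passes
      through x with labels \<open>?v\<close> and a, the other is the s-translate of the second
      given chain.\<close>
    case asc1
    let ?v = "x \<otimes> s \<otimes> inv x"
    have v: "up_edge (x \<otimes> s) ?v" "?v \<otimes> (x \<otimes> s) = x" "?v \<in> reflections"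
      using up_edge_desc[OF c(1) s(1) asc1(1)] gen_label(1)[OF c(1) s(1)] by auto
    have z: "?z = ?y \<otimes> s" "b = ?y \<otimes> s \<otimes> inv ?y"
      using up_edge_asc_desc[OF x(2) s(1) asc1(2) s(2)] by auto
    then have "b = a \<otimes> ?v \<otimes> a" using gen_label_mult[OF c(1) s(1) r(1)] by simp
    then have "?v = a \<otimes> b \<otimes> a" using r v(3) by (simp only: m_assoc reflection_closed m_closed) simp
    then have "?v \<in> ?G" using ab mult by auto
    then have sub: "generate W {?v, a} \<subseteq> ?G"
      using ab r by (intro generate_subgroup_incl generate_is_subgroup) auto
    have e': "up_edge (x \<otimes> s) a'" "a' \<otimes> (x \<otimes> s) = ?y' \<otimes> s"
      using up_edge_mult_gen[OF x(3) s(1)] asc1 by auto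
    have f': "up_edge (?y' \<otimes> s) b'" "b' \<otimes> (?y' \<otimes> s) = ?z \<otimes> s"
      using up_edge_mult_gen[OF x(4) s(1)] asc1 z' x(5) by auto
    have "?z \<otimes> s = ?y" using z c s mult_gen_cancel by simp
    then have "{a', b'} \<subseteq> generate W {?v, a}"
      using less.hyps[OF asc1(1), of ?v a a' b'] v x(1) e' f' by simp
    then show ?thesis using sub by blast
  next
    \<comment> \<open>The mirror case: now z s = y', so the chain through x has labels
      \<open>?v\<close> and a', and the first given chain is the one that is translated.\<close>
    case asc2
    let ?v = "x \<otimes> s \<otimes> inv x"
    have v: "up_edge (x \<otimes> s) ?v" "?v \<otimes> (x \<otimes> s) = x" "?v \<in> reflections"
      using up_edge_desc[OF c(1) s(1) asc2(1)] gen_label(1)[OF c(1) s(1)] by auto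
    have z: "b' \<otimes> ?y' = ?y' \<otimes> s" "b' = ?y' \<otimes> s \<otimes> inv ?y'"
      using up_edge_asc_desc[OF x(4) s(1) asc2(3) z'] by auto
    have e: "up_edge (x \<otimes> s) a" "a \<otimes> (x \<otimes> s) = ?y \<otimes> s"
      using up_edge_mult_gen[OF x(1) s(1)] asc2 by auto
    have f: "up_edge (?y \<otimes> s) b" "b \<otimes> (?y \<otimes> s) = ?z \<otimes> s"
      using up_edge_mult_gen[OF x(2) s(1)] asc2 s(2) by auto
    have "?z \<otimes> s = ?y'" using z c s mult_gen_cancel x(5) by simp
    then have "{?v, a'} \<subseteq> ?G"
      using less.hyps[OF asc2(1), of a b ?v a'] v x(3) e f by simp
    moreover have "b' = a' \<otimes> ?v \<otimes> a'" using gen_label_mult[OF c(1) s(1) r(3)] z by simp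
    ultimately show ?thesis using mult by auto
  qed
qed

end

section \<open>Flipping an endpoint of a chain by a simple reflection\<close>

context coxeter_reflection_order
begin

lemma flip_up:
  assumes s: "s \<in> I"
  shows "path_flip up_edge (\<otimes>) (\<lambda>x. x \<otimes> s) (\<lambda>x. x \<in> carrier W \<and> len x < len (x \<otimes> s))
    (\<lambda>x. x \<otimes> s \<otimes> inv x) (\<prec>)"
proof
  fix t u v assume "t \<prec> u" "u \<prec> v" then show "t \<prec> v" by (rule lt_trans)
next
  fix x y t assume "x \<in> carrier W \<and> len x < len (x \<otimes> s)" "up_edge y t" "t \<noteq> x \<otimes> s \<otimes> inv x"
  then show "t \<prec> x \<otimes> s \<otimes> inv x \<or> x \<otimes> s \<otimes> inv x \<prec> t"
    using lt_total gen_label(1) s up_edgeD by blast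
next
  fix x t assume x: "x \<in> carrier W \<and> len x < len (x \<otimes> s)" and t: "up_edge x t"
    and tx: "t \<otimes> x \<in> carrier W \<and> len (t \<otimes> x) < len (t \<otimes> x \<otimes> s)"
  note e = up_edge_mult_gen[OF t s]
  note tc = up_edgeD[OF t]
  have n1: "t \<otimes> x \<noteq> x \<otimes> s" using x tx mult_gen_cancel[of x s] s by auto
  have n2: "t \<otimes> (t \<otimes> x) \<noteq> t \<otimes> x \<otimes> s" using tc tx by auto
  show "up_edge (x \<otimes> s) t \<and> t \<otimes> (x \<otimes> s) = t \<otimes> x \<otimes> s \<and> t \<noteq> x \<otimes> s \<otimes> inv x \<and>
      t \<noteq> t \<otimes> x \<otimes> s \<otimes> inv (t \<otimes> x) \<and> (x \<otimes> s \<otimes> inv x \<prec> t \<longleftrightarrow> t \<otimes> x \<otimes> s \<otimes> inv (t \<otimes> x) \<prec> t)"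
    using e gen_label_side(1,2)[of x s t, OF _ s _ n1] gen_label_side(1)[of "t \<otimes> x" s t, OF _ s _ n2] tc x tx
    by auto
next
  fix x t assume x: "x \<in> carrier W \<and> len x < len (x \<otimes> s)" and t: "up_edge (x \<otimes> s) t"
    and tx: "\<not> (t \<otimes> (x \<otimes> s) \<in> carrier W \<and> len (t \<otimes> (x \<otimes> s)) < len (t \<otimes> (x \<otimes> s) \<otimes> s))"
  note tc = up_edgeD[OF t]
  have c: "t \<otimes> (x \<otimes> s) \<otimes> s = t \<otimes> x" "t \<otimes> (x \<otimes> s) = t \<otimes> x \<otimes> s" using x s tc by (simp_all add: m_assoc)
  then show "up_edge x t \<and> (t \<otimes> x \<in> carrier W \<and> len (t \<otimes> x) < len (t \<otimes> x \<otimes> s)) \<and> t \<otimes> (x \<otimes> s) = t \<otimes> x \<otimes> s"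
    using tc x tx s len_mult_gen_cases[of x s] len_mult_gen_cases[of "t \<otimes> x" s] by (auto simp: up_edge_def)
next
  fix x t assume x: "x \<in> carrier W \<and> len x < len (x \<otimes> s)" and t: "up_edge (x \<otimes> s) t"
    and tx: "t \<otimes> (x \<otimes> s) \<in> carrier W \<and> len (t \<otimes> (x \<otimes> s)) < len (t \<otimes> (x \<otimes> s) \<otimes> s)"
    and less: "t \<prec> x \<otimes> s \<otimes> inv x"
  note tc = up_edgeD[OF t]
  have c: "t \<otimes> (x \<otimes> s) \<otimes> s = t \<otimes> x" "t \<otimes> (x \<otimes> s) = t \<otimes> x \<otimes> s" using x s tc by (simp_all add: m_assoc)
  have n: "t \<otimes> x \<noteq> x \<otimes> s"
  proof
    assume "t \<otimes> x = x \<otimes> s"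
    then have "t \<otimes> (t \<otimes> x) = t \<otimes> (x \<otimes> s)" by simp
    then have "x = t \<otimes> (x \<otimes> s)" using tc x by simp
    then show False using tc x by simp
  qed
  have lab: "t \<otimes> (x \<otimes> s) \<otimes> s \<otimes> inv (t \<otimes> (x \<otimes> s)) = t \<otimes> x \<otimes> s \<otimes> inv (t \<otimes> x)"
    using gen_label_mult_gen[of "t \<otimes> x" s] x s tc unfolding c(2) by simp
  \<comment> \<open>Here s raises x but lowers t x, so the opposite-types case of the side rule
    applies and moves the label to the other side of t.\<close>
  have "t \<prec> t \<otimes> x \<otimes> s \<otimes> inv (t \<otimes> x) \<longleftrightarrow> x \<otimes> s \<otimes> inv x \<prec> t"
  proof -
    have "len (t \<otimes> x \<otimes> s) < len (t \<otimes> x)" using tx unfolding c(1) unfolding c(2) by simp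
    then show ?thesis using gen_label_side(3)[OF _ s _ n] x tc by simp
  qed
  moreover have "t \<otimes> x \<otimes> s \<otimes> inv (t \<otimes> x) \<noteq> t"
  proof -
    have "t \<otimes> (t \<otimes> x) \<noteq> t \<otimes> x \<otimes> s" using n tc x s c by (metis reflection_cancel)
    then show ?thesis using gen_label_side(1)[of "t \<otimes> x" s t] s tc x by simp
  qed
  moreover have "t \<otimes> x \<otimes> s \<otimes> inv (t \<otimes> x) \<in> reflections" using gen_label(1)[of "t \<otimes> x" s] s tc x by simp
  ultimately show "t \<otimes> (x \<otimes> s) \<otimes> s \<otimes> inv (t \<otimes> (x \<otimes> s)) \<prec> t"
    unfolding lab using less lt_asym lt_total tc by blast
next
  fix x t assume "x \<in> carrier W \<and> len x < len (x \<otimes> s)" "up_edge x t"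
    "\<not> (t \<otimes> x \<in> carrier W \<and> len (t \<otimes> x) < len (t \<otimes> x \<otimes> s))"
  then show "t = x \<otimes> s \<otimes> inv x"
    using up_edge_asc_desc(2)[OF _ s] not_asc_iff[OF _ s] up_edgeD by metis
next
  fix x assume "x \<in> carrier W \<and> len x < len (x \<otimes> s)"
  then show "up_edge x (x \<otimes> s \<otimes> inv x) \<and> x \<otimes> s \<otimes> inv x \<otimes> x = x \<otimes> s"
    using gen_label[of x s] s len_mult_gen_cases[of x s] by (auto simp: up_edge_def)
next
  fix x t assume x: "x \<in> carrier W \<and> len x < len (x \<otimes> s)" and t: "up_edge (x \<otimes> s) t"
  show "t \<noteq> x \<otimes> s \<otimes> inv x"
  proof
    assume "t = x \<otimes> s \<otimes> inv x"
    then have "t \<otimes> (x \<otimes> s) = x" using x s by (simp add: m_assoc)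
    then show False using t x by (simp add: up_edge_def)
  qed
qed (rule lt_irrefl)

text \<open>The same setting for chains read from the top: steps go down, an increasing chain is
  read as a decreasing list, and the role of ascents is taken by the elements that s lowers. It lets
  the upper end of a chain be changed.\<close>

lemma flip_down:
  assumes s: "s \<in> I"
  shows "path_flip down_edge (\<otimes>) (\<lambda>x. x \<otimes> s) (\<lambda>x. x \<in> carrier W \<and> len (x \<otimes> s) < len x)
    (\<lambda>x. x \<otimes> s \<otimes> inv x) (\<lambda>a b. b \<prec> a)"
proof
  fix t u v assume "u \<prec> t" "v \<prec> u" then show "v \<prec> t" by (blast intro: lt_trans)
next
  fix x y t assume "x \<in> carrier W \<and> len (x \<otimes> s) < len x" "down_edge y t" "t \<noteq> x \<otimes> s \<otimes> inv x"
  then show "x \<otimes> s \<otimes> inv x \<prec> t \<or> t \<prec> x \<otimes> s \<otimes> inv x"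
    using lt_total gen_label(1) s unfolding down_edge_def by blast
next
  fix x t assume x: "x \<in> carrier W \<and> len (x \<otimes> s) < len x" and t: "down_edge x t"
    and tx: "t \<otimes> x \<in> carrier W \<and> len (t \<otimes> x \<otimes> s) < len (t \<otimes> x)"
  have tc: "t \<in> reflections" "len x = Suc (len (t \<otimes> x))" using t by (auto simp: down_edge_def)
  have e: "t \<otimes> (x \<otimes> s) = t \<otimes> x \<otimes> s" using x tc s by (simp add: m_assoc)
  have d: "down_edge (x \<otimes> s) t" unfolding down_edge_def e
    using x tx tc s len_mult_gen_cases[of x s] len_mult_gen_cases[of "t \<otimes> x" s] by auto
  have n1: "t \<otimes> x \<noteq> x \<otimes> s" using x tx mult_gen_cancel[of x s] s by auto
  have n2: "t \<otimes> (t \<otimes> x) \<noteq> t \<otimes> x \<otimes> s" using tc x tx by auto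
  have "t \<otimes> x \<otimes> s \<otimes> inv (t \<otimes> x) \<in> reflections" "x \<otimes> s \<otimes> inv x \<in> reflections"
    using gen_label(1) x tx s by auto
  moreover note gen_label_side(1,2)[of x s t, OF _ s _ n1] gen_label_side(1)[of "t \<otimes> x" s t, OF _ s _ n2]
  ultimately show "down_edge (x \<otimes> s) t \<and> t \<otimes> (x \<otimes> s) = t \<otimes> x \<otimes> s \<and> t \<noteq> x \<otimes> s \<otimes> inv x \<and>
      t \<noteq> t \<otimes> x \<otimes> s \<otimes> inv (t \<otimes> x) \<and> (t \<prec> x \<otimes> s \<otimes> inv x \<longleftrightarrow> t \<prec> t \<otimes> x \<otimes> s \<otimes> inv (t \<otimes> x))"
    using d e tc x tx lt_total lt_asym by metis
next
  fix x t assume x: "x \<in> carrier W \<and> len (x \<otimes> s) < len x" and t: "down_edge (x \<otimes> s) t"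
    and tx: "\<not> (t \<otimes> (x \<otimes> s) \<in> carrier W \<and> len (t \<otimes> (x \<otimes> s) \<otimes> s) < len (t \<otimes> (x \<otimes> s)))"
  have tc: "t \<in> reflections" "len (x \<otimes> s) = Suc (len (t \<otimes> (x \<otimes> s)))" using t by (auto simp: down_edge_def)
  have c: "t \<otimes> (x \<otimes> s) \<otimes> s = t \<otimes> x" "t \<otimes> (x \<otimes> s) = t \<otimes> x \<otimes> s" using x s tc by (simp_all add: m_assoc)
  then show "down_edge x t \<and> (t \<otimes> x \<in> carrier W \<and> len (t \<otimes> x \<otimes> s) < len (t \<otimes> x)) \<and> t \<otimes> (x \<otimes> s) = t \<otimes> x \<otimes> s"
    using tc x tx s len_mult_gen_cases[of x s] len_mult_gen_cases[of "t \<otimes> x" s] by (auto simp: down_edge_def)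
next
  fix x t assume x: "x \<in> carrier W \<and> len (x \<otimes> s) < len x" and t: "down_edge (x \<otimes> s) t"
    and tx: "t \<otimes> (x \<otimes> s) \<in> carrier W \<and> len (t \<otimes> (x \<otimes> s) \<otimes> s) < len (t \<otimes> (x \<otimes> s))"
    and less: "x \<otimes> s \<otimes> inv x \<prec> t"
  have tc: "t \<in> reflections" "len (x \<otimes> s) = Suc (len (t \<otimes> (x \<otimes> s)))" using t by (auto simp: down_edge_def)
  have c: "t \<otimes> (x \<otimes> s) \<otimes> s = t \<otimes> x" "t \<otimes> (x \<otimes> s) = t \<otimes> x \<otimes> s" using x s tc by (simp_all add: m_assoc)
  have n: "t \<otimes> x \<noteq> x \<otimes> s"
  proof
    assume "t \<otimes> x = x \<otimes> s"
    then have "t \<otimes> (t \<otimes> x) = t \<otimes> (x \<otimes> s)" by simp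
    then have "x = t \<otimes> (x \<otimes> s)" using tc x by simp
    then show False using tc x by simp
  qed
  have lab: "t \<otimes> (x \<otimes> s) \<otimes> s \<otimes> inv (t \<otimes> (x \<otimes> s)) = t \<otimes> x \<otimes> s \<otimes> inv (t \<otimes> x)"
    using gen_label_mult_gen[of "t \<otimes> x" s] x s tc unfolding c(2) by simp
  have "t \<prec> t \<otimes> x \<otimes> s \<otimes> inv (t \<otimes> x) \<longleftrightarrow> x \<otimes> s \<otimes> inv x \<prec> t"
  proof -
    have "len (t \<otimes> x) < len (t \<otimes> x \<otimes> s)" using tx unfolding c(1) unfolding c(2) by simp
    then show ?thesis using gen_label_side(3)[OF _ s _ n] x tc by simp
  qed
  then show "t \<prec> t \<otimes> (x \<otimes> s) \<otimes> s \<otimes> inv (t \<otimes> (x \<otimes> s))"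
    unfolding lab using less by blast
next
  fix x t assume x: "x \<in> carrier W \<and> len (x \<otimes> s) < len x" and t: "down_edge x t"
    and tx: "\<not> (t \<otimes> x \<in> carrier W \<and> len (t \<otimes> x \<otimes> s) < len (t \<otimes> x))"
  have tc: "t \<in> reflections" "len x = Suc (len (t \<otimes> x))" using t by (auto simp: down_edge_def)
  have tx': "t \<otimes> x \<in> carrier W" "len (t \<otimes> x) < len (t \<otimes> x \<otimes> s)"
    using tx x tc not_asc_iff[of "t \<otimes> x" s] s by auto
  have "up_edge (t \<otimes> x) t" using t down_edge_iff tc x by blast
  then have "t = t \<otimes> x \<otimes> s \<otimes> inv (t \<otimes> x)"
    using up_edge_asc_desc(2)[OF _ s tx'(2)] x tc by simp
  also have "\<dots> = t \<otimes> (x \<otimes> s \<otimes> inv x) \<otimes> t" using gen_label_mult x s tc by simp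
  finally have "t \<otimes> t \<otimes> t = t \<otimes> (t \<otimes> (x \<otimes> s \<otimes> inv x) \<otimes> t) \<otimes> t" by simp
  then show "t = x \<otimes> s \<otimes> inv x" using tc x s by (simp add: m_assoc)
next
  fix x assume x: "x \<in> carrier W \<and> len (x \<otimes> s) < len x"
  then show "down_edge x (x \<otimes> s \<otimes> inv x) \<and> x \<otimes> s \<otimes> inv x \<otimes> x = x \<otimes> s"
    using gen_label[of x s] s len_mult_gen_cases[of x s] by (auto simp: down_edge_def)
next
  fix x t assume x: "x \<in> carrier W \<and> len (x \<otimes> s) < len x" and t: "down_edge (x \<otimes> s) t"
  show "t \<noteq> x \<otimes> s \<otimes> inv x"
  proof
    assume "t = x \<otimes> s \<otimes> inv x"
    then have "t \<otimes> (x \<otimes> s) = x" using x s by (simp add: m_assoc)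
    then show False using t x by (simp add: down_edge_def)
  qed
qed (rule lt_irrefl)

section \<open>Increasing chains\<close>

abbreviation increasing :: "'a list \<Rightarrow> bool" where
  "increasing \<equiv> sorted_wrt (\<prec>)"

lemma unique_increasing_reverse:
  assumes "x \<in> carrier W" "y \<in> carrier W"
  shows "(\<exists>!ts. labelled_path down_edge (\<otimes>) y ts x \<and> sorted_wrt (\<lambda>a b. b \<prec> a) ts) \<longleftrightarrow>
    (\<exists>!ts. chain x ts y \<and> increasing ts)"
proof -
  have *: "labelled_path down_edge (\<otimes>) y ts x \<and> sorted_wrt (\<lambda>a b. b \<prec> a) ts \<longleftrightarrow>
      chain x (rev ts) y \<and> increasing (rev ts)" for ts
    using chain_reverse[OF assms(1), of y "rev ts"] assms by (simp add: sorted_wrt_rev)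
  have rev: "(\<exists>!ts. P (rev ts)) \<longleftrightarrow> (\<exists>!ts. P ts)" for P :: "'a list \<Rightarrow> bool"
  proof
    assume "\<exists>!ts. P (rev ts)"
    then obtain ts where ts: "P (rev ts)" "\<And>us. P (rev us) \<Longrightarrow> us = ts" by blast
    show "\<exists>!ts. P ts"
    proof (rule ex1I[of _ "rev ts"])
      fix us assume "P us"
      then show "us = rev ts" using ts(2)[of "rev us"] by auto
    qed (rule ts)
  next
    assume "\<exists>!ts. P ts"
    then obtain ts where ts: "P ts" "\<And>us. P us \<Longrightarrow> us = ts" by blast
    show "\<exists>!ts. P (rev ts)"
    proof (rule ex1I[of _ "rev ts"])
      fix us assume "P (rev us)"
      then show "us = rev ts" using ts(2)[of "rev us"] by auto
    qed (simp add: ts)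
  qed
  show ?thesis unfolding * by (rule rev)
qed

theorem unique_increasing_chain:
  "bruhat_le x y \<Longrightarrow> \<exists>!ts. chain x ts y \<and> increasing ts"
proof (induction "len y" arbitrary: x y rule: less_induct)
  case less
  then have c: "x \<in> carrier W" "y \<in> carrier W" using bruhat_le_closed by auto
  show ?case
  proof (cases "y = \<one>")
    case True
    then have "x = \<one>" using bruhat_le_len[OF less.prems] by simp
    then have "ts = []" if "chain x ts y" for ts
      using True chain_len[OF that] by simp
    moreover have "chain x [] y" using True \<open>x = \<one>\<close> by simp
    ultimately show ?thesis by (intro ex1I[of _ "[]"]) auto
  next
    case False
    then obtain s where s: "s \<in> I" "len (y \<otimes> s) < len y" using right_descent c by blast
    interpret up: path_flip up_edge "(\<otimes>)" "\<lambda>x. x \<otimes> s" "\<lambda>x. x \<in> carrier W \<and> len x < len (x \<otimes> s)"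
      "\<lambda>x. x \<otimes> s \<otimes> inv x" "(\<prec>)"
      by (rule flip_up[OF s(1)])
    interpret down: path_flip down_edge "(\<otimes>)" "\<lambda>x. x \<otimes> s" "\<lambda>x. x \<in> carrier W \<and> len (x \<otimes> s) < len x"
      "\<lambda>x. x \<otimes> s \<otimes> inv x" "\<lambda>a b. b \<prec> a"
      by (rule flip_down[OF s(1)])
    let ?q = "lower_mult s x"
    have q: "?q \<in> carrier W" "len ?q < len (?q \<otimes> s)"
      using c s len_mult_gen_cases[of x s] by (auto simp: lower_mult_def mult_gen_cancel)
    have "bruhat_le ?q (y \<otimes> s)"
      using lower_mult_mono[OF less.prems s(1)] s(2) by (simp add: lower_mult_def[of s y])
    then have IH: "\<exists>!ts. chain ?q ts (y \<otimes> s) \<and> increasing ts" by (rule less.hyps[OF s(2)])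
    have ys: "y \<otimes> s \<in> carrier W" using c s by simp
    have y: "y \<in> carrier W \<and> len (y \<otimes> s) < len y" "\<not> (y \<in> carrier W \<and> len y < len (y \<otimes> s))"
      using c s by simp_all
    have q': "?q \<in> carrier W \<and> len ?q < len (?q \<otimes> s)" "\<not> (?q \<in> carrier W \<and> len (?q \<otimes> s) < len ?q)"
      using q by simp_all
    \<comment> \<open>The upper end moves first, from y s to y, which requires the lower end
      \<open>?q\<close> to be raised by s; afterwards the lower end may move from \<open>?q\<close>
      to its product with s.\<close>
    note down.unique_increasing_path_flip[OF y(1) q'(2), THEN iffD2,
        OF unique_increasing_reverse[OF q(1) ys, THEN iffD2, OF IH]]
    then have 1: "\<exists>!ts. chain ?q ts y \<and> increasing ts"
      by (rule unique_increasing_reverse[OF q(1) c(2), THEN iffD1])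
    note 2 = up.unique_increasing_path_flip[OF q'(1) y(2), THEN iffD1, OF 1]
    have "x = ?q \<or> x = ?q \<otimes> s"
      using c s by (simp add: lower_mult_def mult_gen_cancel)
    then show ?thesis
    proof
      assume "x = ?q"
      then show ?thesis using 1 by simp
    next
      assume "x = ?q \<otimes> s"
      then show ?thesis using 2 by simp
    qed
  qed
qed

lemma finite_has_minimal_label:
  assumes "finite A" "A \<noteq> {}" "A \<subseteq> reflections"
  shows "\<exists>m\<in>A. \<forall>t\<in>A. m = t \<or> m \<prec> t"
  using assms
proof (induction rule: finite_ne_induct)
  case (insert t A)
  then obtain m where m: "m \<in> A" "\<forall>u\<in>A. m = u \<or> m \<prec> u" by auto
  then consider "m = t \<or> m \<prec> t" | "t \<prec> m" using lt_total[of m t] insert.prems by blast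
  then show ?case
  proof cases
    case 1
    then show ?thesis using m by auto
  next
    case 2
    then have "\<forall>u\<in>A. t \<prec> u" using m(2) lt_trans by metis
    then show ?thesis by blast
  qed
qed simp

lemma finite_has_maximal_label:
  assumes "finite A" "A \<noteq> {}" "A \<subseteq> reflections"
  shows "\<exists>m\<in>A. \<forall>t\<in>A. m = t \<or> t \<prec> m"
proof -
  interpret dual: coxeter_reflection_order W I "\<lambda>a b. b \<prec> a" by (rule dual)
  show ?thesis using dual.finite_has_minimal_label[OF assms] .
qed

text \<open>Both chains have the same product inside one dihedral subgroup. With the opposite
  inequality in either conclusion, the four labels would form an increasing sequence q, p, a, b or
  a, b, q, p, which \<open>lt_no_nested\<close> rules out.\<close>

lemma descent_swap:
  assumes pq: "up_edge x p" "up_edge (p \<otimes> x) q" "q \<prec> p"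
    and ab: "up_edge x a" "up_edge (a \<otimes> x) b" "a \<prec> b"
    and eq: "q \<otimes> (p \<otimes> x) = b \<otimes> (a \<otimes> x)"
  shows "a \<prec> p" "q \<prec> b"
proof -
  have c: "x \<in> carrier W" "p \<in> reflections" "q \<in> reflections" "a \<in> reflections" "b \<in> reflections"
    using up_edgeD[OF pq(1)] up_edgeD[OF pq(2)] up_edgeD[OF ab(1)] up_edgeD[OF ab(2)] by auto
  have "(q \<otimes> p) \<otimes> x = (b \<otimes> a) \<otimes> x" using eq c by (simp add: m_assoc)
  then have prod: "q \<otimes> p = b \<otimes> a" using c by (simp only: right_cancel m_closed reflection_closed)
  then have "inv (q \<otimes> p) = inv (b \<otimes> a)" by simp
  then have prod': "p \<otimes> q = a \<otimes> b" using c by (simp add: inv_mult_group)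
  have "{p, q} \<subseteq> generate W {a, b}" using two_step_labels[OF ab(1,2) pq(1,2)] eq by simp
  moreover have "{a, b} \<subseteq> generate W {a, b}" using generate.incl[of _ "{a, b}" W] by auto
  ultimately have sub: "{q, p, a, b} \<subseteq> reflections \<inter> generate W {a, b}" "{a, b, q, p} \<subseteq> reflections \<inter> generate W {a, b}"
    using c by auto
  have "a \<noteq> b" using ab(3) lt_irrefl by auto
  note nested = lt_no_nested[OF c(4,5) this]
  have "p \<noteq> a"
  proof
    assume "p = a"
    then have "q = b" using prod c by simp
    then show False using pq(3) ab(3) \<open>p = a\<close> lt_asym by blast
  qed
  moreover have "\<not> p \<prec> a" using nested[OF sub(1) pq(3) _ ab(3)] prod' by blast
  ultimately show "a \<prec> p" using lt_total c by blast
  have "q \<noteq> b"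
  proof
    assume "q = b"
    then have "p = a" using prod c by simp
    then show False using \<open>p \<noteq> a\<close> by simp
  qed
  moreover have "\<not> b \<prec> q" using nested[OF sub(2) ab(3) _ pq(3)] prod by metis
  ultimately show "q \<prec> b" using lt_total c by blast
qed

lemma increasing_two_step:
  assumes "up_edge x p" "up_edge (p \<otimes> x) q"
  obtains a b where "up_edge x a" "up_edge (a \<otimes> x) b" "a \<prec> b" "b \<otimes> (a \<otimes> x) = q \<otimes> (p \<otimes> x)"
proof -
  have x: "x \<in> carrier W" using up_edgeD assms by blast
  have pq: "chain x [p, q] (q \<otimes> (p \<otimes> x))" using assms by simp
  then obtain ts where ts: "chain x ts (q \<otimes> (p \<otimes> x))" "increasing ts"
    using unique_increasing_chain[OF chain_bruhat_le[OF x pq]] by blast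
  then have "length ts = 2" using chain_len[OF ts(1)] chain_len[OF pq] by simp
  then obtain a b where "ts = [a, b]"
    by (auto simp: numeral_2_eq_2 length_Suc_conv)
  then show ?thesis using that[of a b] ts by simp
qed

lemma up_edge_bruhat_le: "up_edge x t \<Longrightarrow> bruhat_le x (t \<otimes> x)"
  using chain_bruhat_le[of x "[t]"] up_edgeD by simp

lemma up_edge_label_inj: "up_edge x t \<Longrightarrow> up_edge x u \<Longrightarrow> t \<otimes> x = u \<otimes> x \<Longrightarrow> t = u"
  using up_edgeD by (metis reflection_closed right_cancel)

text \<open>Prefix the minimal available label m to the increasing chain that starts at m x. A
  descent at the junction could be exchanged by \<open>descent_swap\<close> for a chain beginning
  with a smaller label, so the result is increasing, and uniqueness identifies it with the given
  chain.\<close>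

lemma first_label_minimal:
  assumes chain: "chain x (t # ts) y" "increasing (t # ts)"
    and u: "up_edge x u" "bruhat_le (u \<otimes> x) y"
  shows "t = u \<or> t \<prec> u"
proof -
  have x: "x \<in> carrier W" using u up_edgeD by blast
  have xy: "bruhat_le x y" using chain_bruhat_le[OF x chain(1)] .
  define S where "S = {u. up_edge x u \<and> bruhat_le (u \<otimes> x) y}"
  have "inj_on (\<lambda>u. u \<otimes> x) S"
    using up_edge_label_inj by (auto simp: S_def inj_on_def)
  moreover have "(\<lambda>u. u \<otimes> x) ` S \<subseteq> {z. bruhat_le z y}" by (auto simp: S_def)
  moreover have "finite {z. bruhat_le z y}" using finite_bruhat_lower bruhat_le_closed[OF xy] by blast
  ultimately have "finite S" using finite_imageD finite_subset by metis
  moreover have "S \<noteq> {}" "S \<subseteq> reflections" using u up_edgeD by (auto simp: S_def)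
  ultimately obtain m where m: "m \<in> S" "\<And>u. u \<in> S \<Longrightarrow> m = u \<or> m \<prec> u"
    using finite_has_minimal_label[of S] by blast
  then have mx: "up_edge x m" "bruhat_le (m \<otimes> x) y" by (auto simp: S_def)
  obtain us where us: "chain (m \<otimes> x) us y" "increasing us"
    using unique_increasing_chain[OF mx(2)] by blast
  have "increasing (m # us)"
  proof (cases us)
    case (Cons q vs)
    then have q: "up_edge (m \<otimes> x) q" "chain (q \<otimes> (m \<otimes> x)) vs y" using us by auto
    have "m \<prec> q"
    proof (rule ccontr)
      assume "\<not> m \<prec> q"
      moreover have "m \<noteq> q" using up_edgeD[OF mx(1)] up_edgeD[OF q(1)] x by auto
      ultimately have qm: "q \<prec> m" using lt_total up_edgeD[OF mx(1)] up_edgeD[OF q(1)] by blast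
      obtain a b where ab: "up_edge x a" "up_edge (a \<otimes> x) b" "a \<prec> b" "b \<otimes> (a \<otimes> x) = q \<otimes> (m \<otimes> x)"
        using increasing_two_step[OF mx(1) q(1)] by blast
      have "a \<prec> m" using descent_swap(1)[OF mx(1) q(1) qm ab(1-3) ab(4)[symmetric]] .
      moreover have "a \<in> S"
      proof -
        have "bruhat_le (a \<otimes> x) (q \<otimes> (m \<otimes> x))" using up_edge_bruhat_le[OF ab(2)] ab(4) by simp
        moreover have "bruhat_le (q \<otimes> (m \<otimes> x)) y"
          using chain_bruhat_le[OF _ q(2)] up_edgeD[OF q(1)] by blast
        ultimately show ?thesis using ab(1) bruhat_le_trans unfolding S_def by blast
      qed
      ultimately show False using m(2) lt_asym lt_irrefl by blast
    qed
    moreover have "\<forall>v\<in>set vs. q \<prec> v" using us(2) Cons by simp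
    ultimately have "\<forall>v\<in>set us. m \<prec> v" using Cons lt_trans by auto
    then show ?thesis using us(2) by simp
  qed simp
  moreover have "chain x (m # us) y" using mx(1) us(1) by simp
  ultimately have "t # ts = m # us"
    using unique_increasing_chain[OF xy] chain by blast
  then show ?thesis using m(2)[of u] u by (simp add: S_def)
qed

lemma chain_snoc: "chain x (ts @ [t]) y \<longleftrightarrow> (\<exists>z. chain x ts z \<and> up_edge z t \<and> t \<otimes> z = y)"
  by (auto simp: labelled_path_append)

lemma last_label_maximal:
  assumes chain: "chain x (ts @ [t]) y" "increasing (ts @ [t])" and x: "x \<in> carrier W"
    and u: "up_edge z u" "u \<otimes> z = y" "bruhat_le x z"
  shows "t = u \<or> u \<prec> t"
proof -
  have xy: "bruhat_le x y" using chain_bruhat_le[OF x chain(1)] .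
  \<comment> \<open>The mirror image of the argument for first labels, at the upper end: S collects
    the labels of all covers that enter y from elements above x, and the junction is repaired by the
    second half of \<open>descent_swap\<close>.\<close>
  define S where "S = {u. \<exists>z. up_edge z u \<and> u \<otimes> z = y \<and> bruhat_le x z}"
  have y: "y \<in> carrier W" using bruhat_le_closed[OF xy] by blast
  have "inj_on (\<lambda>u. u \<otimes> y) reflections"
    using y by (intro inj_onI) (metis reflection_closed right_cancel)
  then have "inj_on (\<lambda>u. u \<otimes> y) S"
    by (rule inj_on_subset) (auto simp: S_def dest: up_edgeD)
  moreover have "(\<lambda>u. u \<otimes> y) ` S \<subseteq> {z. bruhat_le z y}"
  proof (clarsimp simp: S_def)
    fix u z assume "up_edge z u" "y = u \<otimes> z"
    then show "bruhat_le (u \<otimes> (u \<otimes> z)) (u \<otimes> z)" using up_edge_bruhat_le[of z u] up_edgeD[of z u] by simp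
  qed
  moreover have "finite {z. bruhat_le z y}" using finite_bruhat_lower y by blast
  ultimately have "finite S" using finite_imageD finite_subset by metis
  moreover have "S \<noteq> {}" "S \<subseteq> reflections" using u by (auto simp: S_def dest: up_edgeD)
  ultimately obtain m where m: "m \<in> S" "\<And>u. u \<in> S \<Longrightarrow> m = u \<or> u \<prec> m"
    using finite_has_maximal_label[of S] by blast
  then obtain z' where z': "up_edge z' m" "m \<otimes> z' = y" "bruhat_le x z'" by (auto simp: S_def)
  obtain us where us: "chain x us z'" "increasing us"
    using unique_increasing_chain[OF z'(3)] by blast
  have "increasing (us @ [m])"
  proof (cases us rule: rev_cases)
    case (snoc vs p)
    then obtain z0 where p: "chain x vs z0" "up_edge z0 p" "p \<otimes> z0 = z'"
      using us chain_snoc by blast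
    have "p \<prec> m"
    proof (rule ccontr)
      assume "\<not> p \<prec> m"
      moreover have "m \<noteq> p" using up_edgeD[OF z'(1)] up_edgeD[OF p(2)] p(3) by auto
      ultimately have mp: "m \<prec> p" using lt_total up_edgeD[OF z'(1)] up_edgeD[OF p(2)] by blast
      have m': "up_edge (p \<otimes> z0) m" using z'(1) p(3) by simp
      obtain a b where ab: "up_edge z0 a" "up_edge (a \<otimes> z0) b" "a \<prec> b" "b \<otimes> (a \<otimes> z0) = m \<otimes> (p \<otimes> z0)"
        using increasing_two_step[OF p(2) m'] by blast
      have "m \<prec> b" using descent_swap(2)[OF p(2) m' mp ab(1-3) ab(4)[symmetric]] .
      moreover have "b \<in> S"
      proof -
        have "bruhat_le x (a \<otimes> z0)"
          using chain_bruhat_le[OF x p(1)] up_edge_bruhat_le[OF ab(1)] bruhat_le_trans by blast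
        moreover have "b \<otimes> (a \<otimes> z0) = y" using ab(4) p(3) z'(2) by simp
        ultimately show ?thesis using ab(2) unfolding S_def by blast
      qed
      ultimately show False using m(2) lt_asym lt_irrefl by blast
    qed
    moreover have "\<forall>v\<in>set vs. v \<prec> p" using us(2) snoc by (simp add: sorted_wrt_append)
    ultimately have "\<forall>v\<in>set us. v \<prec> m" using snoc lt_trans by auto
    then show ?thesis using us(2) by (simp add: sorted_wrt_append)
  qed simp
  moreover have "chain x (us @ [m]) y" using z' us(1) chain_snoc by blast
  ultimately have "ts @ [t] = us @ [m]"
    using unique_increasing_chain[OF xy] chain by blast
  then show ?thesis using m(2)[of u] u by (auto simp: S_def)
qed

lemma chain_Cons_le:
  assumes "bruhat_le x y" "x \<noteq> y"
  obtains t where "up_edge x t" "bruhat_le (t \<otimes> x) y"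
proof -
  obtain ts where ts: "chain x ts y" using unique_increasing_chain[OF assms(1)] by blast
  then obtain t us where "ts = t # us" using assms(2) by (cases ts) auto
  then show ?thesis using that ts chain_bruhat_le up_edgeD by auto
qed

lemma chain_snoc_le:
  assumes "bruhat_le x y" "x \<noteq> y"
  obtains z t where "up_edge z t" "t \<otimes> z = y" "bruhat_le x z"
proof -
  obtain ts where ts: "chain x ts y" using unique_increasing_chain[OF assms(1)] by blast
  then obtain us t where "ts = us @ [t]" using assms(2) by (cases ts rule: rev_cases) auto
  then show ?thesis using that ts chain_bruhat_le bruhat_le_closed[OF assms(1)] chain_snoc by metis
qed

definition increasing_labels :: "'a \<Rightarrow> 'a \<Rightarrow> 'a list" where
  "increasing_labels x y = (THE ts. chain x ts y \<and> increasing ts)"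

lemma increasing_labels:
  assumes "bruhat_le x y"
  shows "chain x (increasing_labels x y) y" "increasing (increasing_labels x y)"
  using theI'[OF unique_increasing_chain[OF assms]] by (auto simp: increasing_labels_def)

text \<open>At the first disagreement both chains leave the same vertex, and the increasing one
  leaves it with the minimal label. All chains have equal length, so neither list is a proper prefix
  of the other.\<close>

lemma increasing_labels_lex_least:
  assumes "x \<in> carrier W" "chain x us y" "chain x ts y" "increasing ts" "us \<noteq> ts"
  shows "(ts, us) \<in> lexord {(a, b). a \<prec> b}"
  using assms
proof (induction us arbitrary: x ts)
  case Nil
  have "x = y" using Nil.prems(2) by simp
  then have "ts = []" using chain_len[OF Nil.prems(3)] by simp
  then show ?case using Nil.prems(5) by simp
next
  case (Cons u us)
  have "length ts = length (u # us)"
    using chain_len[OF Cons.prems(2)] chain_len[OF Cons.prems(3)] by simp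
  then obtain t vs where ts: "ts = t # vs" by (auto simp: length_Suc_conv)
  have u: "up_edge x u" "chain (u \<otimes> x) us y" using Cons.prems(2) by simp_all
  have "bruhat_le (u \<otimes> x) y" using chain_bruhat_le[OF _ u(2)] up_edgeD[OF u(1)] by blast
  then have tu: "t = u \<or> t \<prec> u"
    by (rule first_label_minimal[OF Cons.prems(3,4)[unfolded ts] u(1)])
  show ?case
  proof (cases "t = u")
    case True
    have "u \<otimes> x \<in> carrier W" using up_edgeD[OF u(1)] by simp
    moreover have "chain (u \<otimes> x) vs y" "increasing vs" "us \<noteq> vs"
      using Cons.prems(3-5) ts True by simp_all
    ultimately have "(vs, us) \<in> lexord {(a, b). a \<prec> b}"
      by (intro Cons.IH[OF _ u(2)])
    then show ?thesis using ts True by simp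
  next
    case False
    then show ?thesis using tu ts by simp
  qed
qed

end

section \<open>The Hasse diagram of a Bruhat interval described by labels\<close>

context coxeter_system
begin

lemma bruhat_interval_iff: "x \<in> bruhat_interval v w \<longleftrightarrow> bruhat_le v x \<and> bruhat_le x w"
  using bruhat_le_closed by (auto simp: bruhat_interval_def)

text \<open>Edges at x are represented by their labels. Since a reflection is an involution, t x is
  the other end whether the edge goes up or down, so both directions are treated alike.\<close>

definition neighbour_label :: "'a \<Rightarrow> 'a \<Rightarrow> 'a \<Rightarrow> 'a \<Rightarrow> bool" where
  "neighbour_label v w x t \<longleftrightarrow>
    x \<in> bruhat_interval v w \<and> t \<otimes> x \<in> bruhat_interval v w \<and> (up_edge x t \<or> down_edge x t)"

lemma neighbour_label_reflection: "neighbour_label v w x t \<Longrightarrow> t \<in> reflections \<and> x \<in> carrier W"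
  by (auto simp: neighbour_label_def up_edge_def down_edge_def)

lemma up_down_exclusive: "up_edge x t \<Longrightarrow> \<not> down_edge x t"
  by (auto simp: up_edge_def down_edge_def)

lemma down_edge_of_up: "up_edge x t \<Longrightarrow> down_edge (t \<otimes> x) t"
  by (auto simp: up_edge_def down_edge_def)

lemma up_edge_of_down: "down_edge x t \<Longrightarrow> up_edge (t \<otimes> x) t"
  by (auto simp: up_edge_def down_edge_def)

lemma neighbour_label_sym: "neighbour_label v w x t \<Longrightarrow> neighbour_label v w (t \<otimes> x) t"
  using neighbour_label_reflection[of v w x t] down_edge_of_up up_edge_of_down
  by (auto simp: neighbour_label_def)

definition label_edge :: "'a \<Rightarrow> 'a \<Rightarrow> 'a \<times> 'a" where
  "label_edge x t = (if up_edge x t then (x, t \<otimes> x) else (t \<otimes> x, x))"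

lemma label_edge_sym: "neighbour_label v w x t \<Longrightarrow> label_edge (t \<otimes> x) t = label_edge x t"
  using neighbour_label_reflection[of v w x t] down_edge_of_up up_edge_of_down up_down_exclusive
  unfolding neighbour_label_def label_edge_def by (metis reflection_cancel)

lemma incident_label_edge: "incident y (label_edge x t) \<longleftrightarrow> y = x \<or> y = t \<otimes> x"
  by (auto simp: incident_def label_edge_def)

lemma edge_label_label_edge:
  assumes "t \<in> reflections" "x \<in> carrier W"
  shows "edge_label (label_edge x t) = t"
  using assms by (simp add: edge_label_def label_edge_def inv_mult_group m_assoc)

end

context coxeter_reflection_order
begin

text \<open>A relation x < y admits a saturated chain; its first vertex above x again lies in the
  interval, so in a covering relation it must already be y. Conversely nothing fits between elements
  whose lengths differ by one.\<close>

lemma hasse_edges_iff: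
  "(x, y) \<in> hasse_edges (bruhat_interval v w) bruhat_le \<longleftrightarrow>
    x \<in> bruhat_interval v w \<and> y \<in> bruhat_interval v w \<and> (\<exists>t. up_edge x t \<and> t \<otimes> x = y)"
proof (intro iffI conjI)
  assume h: "(x, y) \<in> hasse_edges (bruhat_interval v w) bruhat_le"
  then show P: "x \<in> bruhat_interval v w" "y \<in> bruhat_interval v w"
    by (auto simp: hasse_edges_def)
  have xy: "bruhat_le x y" "x \<noteq> y" using h by (auto simp: hasse_edges_def)
  then obtain t where t: "up_edge x t" "bruhat_le (t \<otimes> x) y" using chain_Cons_le by blast
  have "t \<otimes> x \<in> bruhat_interval v w"
    using P t up_edge_bruhat_le[OF t(1)] bruhat_le_trans unfolding bruhat_interval_iff by blast
  moreover have "bruhat_le x (t \<otimes> x)" "t \<otimes> x \<noteq> x"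
    using up_edge_bruhat_le[OF t(1)] up_edgeD[OF t(1)] by auto
  ultimately have "t \<otimes> x = y" using h t(2) unfolding hasse_edges_def by blast
  then show "\<exists>t. up_edge x t \<and> t \<otimes> x = y" using t by blast
next
  assume a: "x \<in> bruhat_interval v w \<and> y \<in> bruhat_interval v w \<and> (\<exists>t. up_edge x t \<and> t \<otimes> x = y)"
  then obtain t where t: "up_edge x t" "t \<otimes> x = y" by blast
  then have l: "len y = Suc (len x)" "bruhat_le x y" using up_edgeD up_edge_bruhat_le by blast+
  have "\<not> (bruhat_le x z \<and> z \<noteq> x \<and> bruhat_le z y \<and> z \<noteq> y)" for z
    using bruhat_le_len[of x z] bruhat_le_len[of z y] l(1) by auto
  then show "(x, y) \<in> hasse_edges (bruhat_interval v w) bruhat_le"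
    using a l unfolding hasse_edges_def by auto
qed

lemma neighbour_label_up:
  assumes "bruhat_le v x" "up_edge x t" "bruhat_le (t \<otimes> x) w"
  shows "neighbour_label v w x t"
  using assms bruhat_le_trans[OF assms(1) up_edge_bruhat_le[OF assms(2)]]
    bruhat_le_trans[OF up_edge_bruhat_le[OF assms(2)] assms(3)]
  by (simp add: neighbour_label_def bruhat_interval_iff)

lemma neighbour_label_down:
  assumes "bruhat_le v z" "up_edge z t" "t \<otimes> z = x" "bruhat_le x w"
  shows "neighbour_label v w x t" "t \<otimes> x = z" "down_edge x t"
  using neighbour_label_sym[OF neighbour_label_up[OF assms(1,2)]] assms(3,4) up_edgeD[OF assms(2)]
    down_edge_of_up[OF assms(2)] by auto

context
  fixes v w
  assumes vw: "bruhat_less v w"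
begin

section \<open>The matching by maximal labels\<close>

definition maximal_label :: "'a \<Rightarrow> 'a \<Rightarrow> bool" where
  "maximal_label x t \<longleftrightarrow> neighbour_label v w x t \<and> (\<forall>u. neighbour_label v w x u \<longrightarrow> u = t \<or> u \<prec> t)"

lemma maximal_label_unique: "maximal_label x t \<Longrightarrow> maximal_label x u \<Longrightarrow> t = u"
  unfolding maximal_label_def using lt_asym by blast

lemma maximal_label_exists:
  assumes x: "x \<in> bruhat_interval v w"
  shows "\<exists>t. maximal_label x t"
proof -
  let ?L = "{t. neighbour_label v w x t}"
  have x': "bruhat_le v x" "bruhat_le x w" using x by (simp_all add: bruhat_interval_iff)
  have xc: "x \<in> carrier W" "w \<in> carrier W" using bruhat_le_closed[OF x'(2)] by auto
  have "inj_on (\<lambda>t. t \<otimes> x) reflections"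
    using xc by (auto intro: inj_onI)
  then have "inj_on (\<lambda>t. t \<otimes> x) ?L"
    by (rule inj_on_subset) (use neighbour_label_reflection in auto)
  moreover have "(\<lambda>t. t \<otimes> x) ` ?L \<subseteq> {z. bruhat_le z w}"
    by (auto simp: neighbour_label_def bruhat_interval_iff)
  moreover have "finite {z. bruhat_le z w}"
    using finite_bruhat_lower xc(2) .
  ultimately have "finite ?L" using finite_imageD finite_subset by metis
  moreover have "?L \<noteq> {}"
  \<comment> \<open>There is an edge upwards unless x is the top, and then one downwards because v
    differs from w.\<close>
  proof (cases "x = w")
    case False
    then obtain t where "up_edge x t" "bruhat_le (t \<otimes> x) w"
      using chain_Cons_le[OF x'(2)] by blast
    then have "neighbour_label v w x t"
      using neighbour_label_up[OF x'(1)] by blast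
    then show ?thesis by blast
  next
    case True
    then have "x \<noteq> v" using vw by (auto simp: bruhat_less_def)
    then obtain z t where z: "up_edge z t" "t \<otimes> z = x" "bruhat_le v z"
      using chain_snoc_le[OF x'(1)] by metis
    then have "neighbour_label v w x t"
      using neighbour_label_down(1)[OF z(3,1,2) x'(2)] by blast
    then show ?thesis by blast
  qed
  moreover have "?L \<subseteq> reflections" using neighbour_label_reflection by auto
  ultimately obtain t where "t \<in> ?L" "\<forall>u\<in>?L. t = u \<or> u \<prec> t"
    using finite_has_maximal_label[of ?L] by blast
  then have "maximal_label x t" unfolding maximal_label_def by auto
  then show ?thesis ..
qed

text \<open>The last label of the chain to x belongs to a downward edge at x inside the interval, so
  it lies below the maximal label t, whose edge goes up.\<close>

lemma increasing_labels_snoc: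
  assumes "maximal_label x t" "up_edge x t"
  shows "chain v (increasing_labels v x @ [t]) (t \<otimes> x)" "increasing (increasing_labels v x @ [t])"
proof -
  let ?us = "increasing_labels v x"
  have x: "bruhat_le v x" "bruhat_le x w"
    using assms(1) by (auto simp: maximal_label_def neighbour_label_def bruhat_interval_iff)
  note us = increasing_labels[OF x(1)]
  show "chain v (?us @ [t]) (t \<otimes> x)" using us assms(2) chain_snoc by blast
  show "increasing (?us @ [t])"
  proof (cases ?us rule: rev_cases)
    case (snoc vs p)
    then obtain z where z: "chain v vs z" "up_edge z p" "p \<otimes> z = x" using us chain_snoc by metis
    have "bruhat_le v z" using chain_bruhat_le[OF _ z(1)] bruhat_le_closed[OF x(1)] by blast
    note d = neighbour_label_down[OF this z(2,3) x(2)]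
    have "p \<noteq> t" using d(3) assms(2) up_down_exclusive by blast
    then have pt: "p \<prec> t" using assms(1) d(1) unfolding maximal_label_def by blast
    have "\<forall>u\<in>set vs. u \<prec> p" using us(2) snoc by (simp add: sorted_wrt_append)
    then have "\<forall>u\<in>set vs. u \<prec> t" using lt_trans[OF _ pt] by blast
    then have "\<forall>u\<in>set ?us. u \<prec> t" using pt unfolding snoc by simp
    then show ?thesis using us(2) by (simp add: sorted_wrt_append)
  qed simp
qed

text \<open>Local maximality at a peak or a valley propagates because the increasing chain from \<open>v\<close>
  (the decreasing chain to \<open>w\<close>) extends through the edge and has the extremal last (first) label.\<close>

lemma maximal_label_sym:
  assumes max: "maximal_label x t"
  shows "maximal_label (t \<otimes> x) t"
proof -
  interpret dual: coxeter_reflection_order W I "\<lambda>a b. b \<prec> a" by (rule dual)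
  have nb: "neighbour_label v w x t" using max by (simp add: maximal_label_def)
  have tx: "t \<in> reflections" "x \<in> carrier W" using neighbour_label_reflection[OF nb] by auto
  have P: "bruhat_le v x" "bruhat_le x w" "bruhat_le v (t \<otimes> x)" "bruhat_le (t \<otimes> x) w"
    using nb by (auto simp: neighbour_label_def bruhat_interval_iff)
  have xmax: "u = t \<or> u \<prec> t" if "neighbour_label v w x u" for u
    using max that by (simp add: maximal_label_def)
  have "u = t \<or> u \<prec> t" if u: "neighbour_label v w (t \<otimes> x) u" for u
  proof (rule ccontr)
    assume neg: "\<not> (u = t \<or> u \<prec> t)"
    have uT: "u \<in> reflections" using neighbour_label_reflection[OF u] by blast
    have less: "t \<prec> u" using neg lt_total[OF uT tx(1)] by blast
    have Pu: "bruhat_le v (u \<otimes> (t \<otimes> x))" "bruhat_le (u \<otimes> (t \<otimes> x)) w"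
      using u by (auto simp: neighbour_label_def bruhat_interval_iff)
    consider "up_edge x t" "up_edge (t \<otimes> x) u" | "down_edge x t" "down_edge (t \<otimes> x) u"
      | "up_edge x t" "down_edge (t \<otimes> x) u" | "down_edge x t" "up_edge (t \<otimes> x) u"
      using nb u unfolding neighbour_label_def by blast
    then show False
    proof cases
      case 1
      \<comment> \<open>The labels t, u increase, so in the reversed order they form a descent. Its
        exchange starts at x with a label above t and stays below w, against the maximality of t at
        x.\<close>
      obtain a b where ab: "up_edge x a" "up_edge (a \<otimes> x) b" "b \<prec> a" "b \<otimes> (a \<otimes> x) = u \<otimes> (t \<otimes> x)"
        using dual.increasing_two_step[OF 1] by blast
      have "t \<prec> a" using dual.descent_swap(1)[OF 1 less ab(1-3) ab(4)[symmetric]] .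
      moreover have "bruhat_le (a \<otimes> x) w"
        using bruhat_le_trans[OF up_edge_bruhat_le[OF ab(2)]] ab(4) Pu(2) by simp
      then have "neighbour_label v w x a" by (rule neighbour_label_up[OF P(1) ab(1)])
      ultimately show False using xmax[of a] lt_asym lt_irrefl by blast
    next
      case 2
      let ?z = "u \<otimes> (t \<otimes> x)"
      have z: "up_edge ?z u" "u \<otimes> ?z = t \<otimes> x" using up_edge_of_down[OF 2(2)] uT tx by auto
      have t: "up_edge (u \<otimes> ?z) t" "t \<otimes> (u \<otimes> ?z) = x" using up_edge_of_down[OF 2(1)] z(2) tx by auto
      \<comment> \<open>Read upwards from \<open>?z\<close>, the labels u, t form a descent ending
        at x. Its exchange enters x by an edge whose label is above t.\<close>
      obtain a b where ab: "up_edge ?z a" "up_edge (a \<otimes> ?z) b" "a \<prec> b" "b \<otimes> (a \<otimes> ?z) = t \<otimes> (u \<otimes> ?z)"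
        using increasing_two_step[OF z(1) t(1)] by blast
      have "t \<prec> b" using descent_swap(2)[OF z(1) t(1) less ab(1-3) ab(4)[symmetric]] .
      moreover have "b \<otimes> (a \<otimes> ?z) = x" using ab(4) t(2) by simp
      then have "neighbour_label v w x b"
        by (rule neighbour_label_down(1)[OF bruhat_le_trans[OF Pu(1) up_edge_bruhat_le[OF ab(1)]] ab(2) _ P(2)])
      ultimately show False using xmax[of b] lt_asym lt_irrefl by blast
    next
      case 3
      have z: "up_edge (u \<otimes> (t \<otimes> x)) u" "u \<otimes> (u \<otimes> (t \<otimes> x)) = t \<otimes> x"
        using up_edge_of_down[OF 3(2)] uT tx by auto
      have "v \<in> carrier W" using bruhat_le_closed[OF P(1)] by blast
      then show False
        using last_label_maximal[OF increasing_labels_snoc[OF max 3(1)] _ z Pu(1)] neg by blast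
    next
      case 4
      have t: "up_edge (t \<otimes> x) t" "t \<otimes> (t \<otimes> x) = x" using up_edge_of_down[OF 4(1)] tx by auto
      obtain us where us: "chain x us w" "sorted_wrt (\<lambda>a b. b \<prec> a) us"
        using dual.unique_increasing_chain[OF P(2)] by blast
      have "sorted_wrt (\<lambda>a b. b \<prec> a) (t # us)"
      proof (cases us)
        case (Cons p vs)
        then have p: "up_edge x p" "chain (p \<otimes> x) vs w" using us by auto
        have "bruhat_le (p \<otimes> x) w" using chain_bruhat_le[OF _ p(2)] up_edgeD[OF p(1)] by blast
        then have "neighbour_label v w x p" by (rule neighbour_label_up[OF P(1) p(1)])
        moreover have "p \<noteq> t" using p(1) 4(1) up_down_exclusive by blast
        ultimately have pt: "p \<prec> t" using xmax by blast
        have "\<forall>u\<in>set vs. u \<prec> p" using us(2) Cons by simp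
        then have "\<forall>u\<in>set vs. u \<prec> t" using lt_trans[OF _ pt] by blast
        then have "\<forall>u\<in>set us. u \<prec> t" using pt unfolding Cons by simp
        then show ?thesis using us(2) by simp
      qed simp
      moreover have "chain (t \<otimes> x) (t # us) w" using t us(1) by simp
      ultimately show False
        using dual.first_label_minimal[of "t \<otimes> x" t us w u] 4(2) Pu(2) neg by blast
    qed
  qed
  then show ?thesis using neighbour_label_sym[OF nb] by (simp add: maximal_label_def)
qed

definition matched_edges :: "('a \<times> 'a) set" where
  "matched_edges = {label_edge x t | x t. maximal_label x t}"

lemma matched_edge_at:
  assumes "e \<in> matched_edges" "incident p e"
  shows "\<exists>t. maximal_label p t \<and> e = label_edge p t"
proof -
  obtain x t where e: "e = label_edge x t" "maximal_label x t"
    using assms(1) by (auto simp: matched_edges_def)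
  then have "p = x \<or> p = t \<otimes> x" using assms(2) incident_label_edge by simp
  then show ?thesis
    using e maximal_label_sym[OF e(2)] label_edge_sym[of v w x t] unfolding maximal_label_def by metis
qed

lemma matched_edges_complete_matching:
  "complete_matching (bruhat_interval v w) bruhat_le matched_edges"
proof -
  have "matched_edges \<subseteq> hasse_edges (bruhat_interval v w) bruhat_le"
  proof
    fix e assume "e \<in> matched_edges"
    then obtain x t where e: "e = label_edge x t" "neighbour_label v w x t"
      by (auto simp: matched_edges_def maximal_label_def)
    then show "e \<in> hasse_edges (bruhat_interval v w) bruhat_le"
      using neighbour_label_reflection[OF e(2)] up_edge_of_down[of x t]
      by (auto simp: label_edge_def hasse_edges_iff neighbour_label_def)
  qed
  moreover have "e = f" if "e \<in> matched_edges" "f \<in> matched_edges" "incident x e" "incident x f" for x e f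
    using matched_edge_at[OF that(1,3)] matched_edge_at[OF that(2,4)] maximal_label_unique by blast
  moreover have "\<exists>e\<in>matched_edges. incident x e" if "x \<in> bruhat_interval v w" for x
    using maximal_label_exists[OF that] incident_label_edge unfolding matched_edges_def by blast
  ultimately show ?thesis unfolding complete_matching_def matching_def by blast
qed

section \<open>A potential that is monotone along the matching digraph\<close>

definition lower_end :: "'a \<Rightarrow> 'a" where
  "lower_end p = fst (label_edge p (THE t. maximal_label p t))"

lemma lower_end_eq: "maximal_label p t \<Longrightarrow> lower_end p = (if up_edge p t then p else t \<otimes> p)"
proof -
  assume t: "maximal_label p t"
  then have "(THE t. maximal_label p t) = t"
    by (rule the_equality) (rule maximal_label_unique[OF _ t])
  then show ?thesis by (simp add: lower_end_def label_edge_def)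
qed

lemma chain_endpoint_unique: "chain x ts y \<Longrightarrow> chain x ts z \<Longrightarrow> y = z"
  by (induction ts arbitrary: x) auto

text \<open>If \<open>y\<close> is matched down to \<open>x\<close> and goes down to \<open>q \<noteq> x\<close>, which is matched up, then the increasing
  label sequence from \<open>v\<close> to \<open>x\<close> is lexicographically smaller than the one from \<open>v\<close> to \<open>q\<close>: appending
  one label to each yields two chains to \<open>y\<close>, of which the first is increasing.\<close>

definition potential_order :: "'a rel" where
  "potential_order = inv_image ({(i, j). j < i} <*lex*> lexord {(a, b). a \<prec> b} <*lex*> {(i, j). j < i})
    (\<lambda>p. (len (lower_end p), increasing_labels v (lower_end p), of_bool (lower_end p = p) :: nat))"

lemma maximal_labelD:
  assumes "maximal_label x t"
  shows "t \<in> reflections" "x \<in> carrier W" "up_edge x t \<or> down_edge x t"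
    "bruhat_le v x" "bruhat_le x w"
proof -
  have nb: "neighbour_label v w x t" using assms by (simp add: maximal_label_def)
  then show "t \<in> reflections" "x \<in> carrier W" using neighbour_label_reflection by auto
  show "up_edge x t \<or> down_edge x t" "bruhat_le v x" "bruhat_le x w"
    using nb by (simp_all add: neighbour_label_def bruhat_interval_iff)
qed

lemma len_lower_end:
  assumes "maximal_label p t"
  shows "up_edge p t \<Longrightarrow> len (lower_end p) = len p" "\<not> up_edge p t \<Longrightarrow> len p = Suc (len (lower_end p))"
  using maximal_labelD(3)[OF assms] lower_end_eq[OF assms] by (simp_all add: down_edge_def)

text \<open>A step down either shortens the lower end of the matched edge or joins an element
  matched downwards to one matched upwards. In the latter case the two lower ends have equal length
  and the label sequences decide; a step along a matched edge keeps its lower end.\<close>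

lemma matching_digraph_potential:
  assumes "(p, q) \<in> matching_digraph (bruhat_interval v w) bruhat_le matched_edges"
  shows "(p, q) \<in> potential_order"
proof (cases "(p, q) \<in> matched_edges")
  case True
  obtain s where s: "maximal_label p s" "(p, q) = label_edge p s"
    using matched_edge_at[OF True, of p] by (auto simp: incident_def)
  note sp = maximal_labelD(1-3)[OF s(1)]
  have neq: "s \<otimes> p \<noteq> p" using sp(3) by (auto simp: up_edge_def down_edge_def)
  then have up: "up_edge p s" "q = s \<otimes> p" using s(2) by (auto simp: label_edge_def split: if_splits)
  then have "maximal_label q s" "\<not> up_edge q s"
    using maximal_label_sym[OF s(1)] down_edge_of_up[OF up(1)] up_down_exclusive by auto
  then have "lower_end q = p" using lower_end_eq[of q s] up sp by simp
  moreover have "lower_end p = p" using lower_end_eq[OF s(1)] up by simp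
  \<comment> \<open>The first two components agree, and the last one drops from 1 at p to 0 at
    q.\<close>
  ultimately show ?thesis using up neq by (simp add: potential_order_def)
next
  case False
  then have h: "(q, p) \<in> hasse_edges (bruhat_interval v w) bruhat_le" "(q, p) \<notin> matched_edges"
    using assms by (auto simp: matching_digraph_def)
  then obtain t where t: "up_edge q t" "t \<otimes> q = p" and P: "p \<in> bruhat_interval v w" "q \<in> bruhat_interval v w"
    by (auto simp: hasse_edges_iff)
  have l: "len p = Suc (len q)" using up_edgeD[OF t(1)] t(2) by simp
  obtain a b where a: "maximal_label p a" and b: "maximal_label q b"
    using maximal_label_exists[OF P(1)] maximal_label_exists[OF P(2)] by blast
  note nba = maximal_labelD(1-3)[OF a]
  note low = lower_end_eq[OF a] lower_end_eq[OF b]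
  show ?thesis
  proof (cases "up_edge p a \<or> \<not> up_edge q b")
    case True
    then have "len (lower_end q) < len (lower_end p)"
      using len_lower_end[OF a] len_lower_end[OF b] l by linarith
    then show ?thesis by (simp add: potential_order_def)
  next
    case F: False
    let ?x = "a \<otimes> p"
    have x: "up_edge ?x a" "a \<otimes> ?x = p" using up_edge_of_down[of p a] F nba by auto
    have "a \<noteq> t"
    proof
      assume "a = t"
      then have "?x = q" using t up_edgeD[OF t(1)] by auto
      then have "maximal_label q t" using maximal_label_sym[OF a] \<open>a = t\<close> by simp
      moreover have "label_edge q t = (q, p)" using t by (simp add: label_edge_def)
      ultimately have "(q, p) \<in> matched_edges"
        unfolding matched_edges_def by (metis (mono_tags, lifting) mem_Collect_eq)
      then show False using h(2) by simp
    qed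
    have max: "maximal_label ?x a" by (rule maximal_label_sym[OF a])
    have v: "bruhat_le v ?x" "bruhat_le v q"
      using maximal_labelD(4) max b by auto
    let ?A = "increasing_labels v ?x" and ?B = "increasing_labels v q"
    note A = increasing_labels[OF v(1)] and B = increasing_labels[OF v(2)]
    have Bt: "chain v (?B @ [t]) p" using B(1) t chain_snoc by blast
    have At: "chain v (?A @ [a]) p" "increasing (?A @ [a])"
      using increasing_labels_snoc[OF max x(1)] x(2) by auto
    have "?B @ [t] \<noteq> ?A @ [a]" using \<open>a \<noteq> t\<close> by simp
    then have lex: "(?A @ [a], ?B @ [t]) \<in> lexord {(a, b). a \<prec> b}"
      using increasing_labels_lex_least[OF _ Bt At] bruhat_le_closed[OF v(1)] by blast
    have "len ?x = len q" using l up_edgeD[OF x(1)] x(2) by simp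
    then have "length ?A = length ?B" using chain_len[OF A(1)] chain_len[OF B(1)] by simp
    moreover have "?A \<noteq> ?B"
    proof
      assume "?A = ?B"
      then have "?x = q" using chain_endpoint_unique[OF A(1)] B(1) by simp
      then have "a \<otimes> q = t \<otimes> q" using x(2) t(2) by simp
      then show False using \<open>a \<noteq> t\<close> nba up_edgeD[OF t(1)] by simp
    qed
    ultimately have "(?A, ?B) \<in> lexord {(a, b). a \<prec> b}" using lexord_sufE[OF lex] by simp
    then show ?thesis using low F \<open>len ?x = len q\<close> by (simp add: potential_order_def)
  qed
qed

lemma matched_edges_acyclic:
  "acyclic (matching_digraph (bruhat_interval v w) bruhat_le matched_edges)"
proof -
  have less: "trans {(a, b). a \<prec> b}"
  proof (rule transI)
    fix x y z assume "(x, y) \<in> {(a, b). a \<prec> b}" "(y, z) \<in> {(a, b). a \<prec> b}"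
    then have "x \<prec> y" "y \<prec> z" by simp_all
    then have "x \<prec> z" by (rule lt_trans)
    then show "(x, z) \<in> {(a, b). a \<prec> b}" by simp
  qed
  have greater: "trans {(i, j). j < (i::nat)}"
    by (auto intro!: transI)
  have "trans potential_order"
    unfolding potential_order_def
    by (intro trans_inv_image trans_lex_prod greater lexord_transI less)
  moreover have "irrefl potential_order"
    using lexord_irreflexive[of "{(a, b). a \<prec> b}"] by (simp add: irrefl_def potential_order_def lt_irrefl)
  ultimately have "acyclic potential_order" by (simp add: acyclic_irrefl)
  moreover have "matching_digraph (bruhat_interval v w) bruhat_le matched_edges \<subseteq> potential_order"
    using matching_digraph_potential by (intro subrelI) simp
  ultimately show ?thesis by (rule acyclic_subset)
qed

text \<open>Labels determine the edges at x, so the choice operator in \<open>max_edge\<close> has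
  the edge of the maximal label as its only candidate, by antisymmetry of R.\<close>

lemma bruhat_matching_eq:
  assumes R: "linear_order_on reflections R" and lt: "lt = strict_part R"
  shows "bruhat_matching R v w = matched_edges"
proof -
  have max_edge: "max_edge R v w x = label_edge x t" if max: "maximal_label x t" for x t
  proof -
    have edges: "interval_edges_at v w x = label_edge x ` {t. neighbour_label v w x t}"
    proof (intro equalityI subsetI)
      fix e assume "e \<in> interval_edges_at v w x"
      then obtain y z where e: "e = (y, z)" "(y, z) \<in> hasse_edges (bruhat_interval v w) bruhat_le"
        "x = y \<or> x = z" by (cases e) (auto simp: interval_edges_at_def incident_def)
      then obtain u where u: "up_edge y u" "u \<otimes> y = z" "y \<in> bruhat_interval v w" "z \<in> bruhat_interval v w"
        using hasse_edges_iff by blast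
      then have "neighbour_label v w y u" "label_edge y u = e"
        using e by (auto simp: neighbour_label_def label_edge_def)
      then show "e \<in> label_edge x ` {t. neighbour_label v w x t}"
        using e(3) u(2) neighbour_label_sym label_edge_sym by (metis image_eqI mem_Collect_eq)
    next
      fix e assume "e \<in> label_edge x ` {t. neighbour_label v w x t}"
      then obtain u where u: "e = label_edge x u" "neighbour_label v w x u" by blast
      then show "e \<in> interval_edges_at v w x"
        using neighbour_label_reflection[OF u(2)] up_edge_of_down[of x u]
        by (auto simp: interval_edges_at_def incident_def label_edge_def hasse_edges_iff neighbour_label_def)
    qed
    have label: "edge_label (label_edge x u) = u" if "neighbour_label v w x u" for u
      using edge_label_label_edge neighbour_label_reflection[OF that] by blast
    have t: "neighbour_label v w x t" "\<And>u. neighbour_label v w x u \<Longrightarrow> u = t \<or> u \<prec> t"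
      using max by (auto simp: maximal_label_def)
    have ref: "(u, u) \<in> R" if "u \<in> reflections" for u
      using R that by (auto simp: order_on_defs refl_on_def)
    show ?thesis unfolding max_edge_def
    proof (rule the_equality)
      have "(u, t) \<in> R" if "neighbour_label v w x u" for u
        using t(2)[OF that] ref neighbour_label_reflection[OF t(1)] lt by (auto simp: strict_part_def)
      then show "label_edge x t \<in> interval_edges_at v w x \<and>
          (\<forall>f\<in>interval_edges_at v w x. (edge_label f, edge_label (label_edge x t)) \<in> R)"
        unfolding edges using t(1) label by auto
    next
      fix e
      assume e: "e \<in> interval_edges_at v w x \<and> (\<forall>f\<in>interval_edges_at v w x. (edge_label f, edge_label e) \<in> R)"
      then obtain u where u: "e = label_edge x u" "neighbour_label v w x u" unfolding edges by blast
      have "label_edge x t \<in> interval_edges_at v w x" unfolding edges using t(1) by blast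
      then have "(edge_label (label_edge x t), edge_label e) \<in> R" using e by blast
      then have "(t, u) \<in> R" using t(1) u label by simp
      then have "\<not> u \<prec> t" using R lt by (auto simp: strict_part_def order_on_defs dest: antisymD)
      then show "e = label_edge x t" using t(2)[OF u(2)] u(1) by blast
    qed
  qed
  show ?thesis
  proof (intro equalityI subsetI)
    fix e assume "e \<in> bruhat_matching R v w"
    then obtain x where x: "x \<in> bruhat_interval v w" "e = max_edge R v w x"
      by (auto simp: bruhat_matching_def)
    then show "e \<in> matched_edges"
      using maximal_label_exists[OF x(1)] max_edge unfolding matched_edges_def by blast
  next
    fix e assume "e \<in> matched_edges"
    then obtain x t where "e = label_edge x t" "maximal_label x t" by (auto simp: matched_edges_def)
    moreover from this have "x \<in> bruhat_interval v w" by (simp add: maximal_label_def neighbour_label_def)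
    ultimately show "e \<in> bruhat_matching R v w" using max_edge by (force simp: bruhat_matching_def)
  qed
qed

end

end

theorem theorem1:
  fixes W :: "('a, 'b) monoid_scheme" (structure)
    and I :: "'a set" and R :: "'a rel" and v w :: 'a
  assumes "coxeter_system W I"
    and "coxeter_system.reflection_order W I R"
    and "v \<in> carrier W" and "w \<in> carrier W"
    and "coxeter_system.bruhat_less W I v w"
  shows "complete_matching (coxeter_system.bruhat_interval W I v w)
           (coxeter_system.bruhat_le W I) (coxeter_system.bruhat_matching W I R v w) \<and>
         acyclic_matching (coxeter_system.bruhat_interval W I v w)
           (coxeter_system.bruhat_le W I) (coxeter_system.bruhat_matching W I R v w)"
proof -
  interpret coxeter_system W I by fact
  interpret coxeter_reflection_order W I "strict_part R"
    by (rule reflection_order_locale[OF assms(2)])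
  have "linear_order_on reflections R" using assms(2) by (simp add: reflection_order_def)
  then have "bruhat_matching R v w = matched_edges v w"
    using bruhat_matching_eq[OF assms(5)] by blast
  then show ?thesis
    using matched_edges_complete_matching[OF assms(5)] matched_edges_acyclic[OF assms(5)]
    by (simp add: acyclic_matching_def complete_matching_def)
qed

end
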